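(* Let $T>0$, $x\in\mathbb R$, let $A,B,Q:[0,T]\to\mathbb R$ be continuous and bounded, let $\sigma:[0,T]\to\mathbb R$ be continuous, and let $D_1,D_2\in\mathbb R$ be constants. Consider the control problem described in the context, with dynamics $dX_t=(A_tX_t+B_tu_t)\,dt+\sigma_t\,dW_t$, $X_0=x$, and cost $J(u)=\mathbb E\big[\int_0^T Q_tu_t^2\,dt\big]+D_1[\mu_T]_2+D_2[\mu_T]_1^2$. Suppose $Q_t>0$ for all $t$, and suppose there exists $\phi=(\phi_1,\phi_2,\phi_3)\in C^1((0,T),\mathbb R^3)$, extending continuously to $[0,T]$, that solves the Riccati system $$\phi_1'(t)-\frac{B_t^2}{Q_t}\phi_1^2(t)+2A_t\phi_1(t)=0,$$ $$\phi_2'(t)-\frac{B_t^2}{Q_t}\phi_2^2(t)-\frac{2B_t^2}{Q_t}\phi_1(t)\phi_2(t)+2A_t\phi_2(t)=0,$$ $$\phi_3'(t)+\sigma_t^2\phi_1(t)=0$$ for all $t\in(0,T)$, with $\phi(T)=(D_1,D_2,0)$. Then the pair $(v,a^* )$ given by $$v(t,\mu)=\phi_1(t)[\mu]_2+\phi_2(t)[\mu]_1^2+\phi_3(t),\qquad a^*(t,\mu,x)=-\frac{B_t}{Q_t}\big(\phi_1(t)x+\phi_2(t)[\mu]_1\big)$$ solves the master equation $$\inf_{a\in\mathcal M(\mathbb R)}\langle H(t,\cdot,\mu,v,a(\cdot)),\mu\rangle+\tfrac12\sigma_t^2\langle\partial_{x\mu}v(t,\mu,\cdot),\mu\rangle+\partial_tv(t,\mu)=0,\qquad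 (t,\mu)\in(0,T)\times\mathcal P_2,$$ with terminal condition $v(T,\mu)=D_1[\mu]_2+D_2[\mu]_1^2$, and the optimality condition $$H(t,x,\mu,v,a^*(t,\mu,x))=\inf_{a\in\mathbb R}H(t,x,\mu,v,a)\qquad\text{for all }(t,\mu,x)\in(0,T)\times\mathcal P_2\times\mathbb R.$$ Moreover, if $J(u^* )=\mathbb E\big[\int_0^TQ_t(u_t^* )^2\,dt\big]+D_1[\mu_T^*]_2+D_2[\mu_T^*]_1^2$ is well defined via a pair $(X^*,u^* )$ satisfying $$X_t^*=x+\int_0^t(A_sX_s^*+B_su_s^* )\,ds+\int_0^t\sigma_s\,dW_s,\qquad t\in[0,T],$$ and $$u_t^*=a^*(t,\mu_t^*,X_t^* ),$$ where $\mu_t^*$ is the law of $X_t^*$, then $(X^*,u^* )$ are an optimal trajectory and an optimal control, i.e. $J(u^* )=V^*:=\inf_{u\in\mathcal U}J(u)$, and the optimal value is $V^*=v(0,\delta_x)$.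
   Context: Measures: for a probability measure $\mu$ on $\mathcal B(\mathbb R)$ and $f:\mathbb R\to\mathbb R$, $\langle f,\mu\rangle:=\int_{\mathbb R}f(x)\,\mu(dx)$ if the integral exists; $[\mu]_m:=\langle x^m,\mu\rangle$ is the $m$th moment; $\mathcal P_m$ is the set of probability measures on $\mathbb R$ with finite $m$th moment; $\delta_x$ is the Dirac measure at $x$. $\mathcal M(\mathbb R)$ is the collection of all real-valued measurable maps on $\mathbb R$. Derivatives: for a function $f$ on $\mathcal P_2$, $\partial_\mu f(\mu,x)$ denotes the L-derivative (Lions derivative), equivalently the intrinsic derivative $\partial_x\frac{\delta f}{\delta\mu}(\mu,x)$, where $\frac{\delta f}{\delta\mu}$ is the linear functional derivative; for example $\partial_\mu\langle\phi,\mu\rangle(x)=\phi'(x)$, and the usual chain and product rules hold. $\partial_{x\mu}f(\mu,x)=\partial_x(\partial_\mu f(\mu,x))$. For time-dependent $f(t,\mu)$ these are applied for fixed $t$, giving $\partial_\mu f(t,\mu,x)$ and $\partial_{x\mu}f(t,\mu,x)$. Control problem: $(\Omega,\mathcal F,\mathbb P,\mathbb F)$, $\mathbb F=(\mathcal F_t)_{t\ge0}$, is a complete filtered probability space satisfying the usual conditions, with an $\mathbb F$-adapted real Brownian motion $W$. A control is an $\mathbb F$-progressively measurable real process $u$ on $[0,T]$; the state is $$X_t=x+\int_0^t(A_sX_s+B_su_s)\,ds+\int_0^t\sigma_s\,dW_s,$$ $\mu_t$ denotes the law of $X_t$, and $$J(u)=\mathbb E\Big[\int_0^TQ_tu_t^2\,dt\Big]+D_1[\mu_T]_2+D_2[\mu_T]_1^2,$$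 where $[\mu_T]_2=\mathbb E[X_T^2]$ and $[\mu_T]_1^2=(\mathbb E[X_T])^2$. A control $u$ is admissible if $u$ together with $(X,J)$ satisfies these two relations and $u_t=a(t,\mu_t,X_t)$ for all $t\in[0,T]$, for some controller $a$ in the feedback form of $(t,\mu_t,X_t)$. The set of admissible controls is $\mathcal U$. Hamiltonian: for $a\in\mathbb R$, $$H(t,x,\mu,v,a)=(A_tx+B_ta)\,\partial_\mu v(t,\mu,x)+Q_ta^2.$$ *)

theory Defs
  imports "HOL-Probability.Probability"
begin

section \<open>Probability measures on the real line\<close>

definition moment :: "nat \<Rightarrow> real measure \<Rightarrow> real" where
  "moment m \<mu> = (LINT y|\<mu>. y ^ m)"

definition prob_moment :: "nat \<Rightarrow> real measure set" where
  "prob_moment m = {\<mu>. prob_space \<mu> \<and> sets \<mu> = sets borel \<and> integrable \<mu> (\<lambda>y. y ^ m)}"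

definition couplings :: "real measure \<Rightarrow> real measure \<Rightarrow> (real \<times> real) measure set" where
  "couplings \<mu> \<nu> = {\<pi>. sets \<pi> = sets (borel \<Otimes>\<^sub>M borel) \<and> distr \<pi> borel fst = \<mu> \<and> distr \<pi> borel snd = \<nu>}"

definition W2 :: "real measure \<Rightarrow> real measure \<Rightarrow> real" where
  "W2 \<mu> \<nu> = sqrt (INF \<pi>\<in>couplings \<mu> \<nu>. LINT p|\<pi>. (fst p - snd p)\<^sup>2)"

definition mixture :: "real \<Rightarrow> real measure \<Rightarrow> real measure \<Rightarrow> real measure" where
  "mixture s \<mu> \<nu> = measure_of UNIV (sets borel)
     (\<lambda>E. ennreal (1 - s) * emeasure \<mu> E + ennreal s * emeasure \<nu> E)"


section \<open>Differentiation on the space of measures with finite second moment\<close>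

text \<open>
  Linear functional derivative of a function on \<open>prob_moment 2\<close>: jointly continuous (for \<open>W2\<close> in
  the measure argument), of at most quadratic growth uniformly over bounded sets of measures, and
  satisfying the fundamental theorem of calculus along segments. Since
  \<open>W2 \<mu> (return borel 0) = sqrt (moment 2 \<mu>)\<close>, bounded sets are those with bounded second moment.
\<close>

definition linear_functional_derivative ::
  "(real measure \<Rightarrow> real) \<Rightarrow> (real measure \<Rightarrow> real \<Rightarrow> real) \<Rightarrow> bool" where
  "linear_functional_derivative f \<delta> \<longleftrightarrow>
     (\<forall>\<mu>\<in>prob_moment 2. \<forall>y. \<forall>\<mu>s ys. (\<forall>n::nat. \<mu>s n \<in> prob_moment 2)
        \<longrightarrow> (\<lambda>n. W2 (\<mu>s n) \<mu>) \<longlonglongrightarrow> 0 \<longrightarrow> ys \<longlonglongrightarrow> y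
        \<longrightarrow> (\<lambda>n. \<delta> (\<mu>s n) (ys n)) \<longlonglongrightarrow> \<delta> \<mu> y) \<and>
     (\<forall>R. \<exists>C. \<forall>\<mu>\<in>prob_moment 2. moment 2 \<mu> \<le> R \<longrightarrow> (\<forall>y. \<bar>\<delta> \<mu> y\<bar> \<le> C * (1 + y\<^sup>2))) \<and>
     (\<forall>\<mu>\<in>prob_moment 2. \<forall>\<nu>\<in>prob_moment 2.
        f \<nu> - f \<mu> = (LINT s:{0..1}|lborel.
          (LINT y|\<nu>. \<delta> (mixture s \<mu> \<nu>) y) - (LINT y|\<mu>. \<delta> (mixture s \<mu> \<nu>) y)))"

text \<open>
  The L-derivative \<open>\<partial>\<^sub>\<mu> f\<close>, as the intrinsic derivative \<open>\<partial>\<^sub>x (\<delta>f/\<delta>\<mu>)\<close>. A linear functional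
  derivative is unique up to adding a function of \<open>\<mu>\<close> alone, which does not affect its spatial
  derivative, so the choice made by \<open>SOME\<close> is immaterial on \<open>prob_moment 2\<close>.
\<close>

definition L_differentiable :: "(real measure \<Rightarrow> real) \<Rightarrow> bool" where
  "L_differentiable f \<longleftrightarrow> (\<exists>\<delta>. linear_functional_derivative f \<delta> \<and>
     (\<forall>\<mu>\<in>prob_moment 2. \<forall>y. \<delta> \<mu> differentiable at y))"

definition L_deriv :: "(real measure \<Rightarrow> real) \<Rightarrow> real measure \<Rightarrow> real \<Rightarrow> real" where
  "L_deriv f \<mu> y = deriv ((SOME \<delta>. linear_functional_derivative f \<delta>) \<mu>) y"

definition L_deriv_x :: "(real measure \<Rightarrow> real) \<Rightarrow> real measure \<Rightarrow> real \<Rightarrow> real" where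
  "L_deriv_x f \<mu> y = deriv (L_deriv f \<mu>) y"


section \<open>The master equation\<close>

definition hamiltonian ::
  "(real \<Rightarrow> real) \<Rightarrow> (real \<Rightarrow> real) \<Rightarrow> (real \<Rightarrow> real) \<Rightarrow>
   real \<Rightarrow> real \<Rightarrow> real measure \<Rightarrow> (real \<Rightarrow> real measure \<Rightarrow> real) \<Rightarrow> real \<Rightarrow> real" where
  "hamiltonian A B Q t y \<mu> v a = (A t * y + B t * a) * L_deriv (v t) \<mu> y + Q t * a\<^sup>2"

text \<open>
  The infimum ranges over the measurable maps for which the integral exists, since the Bochner
  integral of a non-integrable function is \<open>0\<close> by convention. For \<open>Q t > 0\<close> the excluded maps are
  those whose integral is \<open>+\<infinity>\<close>. Infima are taken in \<open>ereal\<close>, where they always exist.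
\<close>

definition inf_mean_hamiltonian ::
  "(real \<Rightarrow> real) \<Rightarrow> (real \<Rightarrow> real) \<Rightarrow> (real \<Rightarrow> real) \<Rightarrow>
   real \<Rightarrow> real measure \<Rightarrow> (real \<Rightarrow> real measure \<Rightarrow> real) \<Rightarrow> ereal" where
  "inf_mean_hamiltonian A B Q t \<mu> v =
     (INF a\<in>{a \<in> borel_measurable borel. integrable \<mu> (\<lambda>y. hamiltonian A B Q t y \<mu> v (a y))}.
        ereal (LINT y|\<mu>. hamiltonian A B Q t y \<mu> v (a y)))"

text \<open>
  \<open>deriv\<close> and the integral are total functions, hence the explicit differentiability and
  integrability requirements.
\<close>

definition solves_master_equation ::
  "real \<Rightarrow> (real \<Rightarrow> real) \<Rightarrow> (real \<Rightarrow> real) \<Rightarrow> (real \<Rightarrow> real) \<Rightarrow> (real \<Rightarrow> real) \<Rightarrow>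
   (real \<Rightarrow> real measure \<Rightarrow> real) \<Rightarrow> bool" where
  "solves_master_equation T A B Q \<sigma> v \<longleftrightarrow>
     (\<forall>t\<in>{0<..<T}. L_differentiable (v t) \<and> (\<forall>\<mu>\<in>prob_moment 2.
        (\<forall>y. L_deriv (v t) \<mu> differentiable at y) \<and>
        integrable \<mu> (L_deriv_x (v t) \<mu>) \<and>
        (\<lambda>s. v s \<mu>) differentiable at t \<and>
        inf_mean_hamiltonian A B Q t \<mu> v
          + ereal (1/2 * (\<sigma> t)\<^sup>2 * (LINT y|\<mu>. L_deriv_x (v t) \<mu> y))
          + ereal (deriv (\<lambda>s. v s \<mu>) t) = 0))"


section \<open>Filtered probability space, Brownian motion and the Ito integral\<close>

locale brownian_space = prob_space M + complete_measure M
  for M :: "'w measure" +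
  fixes F :: "real \<Rightarrow> 'w measure" and W :: "real \<Rightarrow> 'w \<Rightarrow> real"
  assumes F_subalgebra: "0 \<le> t \<Longrightarrow> subalgebra M (F t)"
    and F_mono: "0 \<le> s \<Longrightarrow> s \<le> t \<Longrightarrow> sets (F s) \<subseteq> sets (F t)"
    and F_right_continuous: "0 \<le> t \<Longrightarrow> sets (F t) = (\<Inter>s\<in>{t<..}. sets (F s))"
    and F_null_sets: "null_sets M \<subseteq> sets (F 0)"
    and W_adapted: "0 \<le> t \<Longrightarrow> W t \<in> borel_measurable (F t)"
    and W_0: "AE \<omega> in M. W 0 \<omega> = 0"
    and W_continuous: "AE \<omega> in M. continuous_on {0..} (\<lambda>t. W t \<omega>)"
    and W_normal: "0 \<le> s \<Longrightarrow> s < t \<Longrightarrow>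
      distributed M lborel (\<lambda>\<omega>. W t \<omega> - W s \<omega>) (\<lambda>y. ennreal (normal_density 0 (sqrt (t - s)) y))"
    and W_indep: "0 \<le> s \<Longrightarrow> s < t \<Longrightarrow>
      indep_set (sets (F s)) (sets (vimage_algebra (space M) (\<lambda>\<omega>. W t \<omega> - W s \<omega>) borel))"

definition adapted :: "(real \<Rightarrow> 'w measure) \<Rightarrow> real \<Rightarrow> (real \<Rightarrow> 'w \<Rightarrow> real) \<Rightarrow> bool" where
  "adapted F T X \<longleftrightarrow> (\<forall>t\<in>{0..T}. X t \<in> borel_measurable (F t))"

definition progressively_measurable ::
  "(real \<Rightarrow> 'w measure) \<Rightarrow> real \<Rightarrow> (real \<Rightarrow> 'w \<Rightarrow> real) \<Rightarrow> bool" where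
  "progressively_measurable F T u \<longleftrightarrow>
     (\<forall>t\<in>{0..T}. (\<lambda>(s, \<omega>). u s \<omega>) \<in> borel_measurable (restrict_space borel {0..t} \<Otimes>\<^sub>M F t))"

text \<open>
  The triple \<open>n\<close>, \<open>\<tau>\<close>, \<open>\<xi>\<close> encodes the simple process with value \<open>\<xi> i\<close> on
  \<open>{\<tau> i<..\<tau> (Suc i)}\<close> for \<open>i < n\<close>.
\<close>

definition simple_process ::
  "(real \<Rightarrow> 'w measure) \<Rightarrow> real \<Rightarrow> nat \<Rightarrow> (nat \<Rightarrow> real) \<Rightarrow> (nat \<Rightarrow> 'w \<Rightarrow> real) \<Rightarrow> bool" where
  "simple_process F T n \<tau> \<xi> \<longleftrightarrow>
     0 \<le> \<tau> 0 \<and> (\<forall>i<n. \<tau> i \<le> \<tau> (Suc i)) \<and> \<tau> n \<le> T \<and>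
     (\<forall>i<n. \<xi> i \<in> borel_measurable (F (\<tau> i)) \<and> bounded (\<xi> i ` space (F (\<tau> i))))"

definition simple_value ::
  "nat \<Rightarrow> (nat \<Rightarrow> real) \<Rightarrow> (nat \<Rightarrow> 'w \<Rightarrow> real) \<Rightarrow> real \<Rightarrow> 'w \<Rightarrow> real" where
  "simple_value n \<tau> \<xi> t \<omega> = (\<Sum>i<n. \<xi> i \<omega> * indicator {\<tau> i<..\<tau> (Suc i)} t)"

definition simple_ito_integral ::
  "(real \<Rightarrow> 'w \<Rightarrow> real) \<Rightarrow> nat \<Rightarrow> (nat \<Rightarrow> real) \<Rightarrow> (nat \<Rightarrow> 'w \<Rightarrow> real) \<Rightarrow> real \<Rightarrow> 'w \<Rightarrow> real" where
  "simple_ito_integral W n \<tau> \<xi> t \<omega> =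
     (\<Sum>i<n. \<xi> i \<omega> * (W (min (\<tau> (Suc i)) t) \<omega> - W (min (\<tau> i) t) \<omega>))"

text \<open>
  \<open>I\<close> is (a continuous version of) the process \<open>t \<mapsto> \<integral>\<^sub>0\<^sup>t H dW\<close>, for a square-integrable integrand
  \<open>H\<close>: the mean-square limit of the integrals of simple processes converging to \<open>H\<close>.
\<close>

definition ito_integral ::
  "'w measure \<Rightarrow> (real \<Rightarrow> 'w measure) \<Rightarrow> (real \<Rightarrow> 'w \<Rightarrow> real) \<Rightarrow> real \<Rightarrow>
   (real \<Rightarrow> 'w \<Rightarrow> real) \<Rightarrow> (real \<Rightarrow> 'w \<Rightarrow> real) \<Rightarrow> bool" where
  "ito_integral M F W T H I \<longleftrightarrow>
     adapted F T I \<and> (AE \<omega> in M. continuous_on {0..T} (\<lambda>t. I t \<omega>)) \<and>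
     (\<exists>n \<tau> \<xi>. (\<forall>k::nat. simple_process F T (n k) (\<tau> k) (\<xi> k)) \<and>
       (\<lambda>k. \<integral>\<^sup>+\<omega>. (\<integral>\<^sup>+t\<in>{0..T}. ennreal ((simple_value (n k) (\<tau> k) (\<xi> k) t \<omega> - H t \<omega>)\<^sup>2) \<partial>lborel) \<partial>M)
         \<longlonglongrightarrow> 0 \<and>
       (\<forall>t\<in>{0..T}. (\<lambda>k. \<integral>\<^sup>+\<omega>. ennreal ((simple_ito_integral W (n k) (\<tau> k) (\<xi> k) t \<omega> - I t \<omega>)\<^sup>2) \<partial>M)
         \<longlonglongrightarrow> 0))"


section \<open>The control problem\<close>

definition law :: "'w measure \<Rightarrow> (real \<Rightarrow> 'w \<Rightarrow> real) \<Rightarrow> real \<Rightarrow> real measure" where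
  "law M X t = distr M borel (X t)"

definition state_process ::
  "'w measure \<Rightarrow> (real \<Rightarrow> 'w measure) \<Rightarrow> (real \<Rightarrow> 'w \<Rightarrow> real) \<Rightarrow> real \<Rightarrow> real \<Rightarrow>
   (real \<Rightarrow> real) \<Rightarrow> (real \<Rightarrow> real) \<Rightarrow> (real \<Rightarrow> real) \<Rightarrow>
   (real \<Rightarrow> 'w \<Rightarrow> real) \<Rightarrow> (real \<Rightarrow> 'w \<Rightarrow> real) \<Rightarrow> bool" where
  "state_process M F W T x A B \<sigma> u X \<longleftrightarrow>
     adapted F T X \<and>
     (AE \<omega> in M. set_integrable lborel {0..T} (\<lambda>s. A s * X s \<omega> + B s * u s \<omega>)) \<and>
     (\<exists>I. ito_integral M F W T (\<lambda>t \<omega>. \<sigma> t) I \<and>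
       (AE \<omega> in M. \<forall>t\<in>{0..T}.
          X t \<omega> = x + (LINT s:{0..t}|lborel. A s * X s \<omega> + B s * u s \<omega>) + I t \<omega>))"

definition cost_well_defined ::
  "'w measure \<Rightarrow> real \<Rightarrow> (real \<Rightarrow> real) \<Rightarrow>
   (real \<Rightarrow> 'w \<Rightarrow> real) \<Rightarrow> (real \<Rightarrow> 'w \<Rightarrow> real) \<Rightarrow> bool" where
  "cost_well_defined M T Q u X \<longleftrightarrow>
     (\<integral>\<^sup>+\<omega>. (\<integral>\<^sup>+t\<in>{0..T}. ennreal (Q t * (u t \<omega>)\<^sup>2) \<partial>lborel) \<partial>M) < \<infinity> \<and>
     law M X T \<in> prob_moment 2"

definition cost ::
  "'w measure \<Rightarrow> real \<Rightarrow> (real \<Rightarrow> real) \<Rightarrow> real \<Rightarrow> real \<Rightarrow>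
   (real \<Rightarrow> 'w \<Rightarrow> real) \<Rightarrow> (real \<Rightarrow> 'w \<Rightarrow> real) \<Rightarrow> real" where
  "cost M T Q D1 D2 u X =
     (LINT \<omega>|M. (LINT t:{0..T}|lborel. Q t * (u t \<omega>)\<^sup>2))
       + D1 * moment 2 (law M X T) + D2 * (moment 1 (law M X T))\<^sup>2"

text \<open>
  \<open>u\<close> determines its state process up to indistinguishability, hence determines the cost.
\<close>

definition J ::
  "'w measure \<Rightarrow> (real \<Rightarrow> 'w measure) \<Rightarrow> (real \<Rightarrow> 'w \<Rightarrow> real) \<Rightarrow> real \<Rightarrow> real \<Rightarrow>
   (real \<Rightarrow> real) \<Rightarrow> (real \<Rightarrow> real) \<Rightarrow> (real \<Rightarrow> real) \<Rightarrow> (real \<Rightarrow> real) \<Rightarrow> real \<Rightarrow> real \<Rightarrow>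
   (real \<Rightarrow> 'w \<Rightarrow> real) \<Rightarrow> real" where
  "J M F W T x A B \<sigma> Q D1 D2 u =
     (THE j. \<exists>X. state_process M F W T x A B \<sigma> u X \<and> cost_well_defined M T Q u X \<and>
        j = cost M T Q D1 D2 u X)"

definition feedback_form ::
  "'w measure \<Rightarrow> real \<Rightarrow> (real \<Rightarrow> real measure \<Rightarrow> real \<Rightarrow> real) \<Rightarrow>
   (real \<Rightarrow> 'w \<Rightarrow> real) \<Rightarrow> (real \<Rightarrow> 'w \<Rightarrow> real) \<Rightarrow> bool" where
  "feedback_form M T a u X \<longleftrightarrow> (\<forall>t\<in>{0..T}. AE \<omega> in M. u t \<omega> = a t (law M X t) (X t \<omega>))"

definition admissible_controls ::
  "'w measure \<Rightarrow> (real \<Rightarrow> 'w measure) \<Rightarrow> (real \<Rightarrow> 'w \<Rightarrow> real) \<Rightarrow> real \<Rightarrow> real \<Rightarrow>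
   (real \<Rightarrow> real) \<Rightarrow> (real \<Rightarrow> real) \<Rightarrow> (real \<Rightarrow> real) \<Rightarrow> (real \<Rightarrow> real) \<Rightarrow>
   (real \<Rightarrow> 'w \<Rightarrow> real) set" where
  "admissible_controls M F W T x A B \<sigma> Q =
     {u. progressively_measurable F T u \<and>
       (\<exists>X a. state_process M F W T x A B \<sigma> u X \<and> cost_well_defined M T Q u X \<and>
         (\<forall>t \<mu>. a t \<mu> \<in> borel_measurable borel) \<and> feedback_form M T a u X)}"

definition optimal_value ::
  "'w measure \<Rightarrow> (real \<Rightarrow> 'w measure) \<Rightarrow> (real \<Rightarrow> 'w \<Rightarrow> real) \<Rightarrow> real \<Rightarrow> real \<Rightarrow>
   (real \<Rightarrow> real) \<Rightarrow> (real \<Rightarrow> real) \<Rightarrow> (real \<Rightarrow> real) \<Rightarrow> (real \<Rightarrow> real) \<Rightarrow> real \<Rightarrow> real \<Rightarrow> ereal" where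
  "optimal_value M F W T x A B \<sigma> Q D1 D2 =
     (INF u\<in>admissible_controls M F W T x A B \<sigma> Q. ereal (J M F W T x A B \<sigma> Q D1 D2 u))"

end

theory Submission
  imports Defs
begin

text \<open>
  The value function is guessed to be quadratic, and two independent computations confirm the guess.

  The first is static. The L-derivative of \<open>p \<langle>y\<^sup>2, \<mu>\<rangle> + q \<langle>y, \<mu>\<rangle>\<^sup>2\<close> is \<open>2 (p y + q \<langle>y, \<mu>\<rangle>)\<close>. The definition
  selects an arbitrary linear functional derivative, so one has to know that all of them have the same
  spatial derivative: \<open>directional_derivative_mixture\<close> identifies any of them, up to a constant, as a directional
  derivative of the function. Then the Hamiltonian is a parabola in the control, minimised by
  \<open>a_star\<close> (\<open>hamiltonian_minimizer\<close>), and comparing coefficients of the two moments turns the master equation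
  into the Riccati system (\<open>quadratic_solves_master_equation\<close>).

  The second is dynamic. For any state \<open>X\<close> of finite cost, the mean and the second moment satisfy
  linear integral equations (\<open>mean_eq\<close>, \<open>second_moment_eq\<close>). Multiplying them with \<open>\<phi>2\<close> and \<open>\<phi>1\<close> and completing
  the square gives the identity

    cost of \<open>u\<close>  =  \<open>v 0 (return borel x)\<close>  +  \<open>E \<integral> Q (u - a_star)\<^sup>2 dt\<close>

  of \<open>completed_square_cost\<close>. So no control is cheaper than \<open>v 0 (return borel x)\<close>, and a control in the feedback form
  \<open>a_star\<close> attains this value.

  Ito's formula is replaced by Fubini's theorem. The difference \<open>Y\<close> between the state and the Ito integral \<open>I\<close> of
  \<open>\<sigma>\<close> is an indefinite integral on each path, and the mixed term \<open>E (Y I)\<close> only involves the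
  orthogonality of the increments of \<open>I\<close> to the past. The isometry and this orthogonality hold for
  simple processes by the independence of Brownian increments and pass to the limit (\<open>ito_isometry\<close>,
  \<open>ito_martingale\<close>). As the approximating sequence of an Ito integral is not fixed, the isometry is
  proved in polarised form for two sequences; this also shows that the integral, and with it
  the state and the cost of a control, is unique (\<open>ito_integral_unique\<close>, \<open>state_process_unique\<close>). Square-integrability of the
  state follows from Gronwall's inequality on each path.
\<close>

section \<open>Mixtures and the Wasserstein distance\<close>

lemma prob_moment_2D:
  assumes "\<mu> \<in> prob_moment 2"
  shows "integrable \<mu> (\<lambda>y. y)" "integrable \<mu> (\<lambda>y. y\<^sup>2)" "prob_space \<mu>" "sets \<mu> = sets borel"
    "space \<mu> = UNIV"
proof -
  show p: "prob_space \<mu>" and s: "sets \<mu> = sets borel" and i: "integrable \<mu> (\<lambda>y. y\<^sup>2)"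
    using assms by (auto simp: prob_moment_def)
  interpret prob_space \<mu> by fact
  have [measurable]: "(\<lambda>y. y) \<in> borel_measurable \<mu>"
    using s by (simp add: measurable_ident_sets)
  show "integrable \<mu> (\<lambda>y. y)"
    by (rule square_integrable_imp_integrable) (use i in auto)
  show "space \<mu> = UNIV" using sets_eq_imp_space_eq[OF s] by simp
qed

lemma space_mixture [simp]: "space (mixture s \<mu> \<nu>) = UNIV"
  by (simp add: mixture_def space_measure_of_conv)

lemma sets_mixture [simp, measurable_cong]: "sets (mixture s \<mu> \<nu>) = sets borel"
  unfolding mixture_def
  by (metis sets.sigma_sets_eq sets_measure_of sets.space_closed space_borel)

lemma emeasure_mixture:
  assumes [measurable_cong]: "sets \<mu> = sets borel" "sets \<nu> = sets borel" and E: "E \<in> sets borel"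
  shows "emeasure (mixture s \<mu> \<nu>) E = ennreal (1 - s) * emeasure \<mu> E + ennreal s * emeasure \<nu> E"
  unfolding mixture_def
proof (rule emeasure_measure_of_sigma)
  show "sigma_algebra UNIV (sets (borel :: real measure))"
    by (metis sets.sigma_algebra_axioms space_borel)
  show "positive (sets borel) (\<lambda>E. ennreal (1 - s) * emeasure \<mu> E + ennreal s * emeasure \<nu> E)"
    by (simp add: positive_def)
  show "countably_additive (sets borel) (\<lambda>E. ennreal (1 - s) * emeasure \<mu> E + ennreal s * emeasure \<nu> E)"
    by (auto simp: countably_additive_def suminf_emeasure assms suminf_add[symmetric])
qed fact

text \<open>
  A mixture is a weighted sum of two measures, so integration against it is the same weighted sum of
  integrals: this is the definition on sets, extended by the usual induction over nonnegative functions.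
\<close>

lemma nn_integral_mixture:
  assumes [measurable_cong]: "sets \<mu> = sets borel" "sets \<nu> = sets borel"
    and f: "f \<in> borel_measurable borel"
  shows "(\<integral>\<^sup>+y. f y \<partial>mixture s \<mu> \<nu>) = ennreal (1 - s) * (\<integral>\<^sup>+y. f y \<partial>\<mu>) + ennreal s * (\<integral>\<^sup>+y. f y \<partial>\<nu>)"
  using f
proof (induction rule: borel_measurable_induct)
  case (cong f g)
  then show ?case by (auto intro: nn_integral_cong)
next
  case (set A)
  then show ?case by (simp add: emeasure_mixture[OF assms(1,2)] assms)
next
  case (mult u c)
  then show ?case by (simp add: nn_integral_cmult distrib_left ac_simps)
next
  case (add u v)
  then show ?case by (simp add: nn_integral_add distrib_left ac_simps)
next
  case (seq U)
  have inc: "incseq (\<lambda>i. \<integral>\<^sup>+ y. U i y \<partial>\<mu>)" "incseq (\<lambda>i. \<integral>\<^sup>+ y. U i y \<partial>\<nu>)"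
    using seq(3) by (auto simp: incseq_def le_fun_def intro!: nn_integral_mono)
  have [measurable]: "\<And>i. U i \<in> borel_measurable borel" by fact
  have eq: "\<And>y. (SUP i. U i) y = (SUP i. U i y)" by (simp add: image_comp)
  show ?case unfolding eq
    using seq(4) inc seq(3)
    by (simp add: nn_integral_monotone_convergence_SUP SUP_mult_left_ennreal seq(5) image_comp comp_def)
      (subst ennreal_SUP_add; auto simp: incseq_def intro!: mult_left_mono)
qed

lemma
  assumes s: "0 \<le> s" "s \<le> 1" and [measurable_cong]: "sets \<mu> = sets borel" "sets \<nu> = sets borel"
    and i: "integrable \<mu> f" "integrable \<nu> f"
  shows integrable_mixture: "integrable (mixture s \<mu> \<nu>) f"
    and integral_mixture: "(LINT y|mixture s \<mu> \<nu>. f y) = (1 - s) * (LINT y|\<mu>. f y) + s * (LINT y|\<nu>. f y :: real)"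
proof -
  have [measurable]: "f \<in> borel_measurable borel"
    using borel_measurable_integrable[OF i(1)] assms(3) by (simp cong: measurable_cong_sets)
  note nn = nn_integral_mixture[OF assms(3,4)]
  have fin: "(\<integral>\<^sup>+y. ennreal (norm (f y)) \<partial>\<mu>) < \<infinity>" "(\<integral>\<^sup>+y. ennreal (norm (f y)) \<partial>\<nu>) < \<infinity>"
    using i by (auto simp: integrable_iff_bounded)
  show int: "integrable (mixture s \<mu> \<nu>) f"
    unfolding integrable_iff_bounded using fin by (auto simp: nn ennreal_mult_less_top)
  have fin2: "(\<integral>\<^sup>+y. ennreal (f y) \<partial>\<mu>) < \<infinity>" "(\<integral>\<^sup>+y. ennreal (f y) \<partial>\<nu>) < \<infinity>"
     "(\<integral>\<^sup>+y. ennreal (- f y) \<partial>\<mu>) < \<infinity>" "(\<integral>\<^sup>+y. ennreal (- f y) \<partial>\<nu>) < \<infinity>"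
    by (rule le_less_trans[OF _ fin(1)] le_less_trans[OF _ fin(2)],
        intro nn_integral_mono ennreal_leI, simp)+
  have e: "enn2real (ennreal (1 - s) * a + ennreal s * b) = (1 - s) * enn2real a + s * enn2real b"
    if "a < \<infinity>" "b < \<infinity>" for a b
    using that s by (simp add: enn2real_plus ennreal_mult_less_top enn2real_mult)
  show "(LINT y|mixture s \<mu> \<nu>. f y) = (1 - s) * (LINT y|\<mu>. f y) + s * (LINT y|\<nu>. f y)"
    unfolding real_lebesgue_integral_def[OF int] real_lebesgue_integral_def[OF i(1)]
      real_lebesgue_integral_def[OF i(2)]
    using fin2 by (simp add: nn e) (simp add: algebra_simps)
qed

lemma mixture_prob_moment:
  assumes s: "0 \<le> s" "s \<le> 1" and \<mu>: "\<mu> \<in> prob_moment 2" and \<nu>: "\<nu> \<in> prob_moment 2"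
  shows "mixture s \<mu> \<nu> \<in> prob_moment 2"
    and "moment 1 (mixture s \<mu> \<nu>) = (1 - s) * moment 1 \<mu> + s * moment 1 \<nu>"
    and "moment 2 (mixture s \<mu> \<nu>) = (1 - s) * moment 2 \<mu> + s * moment 2 \<nu>"
proof -
  note m = prob_moment_2D[OF \<mu>] and n = prob_moment_2D[OF \<nu>]
  have "emeasure (mixture s \<mu> \<nu>) UNIV = ennreal (1 - s) * 1 + ennreal s * 1"
    using m n emeasure_mixture[OF m(4) n(4), of UNIV s]
     prob_space.emeasure_space_1[OF m(3)] prob_space.emeasure_space_1[OF n(3)] by simp
  also have "\<dots> = 1" using s by (simp add: ennreal_plus[symmetric] del: ennreal_plus)
  finally have "prob_space (mixture s \<mu> \<nu>)" by (auto intro: prob_spaceI)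
  then show "mixture s \<mu> \<nu> \<in> prob_moment 2"
    using integrable_mixture[OF s m(4) n(4) m(2) n(2)] by (simp add: prob_moment_def)
  show "moment 1 (mixture s \<mu> \<nu>) = (1 - s) * moment 1 \<mu> + s * moment 1 \<nu>"
    using integral_mixture[OF s m(4) n(4) m(1) n(1)] by (simp add: moment_def)
  show "moment 2 (mixture s \<mu> \<nu>) = (1 - s) * moment 2 \<mu> + s * moment 2 \<nu>"
    using integral_mixture[OF s m(4) n(4) m(2) n(2)] by (simp add: moment_def)
qed

text \<open>
  Moving a fraction \<open>s\<close> of the way towards a point that is itself a fraction \<open>\<epsilon>\<close> of the way towards \<open>\<nu>\<close>
  moves \<open>s \<epsilon>\<close> of the way towards \<open>\<nu>\<close>. The segment from \<open>\<mu>\<close> to a mixture is thus an initial piece of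
  the segment from \<open>\<mu>\<close> to \<open>\<nu>\<close>, which is what allows one to shrink it towards \<open>\<mu>\<close>.
\<close>

lemma mixture_mixture:
  assumes s: "0 \<le> s" "s \<le> 1" and e: "0 \<le> \<epsilon>" "\<epsilon> \<le> 1"
    and [simp]: "sets \<mu> = sets borel" "sets \<nu> = sets borel"
  shows "mixture s \<mu> (mixture \<epsilon> \<mu> \<nu>) = mixture (s * \<epsilon>) \<mu> \<nu>"
proof (rule measure_eqI)
  fix E assume "E \<in> sets (mixture s \<mu> (mixture \<epsilon> \<mu> \<nu>))"
  then have E: "E \<in> sets borel" by simp
  have "ennreal (1 - s) + ennreal s * ennreal (1 - \<epsilon>) = ennreal (1 - s * \<epsilon>)"
    using s e mult_left_le[of \<epsilon> s]
    by (simp add: ennreal_plus[symmetric] ennreal_mult[symmetric] algebra_simps del: ennreal_plus)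
  then have "ennreal (1 - s) * a + ennreal s * (ennreal (1 - \<epsilon>) * a + ennreal \<epsilon> * b)
      = ennreal (1 - s * \<epsilon>) * a + ennreal (s * \<epsilon>) * b" for a b
    using s e by (simp add: ennreal_mult distrib_left distrib_right[symmetric] mult.assoc[symmetric] add.assoc[symmetric])
  then show "emeasure (mixture s \<mu> (mixture \<epsilon> \<mu> \<nu>)) E = emeasure (mixture (s * \<epsilon>) \<mu> \<nu>) E"
    by (simp add: emeasure_mixture E)
qed simp

lemma mixture_0: "sets \<mu> = sets borel \<Longrightarrow> sets \<nu> = sets borel \<Longrightarrow> mixture 0 \<mu> \<nu> = \<mu>"
  by (rule measure_eqI) (simp_all add: emeasure_mixture)

lemma return_prob_moment:
  "return borel y \<in> prob_moment m" "moment m (return borel y) = y ^ m" for y :: real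
proof -
  have "has_bochner_integral (return borel y) (\<lambda>z. z ^ m) (y ^ m)"
    by (simp add: has_bochner_integral_iff integral_return integrable_iff_bounded nn_integral_return)
  then show "return borel y \<in> prob_moment m" "moment m (return borel y) = y ^ m"
    by (auto simp: prob_moment_def moment_def has_bochner_integral_iff prob_space_return)
qed

lemma W2_le:
  assumes "\<pi> \<in> couplings \<mu> \<nu>"
  shows "W2 \<mu> \<nu> \<le> sqrt (LINT p|\<pi>. (fst p - snd p)\<^sup>2)"
  unfolding W2_def
  by (intro real_sqrt_le_mono cINF_lower assms) (auto intro!: bdd_belowI2[of _ 0])

text \<open>
  Under any coupling the difference of the means is the mean of the difference, and Jensen's inequality
  bounds its square by the cost of the coupling. The product coupling shows that the infimum in \<open>W2\<close> is
  over a nonempty set; the infimum of an empty set of reals would carry no information.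
\<close>

lemma moment1_diff_le_W2:
  assumes \<mu>: "\<mu> \<in> prob_moment 2" and \<nu>: "\<nu> \<in> prob_moment 2"
  shows "\<bar>moment 1 \<mu> - moment 1 \<nu>\<bar> \<le> W2 \<mu> \<nu>"
proof -
  note m = prob_moment_2D[OF \<mu>] and n = prob_moment_2D[OF \<nu>]
  interpret m: prob_space \<mu> by fact
  interpret n: prob_space \<nu> by fact
  interpret mn: pair_prob_space \<mu> \<nu> ..
  have [measurable]: "fst \<in> measurable (\<mu> \<Otimes>\<^sub>M \<nu>) borel" "snd \<in> measurable (\<mu> \<Otimes>\<^sub>M \<nu>) borel"
    by (simp_all cong: measurable_cong_sets add: m n)
  \<comment> \<open>the product measure couples \<open>\<mu>\<close> and \<open>\<nu>\<close>\<close>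
  have "distr (\<mu> \<Otimes>\<^sub>M \<nu>) borel fst = \<mu>"
  proof (rule measure_eqI)
    fix E assume "E \<in> sets (distr (\<mu> \<Otimes>\<^sub>M \<nu>) borel fst)"
    then have E: "E \<in> sets borel" by simp
    have "fst -` E \<inter> space (\<mu> \<Otimes>\<^sub>M \<nu>) = E \<times> space \<nu>" by (auto simp: space_pair_measure m n)
    then show "emeasure (distr (\<mu> \<Otimes>\<^sub>M \<nu>) borel fst) E = emeasure \<mu> E"
      using E m n n.emeasure_space_1 by (simp add: emeasure_distr n.emeasure_pair_measure_Times)
  qed (simp add: m)
  moreover have "distr (\<mu> \<Otimes>\<^sub>M \<nu>) borel snd = \<nu>"
  proof (rule measure_eqI)
    fix E assume "E \<in> sets (distr (\<mu> \<Otimes>\<^sub>M \<nu>) borel snd)"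
    then have E: "E \<in> sets borel" by simp
    have "snd -` E \<inter> space (\<mu> \<Otimes>\<^sub>M \<nu>) = space \<mu> \<times> E" by (auto simp: space_pair_measure m n)
    then show "emeasure (distr (\<mu> \<Otimes>\<^sub>M \<nu>) borel snd) E = emeasure \<nu> E"
      using E m n m.emeasure_space_1 by (simp add: emeasure_distr n.emeasure_pair_measure_Times)
  qed (simp add: n)
  ultimately have "\<mu> \<Otimes>\<^sub>M \<nu> \<in> couplings \<mu> \<nu>"
    by (auto simp: couplings_def m n intro!: sets_pair_measure_cong)
  then have ne: "couplings \<mu> \<nu> \<noteq> {}" by auto
  have "\<bar>moment 1 \<mu> - moment 1 \<nu>\<bar>\<^sup>2 \<le> (LINT p|\<pi>. (fst p - snd p)\<^sup>2)" if \<pi>: "\<pi> \<in> couplings \<mu> \<nu>" for \<pi>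
  proof -
    have s [measurable_cong]: "sets \<pi> = sets (borel \<Otimes>\<^sub>M borel)"
      and d: "distr \<pi> borel fst = \<mu>" "distr \<pi> borel snd = \<nu>"
      using \<pi> by (auto simp: couplings_def)
    have fst_borel [measurable]: "fst \<in> measurable \<pi> borel"
      and snd_borel [measurable]: "snd \<in> measurable \<pi> borel" by measurable
    have "emeasure \<pi> (space \<pi>) = emeasure (distr \<pi> borel fst) UNIV"
      by (subst emeasure_distr) auto
    also have "\<dots> = 1"
      unfolding d using m.emeasure_space_1 m(5) by simp
    finally interpret p: prob_space \<pi>
      by (rule prob_spaceI)
    have i: "integrable \<pi> (\<lambda>p. fst p)" "integrable \<pi> (\<lambda>p. (fst p)\<^sup>2)"
       "integrable \<pi> (\<lambda>p. snd p)" "integrable \<pi> (\<lambda>p. (snd p)\<^sup>2)"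
      by (rule integrable_distr[OF fst_borel, unfolded d, OF m(1)]
            integrable_distr[OF fst_borel, unfolded d, OF m(2)]
            integrable_distr[OF snd_borel, unfolded d, OF n(1)]
            integrable_distr[OF snd_borel, unfolded d, OF n(2)])+
    have i2: "integrable \<pi> (\<lambda>p. (fst p - snd p)\<^sup>2)"
    proof (rule Bochner_Integration.integrable_bound)
      show "integrable \<pi> (\<lambda>p. 2 * (fst p)\<^sup>2 + 2 * (snd p)\<^sup>2)" using i by simp
      have "(a - b)\<^sup>2 \<le> 2 * a\<^sup>2 + 2 * b\<^sup>2" for a b :: real
        using zero_le_power2[of "a + b"] by (simp add: power2_sum power2_diff)
      then show "AE p in \<pi>. norm ((fst p - snd p)\<^sup>2) \<le> norm (2 * (fst p)\<^sup>2 + 2 * (snd p)\<^sup>2)"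
        by simp
    qed simp
    have "moment 1 \<mu> - moment 1 \<nu> = (LINT p|\<pi>. fst p - snd p)"
      unfolding moment_def using i
        integral_distr[OF fst_borel, of "\<lambda>y. y ^ 1"] integral_distr[OF snd_borel, of "\<lambda>y. y ^ 1"]
      by (simp add: d)
    then show ?thesis
      using p.variance_positive[of "\<lambda>p. fst p - snd p"]
        p.variance_eq[OF Bochner_Integration.integrable_diff[OF i(1) i(3)] i2]
      by (simp only: power2_abs)
  qed
  then have "\<bar>moment 1 \<mu> - moment 1 \<nu>\<bar>\<^sup>2 \<le> (INF \<pi>\<in>couplings \<mu> \<nu>. LINT p|\<pi>. (fst p - snd p)\<^sup>2)"
    by (intro cINF_greatest ne)
  then show ?thesis unfolding W2_def by (metis abs_ge_zero real_le_rsqrt)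
qed


text \<open>
  Lebesgue measure on \<open>[0, T]\<close>. Being a finite measure with space \<open>{0..T}\<close>, it lets the time integral
  enter Fubini's theorem without indicator functions.
\<close>

abbreviation Leb :: "real \<Rightarrow> real measure" where
  "Leb T \<equiv> restrict_space lborel {0..T}"

lemma integrable_pair_mult:
  fixes f g :: "_ \<Rightarrow> real"
  assumes "pair_sigma_finite M N" and f: "integrable M f" and g: "integrable N g"
  shows "integrable (M \<Otimes>\<^sub>M N) (\<lambda>p. f (fst p) * g (snd p))"
proof -
  interpret pair_sigma_finite M N by fact
  have [measurable]: "f \<in> borel_measurable M" "g \<in> borel_measurable N" using f g by auto
  show ?thesis
    by (rule Fubini_integrable) (use f g in \<open>auto simp: abs_mult\<close>)
qed

lemma prob_space_Leb1: "prob_space (Leb 1)"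
  by (rule prob_spaceI) (simp add: space_restrict_space emeasure_restrict_space)

text \<open>
  All mixtures of \<open>\<mu>\<close> with the point mass at \<open>y\<close> live on one probability space: with \<open>U\<close> uniform on
  \<open>[0, 1]\<close> and \<open>Z\<close> of law \<open>\<mu>\<close>, independent, the variable that is \<open>y\<close> if \<open>U < r\<close> and \<open>Z\<close> otherwise has law
  \<open>mixture r \<mu> (return borel y)\<close>. For two values of \<open>r\<close> these variables differ only when \<open>U\<close> lies
  between them, an event of probability \<open>\<bar>r - r'\<bar>\<close> that is independent of \<open>Z\<close>.
\<close>

lemma W2_mixture_return:
  assumes \<mu>: "\<mu> \<in> prob_moment 2" and r: "r \<in> {0..1}" "r' \<in> {0..1}"
  shows "W2 (mixture r \<mu> (return borel y)) (mixture r' \<mu> (return borel y))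
    \<le> sqrt (\<bar>r - r'\<bar> * (LINT z|\<mu>. (y - z)\<^sup>2))"
proof -
  note m = prob_moment_2D[OF \<mu>]
  interpret m: prob_space \<mu> by fact
  interpret u: prob_space "Leb 1" by (rule prob_space_Leb1)
  interpret mu: pair_prob_space "Leb 1" \<mu> ..
  define Z :: "real \<Rightarrow> real \<times> real \<Rightarrow> real" where "Z = (\<lambda>s p. if fst p < s then y else snd p)"
  have mb [measurable_cong]: "sets \<mu> = sets borel" by fact
  have [measurable]: "fst \<in> borel_measurable (Leb 1 \<Otimes>\<^sub>M \<mu>)"
    by (rule measurable_compose[OF measurable_fst]) (simp add: measurable_restrict_space1)
  have [measurable]: "snd \<in> borel_measurable (Leb 1 \<Otimes>\<^sub>M \<mu>)"
    by (rule measurable_compose[OF measurable_snd]) (simp add: measurable_ident_sets mb)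
  have Zm [measurable]: "Z s \<in> borel_measurable (Leb 1 \<Otimes>\<^sub>M \<mu>)" for s
    unfolding Z_def by measurable
  have Z: "distr (Leb 1 \<Otimes>\<^sub>M \<mu>) borel (Z s) = mixture s \<mu> (return borel y)" if s: "s \<in> {0..1}" for s
  proof (rule measure_eqI)
    fix E assume "E \<in> sets (distr (Leb 1 \<Otimes>\<^sub>M \<mu>) borel (Z s))"
    then have E [measurable]: "E \<in> sets borel" by simp
    have dec: "Z s -` E \<inter> space (Leb 1 \<Otimes>\<^sub>M \<mu>) =
      ({0..<s} \<times> (if y \<in> E then UNIV else {})) \<union> ({s..1} \<times> E)"
      using s m(5) by (auto simp: space_pair_measure Z_def space_restrict_space split: if_splits)
    have S: "{0..<s} \<in> sets (Leb 1)" "{s..1} \<in> sets (Leb 1)"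
      using s by (auto simp: sets_restrict_space_iff)
    have "emeasure (distr (Leb 1 \<Otimes>\<^sub>M \<mu>) borel (Z s)) E =
      emeasure (Leb 1 \<Otimes>\<^sub>M \<mu>) ({0..<s} \<times> (if y \<in> E then UNIV else {})) + emeasure (Leb 1 \<Otimes>\<^sub>M \<mu>) ({s..1} \<times> E)"
      unfolding emeasure_distr[OF Zm E] dec
      using S m by (intro plus_emeasure[symmetric]) (auto simp: mb)
    also have "\<dots> = ennreal s * indicator E y + ennreal (1 - s) * emeasure \<mu> E"
    proof -
      have "emeasure (Leb 1) {0..<s} = ennreal s" "emeasure (Leb 1) {s..1} = ennreal (1 - s)"
      proof -
        have "{0..<s} \<subseteq> {0..1}" "{s..1} \<subseteq> {0..1}" using s by auto
        then show "emeasure (Leb 1) {0..<s} = ennreal s" "emeasure (Leb 1) {s..1} = ennreal (1 - s)"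
          using s by (subst emeasure_restrict_space; simp)+
      qed
      then show ?thesis
        using S E m.emeasure_space_1 by (auto simp: m.emeasure_pair_measure_Times mb m(5))
    qed
    also have "\<dots> = emeasure (mixture s \<mu> (return borel y)) E"
      using mb E by (simp add: emeasure_mixture add.commute)
    finally show "emeasure (distr (Leb 1 \<Otimes>\<^sub>M \<mu>) borel (Z s)) E = emeasure (mixture s \<mu> (return borel y)) E" .
  qed simp
  define \<pi> where "\<pi> = distr (Leb 1 \<Otimes>\<^sub>M \<mu>) (borel \<Otimes>\<^sub>M borel) (\<lambda>p. (Z r p, Z r' p))"
  have "\<pi> \<in> couplings (mixture r \<mu> (return borel y)) (mixture r' \<mu> (return borel y))"
    using Z[OF r(1)] Z[OF r(2)]
    by (simp add: couplings_def \<pi>_def distr_distr comp_def)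
  then have "W2 (mixture r \<mu> (return borel y)) (mixture r' \<mu> (return borel y))
      \<le> sqrt (LINT p|\<pi>. (fst p - snd p)\<^sup>2)"
    by (rule W2_le)
  also have "(LINT p|\<pi>. (fst p - snd p)\<^sup>2) = (LINT p|(Leb 1 \<Otimes>\<^sub>M \<mu>). (Z r p - Z r' p)\<^sup>2)"
    unfolding \<pi>_def by (subst integral_distr) auto
  also have "\<dots> = (LINT p|(Leb 1 \<Otimes>\<^sub>M \<mu>). indicator {min r r'..<max r r'} (fst p) * (y - snd p)\<^sup>2)"
    by (intro Bochner_Integration.integral_cong) (auto simp: Z_def indicator_def power2_commute split: if_splits)
  also have "\<dots> = (LINT u|(Leb 1). (LINT z|\<mu>. indicator {min r r'..<max r r'} u * (y - z)\<^sup>2))"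
  proof (subst mu.integral_fst'[symmetric])
    have "integrable \<mu> (\<lambda>z. (y - z)\<^sup>2)"
      unfolding power2_diff using m by auto
    then have *: "integrable (Leb 1 \<Otimes>\<^sub>M \<mu>) (\<lambda>p. (y - snd p)\<^sup>2)"
      using integrable_pair_mult[OF mu.pair_sigma_finite_axioms, of "\<lambda>_. 1"] by simp
    show "integrable (Leb 1 \<Otimes>\<^sub>M \<mu>) (\<lambda>p. indicator {min r r'..<max r r'} (fst p) * (y - snd p)\<^sup>2)"
    proof (rule Bochner_Integration.integrable_bound[OF *])
      show "AE p in Leb 1 \<Otimes>\<^sub>M \<mu>. norm (indicator {min r r'..<max r r'} (fst p) * (y - snd p)\<^sup>2) \<le> norm ((y - snd p)\<^sup>2)"
        by (auto simp: indicator_def)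
    qed measurable
  qed simp
  also have "\<dots> = (LINT u|(Leb 1). indicator {min r r'..<max r r'} u) * (LINT z|\<mu>. (y - z)\<^sup>2)"
    by simp
  also have "(LINT u|(Leb 1). indicator {min r r'..<max r r'} u) = \<bar>r - r'\<bar>"
  proof -
    have sub: "{min r r'..<max r r'} \<subseteq> {0..1}" using r by auto
    have "(LINT u|(Leb 1). indicator {min r r'..<max r r'} u) = measure lborel {min r r'..<max r r'}"
      using sub by (simp add: space_restrict_space Int_absorb2 measure_restrict_space)
    then show ?thesis by auto
  qed
  finally show ?thesis .
qed

section \<open>Linear functional derivatives\<close>

lemma W2_nonneg: "\<mu> \<in> prob_moment 2 \<Longrightarrow> \<nu> \<in> prob_moment 2 \<Longrightarrow> 0 \<le> W2 \<mu> \<nu>"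
  using moment1_diff_le_W2[of \<mu> \<nu>] by linarith

lemma W2_self:
  assumes \<mu>: "\<mu> \<in> prob_moment 2"
  shows "W2 \<mu> \<mu> = 0"
proof -
  have "mixture 0 \<mu> (return borel 0) = \<mu>"
    by (rule mixture_0) (simp_all add: prob_moment_2D(4)[OF \<mu>])
  then have "W2 \<mu> \<mu> \<le> 0"
    using W2_mixture_return[OF \<mu>, of 0 0 0] by simp
  with W2_nonneg[OF \<mu> \<mu>] show ?thesis by linarith
qed

lemma integrable_quadratic_growth:
  fixes g :: "real \<Rightarrow> real"
  assumes \<mu>: "\<mu> \<in> prob_moment 2" and g: "g \<in> borel_measurable borel" "\<And>z. \<bar>g z\<bar> \<le> C * (1 + z\<^sup>2)"
  shows "integrable \<mu> g"
proof -
  note m = prob_moment_2D[OF \<mu>]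
  interpret prob_space \<mu> by fact
  show ?thesis
  proof (rule Bochner_Integration.integrable_bound)
    show "integrable \<mu> (\<lambda>z. C * (1 + z\<^sup>2))" using m(2) by simp
    show "g \<in> borel_measurable \<mu>"
      using g(1) by (simp add: measurable_cong_sets[OF m(4) refl])
    show "AE z in \<mu>. norm (g z) \<le> norm (C * (1 + z\<^sup>2))"
      unfolding real_norm_def by (intro AE_I2 order_trans[OF g(2) abs_ge_self])
  qed
qed

text \<open>
  The directional derivative of \<open>f\<close> at \<open>\<mu>\<close> towards the point mass at \<open>y\<close> recovers \<open>\<delta> \<mu> y\<close> up to a
  constant in \<open>y\<close>. The left-hand side does not mention \<open>\<delta>\<close>, so two linear functional derivatives of the
  same \<open>f\<close> differ by a function of the measure alone; hence the choice made in \<open>L_deriv\<close> does not matter.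

  The fundamental theorem of calculus along the segment from \<open>\<mu>\<close> to the mixture with weight \<open>\<epsilon>\<close>
  writes the difference quotient as the average of \<open>G\<close> over \<open>[0, \<epsilon>]\<close>, where \<open>G r\<close> pairs \<open>\<delta>\<close> at the mixture
  with weight \<open>r\<close> with the direction. Continuity of \<open>G\<close> then gives the limit \<open>G 0\<close>. It is used
  on all of \<open>[0, 1]\<close> and not only at \<open>0\<close>, because the integral of a function that is not measurable would be
  \<open>0\<close> by convention and would say nothing about \<open>G 0\<close>.
\<close>

lemma directional_derivative_mixture:
  fixes f :: "real measure \<Rightarrow> real"
  assumes lfd: "linear_functional_derivative f \<delta>" and \<mu>: "\<mu> \<in> prob_moment 2"
  shows "(\<lambda>n. (f (mixture (1 / Suc n) \<mu> (return borel y)) - f \<mu>) * Suc n)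
    \<longlonglongrightarrow> \<delta> \<mu> y - (LINT z|\<mu>. \<delta> \<mu> z)"
proof -
  note m = prob_moment_2D[OF \<mu>] and ret = return_prob_moment[where y=y]
  interpret prob_space \<mu> by fact
  define mix where "mix r = mixture r \<mu> (return borel y)" for r
  have mix: "mix r \<in> prob_moment 2" "moment 2 (mix r) \<le> moment 2 \<mu> + y\<^sup>2" if "r \<in> {0..1}" for r
  proof -
    have nn: "0 \<le> moment 2 \<mu>" by (simp add: moment_def)
    then show "moment 2 (mix r) \<le> moment 2 \<mu> + y\<^sup>2"
      using that mixture_prob_moment(3)[of r \<mu> "return borel y"] \<mu> ret
        mult_right_mono[of "1 - r" 1 "moment 2 \<mu>"] mult_right_mono[of r 1 "y\<^sup>2"]
      by (auto simp: mix_def)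
    show "mix r \<in> prob_moment 2"
      using that mixture_prob_moment(1)[of r \<mu> "return borel y"] \<mu> ret by (auto simp: mix_def)
  qed
  have cont: "(\<lambda>n. \<delta> (\<mu>s n) (ys n)) \<longlonglongrightarrow> \<delta> \<nu> z"
    if "\<nu> \<in> prob_moment 2" "\<And>n::nat. \<mu>s n \<in> prob_moment 2" "(\<lambda>n. W2 (\<mu>s n) \<nu>) \<longlonglongrightarrow> 0" "ys \<longlonglongrightarrow> z"
    for \<mu>s ys \<nu> z
    using lfd that unfolding linear_functional_derivative_def by blast
  have growth: "\<exists>C. \<forall>\<nu>\<in>prob_moment 2. moment 2 \<nu> \<le> R \<longrightarrow> (\<forall>y. \<bar>\<delta> \<nu> y\<bar> \<le> C * (1 + y\<^sup>2))" for R
    using lfd unfolding linear_functional_derivative_def by blast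
  have ftc: "f \<nu> - f \<mu> = (LINT s:{0..1}|lborel.
          (LINT y|\<nu>. \<delta> (mixture s \<mu> \<nu>) y) - (LINT y|\<mu>. \<delta> (mixture s \<mu> \<nu>) y))"
    if "\<nu> \<in> prob_moment 2" for \<nu>
    using lfd that \<mu> unfolding linear_functional_derivative_def by blast
  have meas [measurable]: "\<delta> \<nu> \<in> borel_measurable borel" if \<nu>: "\<nu> \<in> prob_moment 2" for \<nu>
  proof (rule borel_measurable_continuous_onI)
    show "continuous_on UNIV (\<delta> \<nu>)"
      unfolding continuous_on_sequentially comp_def
      using cont[OF \<nu>, of "\<lambda>_. \<nu>"] \<nu> W2_self[OF \<nu>] by auto
  qed
  obtain C where C: "\<And>r z. r \<in> {0..1} \<Longrightarrow> \<bar>\<delta> (mix r) z\<bar> \<le> C * (1 + z\<^sup>2)"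
    using growth[of "moment 2 \<mu> + y\<^sup>2"] mix by blast
  have intC: "integrable \<mu> (\<lambda>z. C * (1 + z\<^sup>2))" using m by auto
  have int: "integrable \<mu> (\<delta> (mix r))" if "r \<in> {0..1}" for r
    by (rule integrable_quadratic_growth[OF \<mu> meas[OF mix(1)[OF that]] C[OF that]])
  define G where "G r = \<delta> (mix r) y - (LINT z|\<mu>. \<delta> (mix r) z)" for r
  have G_cont: "continuous_on {0..1} G"
    unfolding continuous_on_sequentially comp_def
  proof safe
    fix rs :: "nat \<Rightarrow> real" and r assume r: "r \<in> {0..1}" and rs: "\<forall>n. rs n \<in> {0..1}" "rs \<longlonglongrightarrow> r"
    have "(\<lambda>n. sqrt (\<bar>rs n - r\<bar> * (LINT z|\<mu>. (y - z)\<^sup>2))) \<longlonglongrightarrow> sqrt (\<bar>r - r\<bar> * (LINT z|\<mu>. (y - z)\<^sup>2))"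
      by (intro tendsto_intros rs)
    then have lim: "(\<lambda>n. sqrt (\<bar>rs n - r\<bar> * (LINT z|\<mu>. (y - z)\<^sup>2))) \<longlonglongrightarrow> 0"
      by simp
    have W: "(\<lambda>n. W2 (mix (rs n)) (mix r)) \<longlonglongrightarrow> 0"
    proof (rule tendsto_sandwich[OF always_eventually always_eventually tendsto_const lim])
      show "\<forall>n. 0 \<le> W2 (mix (rs n)) (mix r)"
        by (intro allI W2_nonneg mix(1) rs(1)[rule_format] r)
      show "\<forall>n. W2 (mix (rs n)) (mix r) \<le> sqrt (\<bar>rs n - r\<bar> * (LINT z|\<mu>. (y - z)\<^sup>2))"
        unfolding mix_def by (intro allI W2_mixture_return[OF \<mu>] rs(1)[rule_format] r)
    qed
    have pt: "(\<lambda>n. \<delta> (mix (rs n)) z) \<longlonglongrightarrow> \<delta> (mix r) z" for z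
      by (rule cont[OF mix(1)[OF r] mix(1)[OF rs(1)[rule_format]] W tendsto_const])
    have "(\<lambda>n. LINT z|\<mu>. \<delta> (mix (rs n)) z) \<longlonglongrightarrow> (LINT z|\<mu>. \<delta> (mix r) z)"
      by (intro integral_dominated_convergence[where w="\<lambda>z. C * (1 + z\<^sup>2)", unfolded real_norm_def]
          AE_I2 pt C[folded real_norm_def] r rs(1)[rule_format] intC borel_measurable_integrable[OF int])
    then show "(\<lambda>n. G (rs n)) \<longlonglongrightarrow> G r"
      unfolding G_def by (intro tendsto_diff pt)
  qed
  obtain K where K: "\<And>r. r \<in> {0..1} \<Longrightarrow> \<bar>G r\<bar> \<le> K"
    using compact_imp_bounded[OF compact_continuous_image[OF G_cont compact_Icc]]
    unfolding bounded_iff real_norm_def by blast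
  have eq: "(f (mixture (1 / Suc n) \<mu> (return borel y)) - f \<mu>) * Suc n
      = (LINT s:{0..1}|lborel. G (s / Suc n))" for n
  proof -
    define \<epsilon> where "\<epsilon> = 1 / real (Suc n)"
    have e: "0 \<le> \<epsilon>" "\<epsilon> \<le> 1" by (auto simp: \<epsilon>_def)
    have "f (mix \<epsilon>) - f \<mu> = (LINT s:{0..1}|lborel.
          (LINT y|mix \<epsilon>. \<delta> (mixture s \<mu> (mix \<epsilon>)) y) - (LINT y|\<mu>. \<delta> (mixture s \<mu> (mix \<epsilon>)) y))"
      by (rule ftc, rule mix(1)) (use e in auto)
    also have "\<dots> = (LINT s:{0..1}|lborel. \<epsilon> * G (s / Suc n))"
    proof (rule set_lebesgue_integral_cong)
      show "\<forall>s. s \<in> {0..1} \<longrightarrow> (LINT y|mix \<epsilon>. \<delta> (mixture s \<mu> (mix \<epsilon>)) y) - (LINT y|\<mu>. \<delta> (mixture s \<mu> (mix \<epsilon>)) y)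
         = \<epsilon> * G (s / Suc n)"
      proof safe
        fix s :: real assume s: "s \<in> {0..1}"
        then have se: "s * \<epsilon> \<in> {0..1}" using e mult_le_one[of s \<epsilon>] by auto
        have mm: "mixture s \<mu> (mix \<epsilon>) = mix (s * \<epsilon>)"
          unfolding mix_def using s e m(4) by (intro mixture_mixture) auto
        have "integrable (return borel y) (\<delta> (mix (s * \<epsilon>)))"
          by (rule integrable_quadratic_growth[OF ret(1) meas[OF mix(1)[OF se]] C[OF se]])
        then have "(LINT y|mix \<epsilon>. \<delta> (mix (s * \<epsilon>)) y)
           = (1 - \<epsilon>) * (LINT z|\<mu>. \<delta> (mix (s * \<epsilon>)) z) + \<epsilon> * \<delta> (mix (s * \<epsilon>)) y"
          unfolding mix_def[of \<epsilon>] using e m(4) int[OF se]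
          by (subst integral_mixture) (auto simp: integral_return meas[OF mix(1)[OF se]])
        then show "(LINT y|mix \<epsilon>. \<delta> (mixture s \<mu> (mix \<epsilon>)) y) - (LINT y|\<mu>. \<delta> (mixture s \<mu> (mix \<epsilon>)) y)
         = \<epsilon> * G (s / Suc n)"
          unfolding mm G_def by (simp add: algebra_simps \<epsilon>_def)
      qed
    qed simp
    finally show ?thesis by (simp add: mix_def \<epsilon>_def)
  qed
  have "(\<lambda>n. LINT s:{0..1}|lborel. G (s / Suc n)) \<longlonglongrightarrow> (LINT s:{0..1::real}|lborel. G 0)"
    unfolding set_lebesgue_integral_def
  proof (rule integral_dominated_convergence[where w="\<lambda>s::real. K * indicator {0..1} s"])
    have in1: "s / Suc n \<in> {0..1}" if "s \<in> {0..1}" for s and n :: nat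
      using that by (auto simp: field_simps)
    have "(\<lambda>s. indicator {0..1} s *\<^sub>R G (s / real (Suc n))) \<in> borel_measurable borel" for n
      by (rule borel_measurable_continuous_on_indicator)
         (use in1 in \<open>auto intro!: continuous_intros continuous_on_compose2[OF G_cont]\<close>)
    then show "(\<lambda>s. indicator {0..1} s *\<^sub>R G (s / real (Suc n))) \<in> borel_measurable lborel" for n
      by simp
    show "AE s in lborel. (\<lambda>n. indicator {0..1} s *\<^sub>R G (s / real (Suc n))) \<longlonglongrightarrow> indicator {0..1} s *\<^sub>R G 0"
    proof (rule AE_I2)
      fix s
      show "(\<lambda>n. indicator {0..1} s *\<^sub>R G (s / real (Suc n))) \<longlonglongrightarrow> indicator {0..1} s *\<^sub>R G 0"
      proof (cases "s \<in> {0..1}")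
        case True
        have "(\<lambda>n. s * (1 / real (Suc n))) \<longlonglongrightarrow> s * 0"
          by (intro tendsto_intros LIMSEQ_Suc[OF lim_1_over_n])
        then have "(\<lambda>n. G (s / real (Suc n))) \<longlonglongrightarrow> G 0"
          by (intro continuous_on_tendsto_compose[OF G_cont]) (use in1 True in auto)
        then show ?thesis using True by simp
      qed simp
    qed
    show "AE s in lborel. norm (indicator {0..1} s *\<^sub>R G (s / real (Suc n))) \<le> K * indicator {0..1} s" for n
      using K in1 by (intro AE_I2) (auto simp: indicator_def)
  qed (auto)
  moreover have "(LINT s:{0..1::real}|lborel. G 0) = \<delta> \<mu> y - (LINT z|\<mu>. \<delta> \<mu> z)"
    using m by (simp add: set_lebesgue_integral_def G_def mix_def mixture_0)
  ultimately show ?thesis unfolding eq by simp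
qed

lemma integral_affine_01: "(LINT s:{0..1}|lborel. a + 2 * b * s) = a + (b :: real)"
proof -
  have "(LINT s:{0..1}|lborel. a + 2 * b * s) = (a * 1 + b * 1\<^sup>2) - (a * 0 + b * 0\<^sup>2)"
    unfolding set_lebesgue_integral_def
    by (rule integral_FTC_atLeastAtMost[where F="\<lambda>s. a * s + b * s\<^sup>2"])
      (auto intro!: derivative_eq_intros continuous_intros
        simp flip: has_real_derivative_iff_has_vector_derivative)
  then show ?thesis by simp
qed

text \<open>
  The derivative of \<open>\<langle>y\<^sup>2, \<mu>\<rangle>\<close> is \<open>y\<^sup>2\<close>, and by the chain rule that of the squared mean is \<open>2 \<langle>y, \<mu>\<rangle> y\<close>.
  Continuity in \<open>W2\<close> holds because only the first moment of the measure enters the derivative.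
\<close>

lemma linear_functional_derivative_quadratic:
  "linear_functional_derivative (\<lambda>\<mu>. p * moment 2 \<mu> + q * (moment 1 \<mu>)\<^sup>2 + c)
     (\<lambda>\<mu> y. p * y\<^sup>2 + 2 * q * moment 1 \<mu> * y)"
  unfolding linear_functional_derivative_def
proof (intro conjI ballI allI impI)
  fix \<mu> y \<mu>s and ys :: "nat \<Rightarrow> real"
  assume \<mu>: "\<mu> \<in> prob_moment 2" and \<mu>s: "\<forall>n. \<mu>s n \<in> prob_moment 2"
    and W: "(\<lambda>n. W2 (\<mu>s n) \<mu>) \<longlonglongrightarrow> 0" and y: "ys \<longlonglongrightarrow> y"
  have "(\<lambda>n. moment 1 (\<mu>s n) - moment 1 \<mu>) \<longlonglongrightarrow> 0"
    by (rule tendsto_rabs_zero_cancel, rule tendsto_sandwich[OF _ _ tendsto_const W])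
      (use moment1_diff_le_W2 \<mu> \<mu>s in auto)
  then have "(\<lambda>n. moment 1 (\<mu>s n)) \<longlonglongrightarrow> moment 1 \<mu>" by (simp add: LIM_zero_iff)
  then show "(\<lambda>n. p * (ys n)\<^sup>2 + 2 * q * moment 1 (\<mu>s n) * ys n) \<longlonglongrightarrow> p * y\<^sup>2 + 2 * q * moment 1 \<mu> * y"
    by (intro tendsto_intros y)
next
  fix R :: real
  show "\<exists>C. \<forall>\<mu>\<in>prob_moment 2. moment 2 \<mu> \<le> R \<longrightarrow>
              (\<forall>y. \<bar>p * y\<^sup>2 + 2 * q * moment 1 \<mu> * y\<bar> \<le> C * (1 + y\<^sup>2))"
  proof (intro exI[of _ "\<bar>p\<bar> + \<bar>q\<bar> * (1 + R)"] ballI impI allI)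
    fix \<mu> y assume \<mu>: "\<mu> \<in> prob_moment 2" and R: "moment 2 \<mu> \<le> R"
    note m = prob_moment_2D[OF \<mu>]
    interpret prob_space \<mu> by fact
    \<comment> \<open>the variance is nonnegative\<close>
    have "(moment 1 \<mu>)\<^sup>2 \<le> R"
      using variance_positive[of "\<lambda>y. y"] m R by (simp add: variance_eq moment_def)
    moreover have "2 * \<bar>moment 1 \<mu> * y\<bar> \<le> (moment 1 \<mu>)\<^sup>2 + y\<^sup>2"
      using sum_squares_bound[of "\<bar>moment 1 \<mu>\<bar>" "\<bar>y\<bar>"] by (simp add: abs_mult)
    moreover have "0 \<le> R * y\<^sup>2" using R by (simp add: moment_def order_trans[OF _ R])
    ultimately have "2 * \<bar>moment 1 \<mu> * y\<bar> \<le> (1 + R) * (1 + y\<^sup>2)" by (simp add: algebra_simps)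
    then have "\<bar>q\<bar> * (2 * \<bar>moment 1 \<mu> * y\<bar>) \<le> \<bar>q\<bar> * ((1 + R) * (1 + y\<^sup>2))"
      by (rule mult_left_mono) simp
    moreover have "\<bar>p * y\<^sup>2\<bar> \<le> \<bar>p\<bar> * (1 + y\<^sup>2)" by (simp add: abs_mult algebra_simps)
    moreover have "\<bar>p * y\<^sup>2 + 2 * q * moment 1 \<mu> * y\<bar> \<le> \<bar>p * y\<^sup>2\<bar> + \<bar>q\<bar> * (2 * \<bar>moment 1 \<mu> * y\<bar>)"
      by (rule order_trans[OF abs_triangle_ineq]) (simp add: abs_mult)
    ultimately show "\<bar>p * y\<^sup>2 + 2 * q * moment 1 \<mu> * y\<bar> \<le> (\<bar>p\<bar> + \<bar>q\<bar> * (1 + R)) * (1 + y\<^sup>2)"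
      by (simp add: algebra_simps)
  qed
next
  fix \<mu> \<nu> assume \<mu>: "\<mu> \<in> prob_moment 2" and \<nu>: "\<nu> \<in> prob_moment 2"
  note m = prob_moment_2D[OF \<mu>] and n = prob_moment_2D[OF \<nu>]
  define d where "d = moment 1 \<nu> - moment 1 \<mu>"
  have int: "(LINT y|\<nu>. p * y\<^sup>2 + k * y) - (LINT y|\<mu>. p * y\<^sup>2 + k * y)
     = p * (moment 2 \<nu> - moment 2 \<mu>) + k * d" for k
    using m(1,2) n(1,2) by (simp add: moment_def d_def algebra_simps)
  have "(LINT s:{0..1}|lborel.
          (LINT y|\<nu>. p * y\<^sup>2 + 2 * q * moment 1 (mixture s \<mu> \<nu>) * y) -
          (LINT y|\<mu>. p * y\<^sup>2 + 2 * q * moment 1 (mixture s \<mu> \<nu>) * y))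
    = (LINT s:{0..1}|lborel. (p * (moment 2 \<nu> - moment 2 \<mu>) + 2 * q * moment 1 \<mu> * d) + 2 * q * d\<^sup>2 * s)"
    unfolding int
    by (rule set_lebesgue_integral_cong)
      (auto simp: mixture_prob_moment(2)[OF _ _ \<mu> \<nu>, unfolded One_nat_def] d_def power2_eq_square algebra_simps)
  also have "\<dots> = (p * (moment 2 \<nu> - moment 2 \<mu>) + 2 * q * moment 1 \<mu> * d) + q * d\<^sup>2"
    using integral_affine_01[of _ "q * d\<^sup>2"] by (simp add: mult.assoc)
  also have "\<dots> = p * moment 2 \<nu> + q * (moment 1 \<nu>)\<^sup>2 + c - (p * moment 2 \<mu> + q * (moment 1 \<mu>)\<^sup>2 + c)"
    by (simp add: d_def power2_eq_square algebra_simps)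
  finally show "p * moment 2 \<nu> + q * (moment 1 \<nu>)\<^sup>2 + c - (p * moment 2 \<mu> + q * (moment 1 \<mu>)\<^sup>2 + c)
    = (LINT s:{0..1}|lborel.
          (LINT y|\<nu>. p * y\<^sup>2 + 2 * q * moment 1 (mixture s \<mu> \<nu>) * y) -
          (LINT y|\<mu>. p * y\<^sup>2 + 2 * q * moment 1 (mixture s \<mu> \<nu>) * y))" by simp
qed

lemma
  fixes p q c :: real
  defines "f \<equiv> (\<lambda>\<mu>. p * moment 2 \<mu> + q * (moment 1 \<mu>)\<^sup>2 + c)"
  shows L_differentiable_quadratic: "L_differentiable f"
    and L_deriv_quadratic: "\<mu> \<in> prob_moment 2 \<Longrightarrow> L_deriv f \<mu> = (\<lambda>y. 2 * (p * y + q * moment 1 \<mu>))"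
    and L_deriv_x_quadratic: "\<mu> \<in> prob_moment 2 \<Longrightarrow> L_deriv_x f \<mu> = (\<lambda>y. 2 * p)"
proof -
  let ?d = "\<lambda>\<mu> y. p * y\<^sup>2 + 2 * q * moment 1 \<mu> * y"
  have lfd: "linear_functional_derivative f ?d"
    unfolding f_def by (rule linear_functional_derivative_quadratic)
  have D: "(?d \<mu> has_field_derivative 2 * (p * y + q * moment 1 \<mu>)) (at y)" for \<mu> y
    by (auto intro!: derivative_eq_intros simp: algebra_simps)
  show "L_differentiable f"
    unfolding L_differentiable_def real_differentiable_def using lfd D by blast
  show 1: "L_deriv f \<mu> = (\<lambda>y. 2 * (p * y + q * moment 1 \<mu>))" if \<mu>: "\<mu> \<in> prob_moment 2" for \<mu>
  proof
    fix y
    define \<delta> where "\<delta> = (SOME \<delta>. linear_functional_derivative f \<delta>)"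
    have "linear_functional_derivative f \<delta>"
      unfolding \<delta>_def by (rule someI[of "linear_functional_derivative f", OF lfd])
    from LIMSEQ_unique[OF directional_derivative_mixture[OF this \<mu>] directional_derivative_mixture[OF lfd \<mu>]]
    have "\<delta> \<mu> = (\<lambda>z. ?d \<mu> z + ((LINT z|\<mu>. \<delta> \<mu> z) - (LINT z|\<mu>. ?d \<mu> z)))"
      by (auto simp: fun_eq_iff algebra_simps)
    moreover have "((\<lambda>z. ?d \<mu> z + k) has_field_derivative 2 * (p * y + q * moment 1 \<mu>)) (at y)" for k
      using DERIV_add[OF D DERIV_const] by simp
    ultimately have "(\<delta> \<mu> has_field_derivative 2 * (p * y + q * moment 1 \<mu>)) (at y)" by metis
    then show "L_deriv f \<mu> y = 2 * (p * y + q * moment 1 \<mu>)"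
      unfolding L_deriv_def \<delta>_def by (rule DERIV_imp_deriv)
  qed
  show "L_deriv_x f \<mu> = (\<lambda>y. 2 * p)" if \<mu>: "\<mu> \<in> prob_moment 2" for \<mu>
    unfolding L_deriv_x_def 1[OF \<mu>]
    by (intro ext DERIV_imp_deriv) (auto intro!: derivative_eq_intros)
qed

section \<open>The master equation\<close>

text \<open>
  In the control \<open>a\<close> the Hamiltonian is a parabola. Completing the square shows its minimum and its
  minimiser \<open>- B l / Q\<close>, where \<open>2 l\<close> is the L-derivative of \<open>v\<close>.
\<close>

lemma hamiltonian_complete_square:
  assumes "L_deriv (v t) \<mu> y = 2 * l" and "Q t > 0"
  shows "hamiltonian A B Q t y \<mu> v a
    = Q t * (a + B t / Q t * l)\<^sup>2 + (2 * A t * y * l - (B t)\<^sup>2 / Q t * l\<^sup>2)"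
  using assms by (simp add: hamiltonian_def power2_eq_square field_simps)

text \<open>
  The map \<open>a\<close> enters the mean Hamiltonian pointwise, so the infimum over maps is attained by the
  pointwise minimiser; this map is affine, so its Hamiltonian is quadratic in \<open>y\<close> and integrable.
\<close>

lemma
  fixes A B Q p q :: "real \<Rightarrow> real" and r :: "real \<Rightarrow> real"
  defines "v \<equiv> (\<lambda>t \<mu>. p t * moment 2 \<mu> + q t * (moment 1 \<mu>)\<^sup>2 + r t)"
  assumes Q: "Q t > 0" and \<mu>: "\<mu> \<in> prob_moment 2"
  shows hamiltonian_minimizer:
      "hamiltonian A B Q t y \<mu> v (- (B t / Q t) * (p t * y + q t * moment 1 \<mu>)) \<le> hamiltonian A B Q t y \<mu> v a"
    and inf_mean_hamiltonian_quadratic: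
      "inf_mean_hamiltonian A B Q t \<mu> v =
        ereal (2 * A t * (p t * moment 2 \<mu> + q t * (moment 1 \<mu>)\<^sup>2)
          - (B t)\<^sup>2 / Q t * ((p t)\<^sup>2 * moment 2 \<mu> + 2 * p t * q t * (moment 1 \<mu>)\<^sup>2 + (q t)\<^sup>2 * (moment 1 \<mu>)\<^sup>2))"
proof -
  note m = prob_moment_2D[OF \<mu>]
  interpret prob_space \<mu> by fact
  define l where "l y = p t * y + q t * moment 1 \<mu>" for y
  define a0 where "a0 y = - (B t / Q t) * l y" for y
  have L: "L_deriv (v t) \<mu> y = 2 * l y" for y
    unfolding v_def l_def by (subst L_deriv_quadratic[OF \<mu>]) (rule refl)
  note H = hamiltonian_complete_square[of v t \<mu> _ _ Q A B, OF L Q]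
  have min: "hamiltonian A B Q t y \<mu> v (a0 y) \<le> hamiltonian A B Q t y \<mu> v a" for y a
    unfolding H a0_def using Q by simp
  then show "hamiltonian A B Q t y \<mu> v (- (B t / Q t) * (p t * y + q t * moment 1 \<mu>)) \<le> hamiltonian A B Q t y \<mu> v a"
    unfolding a0_def l_def .
  have Ha: "hamiltonian A B Q t y \<mu> v (a0 y) =
     (2 * A t * p t - (B t)\<^sup>2 / Q t * (p t)\<^sup>2) * y\<^sup>2
     + (2 * A t * q t * moment 1 \<mu> - 2 * (B t)\<^sup>2 / Q t * p t * q t * moment 1 \<mu>) * y
     - (B t)\<^sup>2 / Q t * (q t)\<^sup>2 * (moment 1 \<mu>)\<^sup>2" for y
    unfolding H a0_def l_def by (simp add: power2_eq_square algebra_simps)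
  have int: "integrable \<mu> (\<lambda>y. hamiltonian A B Q t y \<mu> v (a0 y))"
    unfolding Ha using m(1,2) by simp
  have val: "(LINT y|\<mu>. hamiltonian A B Q t y \<mu> v (a0 y)) =
     2 * A t * (p t * moment 2 \<mu> + q t * (moment 1 \<mu>)\<^sup>2)
          - (B t)\<^sup>2 / Q t * ((p t)\<^sup>2 * moment 2 \<mu> + 2 * p t * q t * (moment 1 \<mu>)\<^sup>2 + (q t)\<^sup>2 * (moment 1 \<mu>)\<^sup>2)"
    unfolding Ha using m(1,2) prob_space
    by (simp add: moment_def[of 2, symmetric] moment_def[of "Suc 0", simplified, symmetric])
      (simp add: power2_eq_square algebra_simps add_divide_distrib)
  show "inf_mean_hamiltonian A B Q t \<mu> v =
        ereal (2 * A t * (p t * moment 2 \<mu> + q t * (moment 1 \<mu>)\<^sup>2)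
          - (B t)\<^sup>2 / Q t * ((p t)\<^sup>2 * moment 2 \<mu> + 2 * p t * q t * (moment 1 \<mu>)\<^sup>2 + (q t)\<^sup>2 * (moment 1 \<mu>)\<^sup>2))"
    unfolding inf_mean_hamiltonian_def val[symmetric]
  proof (rule INF_eqI)
    fix a assume "a \<in> {a \<in> borel_measurable borel. integrable \<mu> (\<lambda>y. hamiltonian A B Q t y \<mu> v (a y))}"
    then show "ereal (LINT y|\<mu>. hamiltonian A B Q t y \<mu> v (a0 y)) \<le> ereal (LINT y|\<mu>. hamiltonian A B Q t y \<mu> v (a y))"
      using int min by (auto intro!: integral_mono)
  next
    fix z assume z: "\<And>a. a \<in> {a \<in> borel_measurable borel. integrable \<mu> (\<lambda>y. hamiltonian A B Q t y \<mu> v (a y))} \<Longrightarrow>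
       z \<le> ereal (LINT y|\<mu>. hamiltonian A B Q t y \<mu> v (a y))"
    show "z \<le> ereal (LINT y|\<mu>. hamiltonian A B Q t y \<mu> v (a0 y))"
      by (rule z) (use int in \<open>auto simp: a0_def l_def\<close>)
  qed
qed

text \<open>
  With the quadratic ansatz the master equation is affine in the second moment and in the squared
  first moment of \<open>\<mu>\<close>; its three coefficients vanish by the three Riccati equations.
\<close>

lemma quadratic_solves_master_equation:
  fixes A B Q \<sigma> p q r :: "real \<Rightarrow> real"
  defines "v \<equiv> (\<lambda>t \<mu>. p t * moment 2 \<mu> + q t * (moment 1 \<mu>)\<^sup>2 + r t)"
  assumes Q: "\<And>t. t \<in> {0<..<T} \<Longrightarrow> Q t > 0"
    and p: "\<And>t. t \<in> {0<..<T} \<Longrightarrow>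
      (p has_real_derivative (B t)\<^sup>2 / Q t * (p t)\<^sup>2 - 2 * A t * p t) (at t)"
    and q: "\<And>t. t \<in> {0<..<T} \<Longrightarrow>
      (q has_real_derivative (B t)\<^sup>2 / Q t * (q t)\<^sup>2 + 2 * (B t)\<^sup>2 / Q t * p t * q t - 2 * A t * q t) (at t)"
    and r: "\<And>t. t \<in> {0<..<T} \<Longrightarrow> (r has_real_derivative - ((\<sigma> t)\<^sup>2 * p t)) (at t)"
  shows "solves_master_equation T A B Q \<sigma> v"
  unfolding solves_master_equation_def
proof (intro ballI conjI allI)
  fix t \<mu> y assume t: "t \<in> {0<..<T}"
  show "L_differentiable (v t)" unfolding v_def by (rule L_differentiable_quadratic)
  assume \<mu>: "\<mu> \<in> prob_moment 2"
  interpret prob_space \<mu> by (rule prob_moment_2D(3)[OF \<mu>])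
  have Lx: "L_deriv_x (v t) \<mu> = (\<lambda>_. 2 * p t)" unfolding v_def by (rule L_deriv_x_quadratic[OF \<mu>])
  show "L_deriv (v t) \<mu> differentiable at y"
    unfolding v_def L_deriv_quadratic[OF \<mu>] by simp
  show "integrable \<mu> (L_deriv_x (v t) \<mu>)" by (simp add: Lx)
  have D: "((\<lambda>s. v s \<mu>) has_real_derivative
      ((B t)\<^sup>2 / Q t * (p t)\<^sup>2 - 2 * A t * p t) * moment 2 \<mu>
      + ((B t)\<^sup>2 / Q t * (q t)\<^sup>2 + 2 * (B t)\<^sup>2 / Q t * p t * q t - 2 * A t * q t) * (moment 1 \<mu>)\<^sup>2
      - (\<sigma> t)\<^sup>2 * p t) (at t)"
    unfolding v_def by (auto intro!: derivative_eq_intros p[OF t] q[OF t] r[OF t])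
  then show "(\<lambda>s. v s \<mu>) differentiable at t" by (auto simp: real_differentiable_def)
  show "inf_mean_hamiltonian A B Q t \<mu> v
          + ereal (1/2 * (\<sigma> t)\<^sup>2 * (LINT y|\<mu>. L_deriv_x (v t) \<mu> y))
          + ereal (deriv (\<lambda>s. v s \<mu>) t) = 0"
    unfolding DERIV_imp_deriv[OF D] Lx unfolding v_def inf_mean_hamiltonian_quadratic[of Q t \<mu> A B p q r, OF Q[OF t] \<mu>]
    using prob_space by (simp add: zero_ereal_def algebra_simps)
qed

section \<open>Square-integrable functions\<close>

definition square_integrable :: "'a measure \<Rightarrow> ('a \<Rightarrow> real) \<Rightarrow> bool" where
  "square_integrable M f \<longleftrightarrow> f \<in> borel_measurable M \<and> integrable M (\<lambda>x. (f x)\<^sup>2)"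

lemma square_integrable_measurable [measurable_dest]: "square_integrable M f \<Longrightarrow> f \<in> borel_measurable M"
  by (simp add: square_integrable_def)

lemma square_integrable_mult:
  assumes f: "square_integrable M f" and g: "square_integrable M g"
  shows "integrable M (\<lambda>x. f x * g x)"
proof (rule Bochner_Integration.integrable_bound)
  show "integrable M (\<lambda>x. (f x)\<^sup>2 + (g x)\<^sup>2)"
    using f g by (simp add: square_integrable_def)
  show "(\<lambda>x. f x * g x) \<in> borel_measurable M" using f g by measurable
  have "\<bar>a * b\<bar> \<le> a\<^sup>2 + b\<^sup>2" for a b :: real
  proof -
    have "2 * \<bar>a * b\<bar> \<le> a\<^sup>2 + b\<^sup>2"
      using sum_squares_bound[of "\<bar>a\<bar>" "\<bar>b\<bar>"] by (simp add: abs_mult)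
    then show ?thesis by linarith
  qed
  then show "AE x in M. norm (f x * g x) \<le> norm ((f x)\<^sup>2 + (g x)\<^sup>2)" by simp
qed

lemma square_integrable_add:
  assumes f: "square_integrable M f" and g: "square_integrable M g"
  shows "square_integrable M (\<lambda>x. f x + g x)"
  using f g square_integrable_mult[OF f g]
  by (auto simp: square_integrable_def power2_sum mult.assoc)

lemma square_integrable_cmult: "square_integrable M f \<Longrightarrow> square_integrable M (\<lambda>x. c * f x)"
  by (auto simp: square_integrable_def power_mult_distrib)

lemma square_integrable_diff:
  assumes f: "square_integrable M f" and g: "square_integrable M g"
  shows "square_integrable M (\<lambda>x. f x - g x)"
  using square_integrable_add[OF f square_integrable_cmult[OF g, of "-1"]] by simp

lemma square_integrable_sum:
  "(\<And>i. i \<in> I \<Longrightarrow> square_integrable M (f i)) \<Longrightarrow> square_integrable M (\<lambda>x. \<Sum>i\<in>I. f i x)"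
  by (induction I rule: infinite_finite_induct) (auto intro!: square_integrable_add simp: square_integrable_def[of _ "\<lambda>_. 0"])

lemma square_integrable_abs: "square_integrable M f \<Longrightarrow> square_integrable M (\<lambda>x. \<bar>f x\<bar>)"
  by (auto simp: square_integrable_def)

lemma (in finite_measure) square_integrable_integrable: "square_integrable M f \<Longrightarrow> integrable M f"
  using square_integrable_mult[of M f "\<lambda>_. 1"] by (simp add: square_integrable_def)

lemma integrable_bounded_mult:
  fixes f g :: "'a \<Rightarrow> real"
  assumes [measurable]: "f \<in> borel_measurable M" and b: "\<And>x. x \<in> space M \<Longrightarrow> \<bar>f x\<bar> \<le> K" and g: "integrable M g"
  shows "integrable M (\<lambda>x. f x * g x)"
proof (rule Bochner_Integration.integrable_bound)
  show "integrable M (\<lambda>x. K * g x)" using g by simp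
  have [measurable]: "g \<in> borel_measurable M" using g by simp
  show "(\<lambda>x. f x * g x) \<in> borel_measurable M" by measurable
  show "AE x in M. norm (f x * g x) \<le> norm (K * g x)"
    using b by (intro AE_I2) (auto simp: abs_mult intro!: mult_right_mono order_trans[OF b abs_ge_self])
qed

lemma square_integrable_bounded_mult:
  assumes [measurable]: "f \<in> borel_measurable M" and b: "\<And>x. x \<in> space M \<Longrightarrow> \<bar>f x\<bar> \<le> K" and g: "square_integrable M g"
  shows "square_integrable M (\<lambda>x. f x * g x)"
proof -
  have "\<bar>(f x)\<^sup>2\<bar> \<le> K\<^sup>2" if "x \<in> space M" for x
    using b[OF that] by (simp add: abs_le_square_iff[symmetric])
  then have "integrable M (\<lambda>x. (f x)\<^sup>2 * (g x)\<^sup>2)"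
    using g by (intro integrable_bounded_mult[where K="K\<^sup>2"]) (auto simp: square_integrable_def)
  then show ?thesis using g by (auto simp: square_integrable_def power_mult_distrib)
qed

text \<open>
  The Cauchy-Schwarz inequality: the integral of \<open>(\<bar>f\<bar> y - \<bar>g\<bar>)\<^sup>2\<close> is a nonnegative quadratic polynomial in
  \<open>y\<close>, so its discriminant is not positive.
\<close>

lemma integral_abs_mult_le:
  assumes f: "square_integrable M f" and g: "square_integrable M g"
  shows "(LINT x|M. \<bar>f x * g x\<bar>) \<le> sqrt (LINT x|M. (f x)\<^sup>2) * sqrt (LINT x|M. (g x)\<^sup>2)"
proof -
  define a b c where "a = (LINT x|M. (f x)\<^sup>2)" and "b = (LINT x|M. (g x)\<^sup>2)" and "c = (LINT x|M. \<bar>f x * g x\<bar>)"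
  have nn: "0 \<le> a" "0 \<le> b" "0 \<le> c" by (auto simp: a_def b_def c_def)
  have q: "0 \<le> a * y\<^sup>2 - 2 * c * y + b" for y
  proof -
    have "0 \<le> (LINT x|M. (\<bar>f x\<bar> * y - \<bar>g x\<bar>)\<^sup>2)" by simp
    also have "\<dots> = (LINT x|M. (f x)\<^sup>2 * y\<^sup>2 - \<bar>f x * g x\<bar> * (2 * y) + (g x)\<^sup>2)"
      by (intro Bochner_Integration.integral_cong) (auto simp: power2_diff power_mult_distrib abs_mult)
    also have "\<dots> = a * y\<^sup>2 - 2 * c * y + b"
      using f g square_integrable_mult[OF f g, THEN integrable_abs]
      by (simp add: a_def b_def c_def square_integrable_def)
    finally show ?thesis .
  qed
  have "c\<^sup>2 \<le> a * b"
  proof (cases "a = 0")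
    case True
    \<comment> \<open>at this point the affine function \<open>b - 2 c y\<close> equals \<open>- 1\<close>\<close>
    then have "c \<le> 0" using q[of "(b + 1) / (2 * c)"] nn by (cases "c = 0") (auto simp: field_simps)
    then show ?thesis using nn by simp
  next
    case False
    then show ?thesis using q[of "c / a"] nn by (simp add: field_simps power2_eq_square)
  qed
  then have "c \<le> sqrt (a * b)" by (rule real_le_rsqrt)
  then show ?thesis by (simp add: a_def b_def c_def real_sqrt_mult)
qed

text \<open>
  The distance is a nonnegative integral, as in the definition of the Ito integral: its convergence to
  \<open>0\<close> is meaningful before the limit is known to be square-integrable.
\<close>

definition L2_tendsto :: "'a measure \<Rightarrow> (nat \<Rightarrow> 'a \<Rightarrow> real) \<Rightarrow> ('a \<Rightarrow> real) \<Rightarrow> bool" where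
  "L2_tendsto M fs f \<longleftrightarrow> (\<forall>k. square_integrable M (fs k)) \<and> f \<in> borel_measurable M \<and>
     (\<lambda>k. \<integral>\<^sup>+x. ennreal ((fs k x - f x)\<^sup>2) \<partial>M) \<longlonglongrightarrow> 0"

lemma L2_tendsto_const: "square_integrable M f \<Longrightarrow> L2_tendsto M (\<lambda>_. f) f"
  by (simp add: L2_tendsto_def square_integrable_def)

lemma
  assumes L: "L2_tendsto M fs f"
  shows L2_tendsto_square_integrable: "square_integrable M f"
    and L2_tendsto_norm: "(\<lambda>k. LINT x|M. (fs k x - f x)\<^sup>2) \<longlonglongrightarrow> 0"
proof -
  have fs: "\<And>k. square_integrable M (fs k)" and [measurable]: "f \<in> borel_measurable M"
    and lim: "(\<lambda>k. \<integral>\<^sup>+x. ennreal ((fs k x - f x)\<^sup>2) \<partial>M) \<longlonglongrightarrow> 0"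
    using L by (auto simp: L2_tendsto_def)
  have [measurable]: "\<And>k. fs k \<in> borel_measurable M" using fs by measurable
  have "eventually (\<lambda>k. (\<integral>\<^sup>+x. ennreal ((fs k x - f x)\<^sup>2) \<partial>M) < 1) sequentially"
    by (rule order_tendstoD(2)[OF lim]) simp
  then obtain k where "(\<integral>\<^sup>+x. ennreal ((fs k x - f x)\<^sup>2) \<partial>M) < 1"
    by (auto simp: eventually_sequentially)
  then have "(\<integral>\<^sup>+x. ennreal ((fs k x - f x)\<^sup>2) \<partial>M) < \<infinity>"
    by (rule less_trans) simp
  then have "square_integrable M (\<lambda>x. fs k x - f x)"
    by (auto simp: square_integrable_def integrable_iff_bounded)
  from square_integrable_diff[OF fs[of k] this] show f: "square_integrable M f" by simp
  have "(\<integral>\<^sup>+x. ennreal ((fs k x - f x)\<^sup>2) \<partial>M) = ennreal (LINT x|M. (fs k x - f x)\<^sup>2)" for k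
    using square_integrable_diff[OF fs f] by (intro nn_integral_eq_integral) (auto simp: square_integrable_def)
  with lim show "(\<lambda>k. LINT x|M. (fs k x - f x)\<^sup>2) \<longlonglongrightarrow> 0"
    by (simp add: ennreal_tendsto_0_iff)
qed

text \<open>
  Joint continuity of the inner product. Applied to two approximating sequences at once it transfers
  bilinear identities between simple processes to their limits, whichever sequences are chosen.
\<close>

lemma L2_tendsto_inner:
  assumes f: "L2_tendsto M fs f" and g: "L2_tendsto M gs g"
  shows "(\<lambda>k. LINT x|M. fs k x * gs k x) \<longlonglongrightarrow> (LINT x|M. f x * g x)"
proof -
  note f2 = L2_tendsto_square_integrable[OF f] and g2 = L2_tendsto_square_integrable[OF g]
  have fs: "\<And>k. square_integrable M (fs k)" and gs: "\<And>k. square_integrable M (gs k)"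
    using f g by (auto simp: L2_tendsto_def)
  define df dg where "df k x = fs k x - f x" and "dg k x = gs k x - g x" for k x
  have d: "square_integrable M (df k)" "square_integrable M (dg k)" for k
    unfolding df_def dg_def by (intro square_integrable_diff fs gs f2 g2)+
  let ?n = "\<lambda>h. sqrt (LINT x|M. (h x)\<^sup>2)"
  have "(\<lambda>k. (LINT x|M. fs k x * gs k x) - (LINT x|M. f x * g x)) \<longlonglongrightarrow> 0"
  proof (rule Lim_null_comparison[OF always_eventually])
    show "\<forall>k. norm ((LINT x|M. fs k x * gs k x) - (LINT x|M. f x * g x))
      \<le> ?n (df k) * ?n (dg k) + ?n f * ?n (dg k) + ?n (df k) * ?n g"
    proof
      fix k
      have "(LINT x|M. fs k x * gs k x) - (LINT x|M. f x * g x)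
        = (LINT x|M. fs k x * gs k x - f x * g x)"
        by (simp add: square_integrable_mult fs gs f2 g2)
      also have "\<dots> = (LINT x|M. df k x * dg k x + f x * dg k x + df k x * g x)"
        by (intro Bochner_Integration.integral_cong) (auto simp: df_def dg_def algebra_simps)
      also have "\<dots> = (LINT x|M. df k x * dg k x) + (LINT x|M. f x * dg k x) + (LINT x|M. df k x * g x)"
        by (simp add: square_integrable_mult d f2 g2)
      also have "norm \<dots> \<le> (LINT x|M. \<bar>df k x * dg k x\<bar>) + (LINT x|M. \<bar>f x * dg k x\<bar>) + (LINT x|M. \<bar>df k x * g x\<bar>)"
        unfolding real_norm_def
        by (intro order_trans[OF abs_triangle_ineq] add_mono integral_abs_bound)
      also have "\<dots> \<le> ?n (df k) * ?n (dg k) + ?n f * ?n (dg k) + ?n (df k) * ?n g"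
        by (intro add_mono integral_abs_mult_le d f2 g2)
      finally show "norm ((LINT x|M. fs k x * gs k x) - (LINT x|M. f x * g x))
        \<le> ?n (df k) * ?n (dg k) + ?n f * ?n (dg k) + ?n (df k) * ?n g" .
    qed
    have df0: "(\<lambda>k. ?n (df k)) \<longlonglongrightarrow> 0" and dg0: "(\<lambda>k. ?n (dg k)) \<longlonglongrightarrow> 0"
      using tendsto_real_sqrt[OF L2_tendsto_norm[OF f]] tendsto_real_sqrt[OF L2_tendsto_norm[OF g]]
      by (simp_all add: df_def dg_def)
    show "(\<lambda>k. ?n (df k) * ?n (dg k) + ?n f * ?n (dg k) + ?n (df k) * ?n g) \<longlonglongrightarrow> 0"
      by (rule tendsto_eq_intros df0 dg0 | simp)+
  qed
  then show ?thesis by (simp add: LIM_zero_iff)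
qed

section \<open>The Ito integral of a deterministic integrand\<close>

context brownian_space
begin

lemma space_F: "0 \<le> t \<Longrightarrow> space (F t) = space M"
  using F_subalgebra[of t] by (simp add: subalgebra_def)

lemma F_measurable_M: "0 \<le> t \<Longrightarrow> f \<in> borel_measurable (F t) \<Longrightarrow> f \<in> borel_measurable M"
  by (rule measurable_from_subalg[OF F_subalgebra])

lemma F_measurable_mono:
  assumes "0 \<le> s" "s \<le> t" "f \<in> borel_measurable (F s)"
  shows "f \<in> borel_measurable (F t)"
proof (rule measurable_from_subalg)
  show "subalgebra (F t) (F s)"
    using assms F_mono[of s t] by (auto simp: subalgebra_def space_F)
qed fact

lemma increment_moments:
  assumes "0 \<le> s" "s < t"
  shows "square_integrable M (\<lambda>\<omega>. W t \<omega> - W s \<omega>)"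
    and "expectation (\<lambda>\<omega>. W t \<omega> - W s \<omega>) = 0"
    and "expectation (\<lambda>\<omega>. (W t \<omega> - W s \<omega>)\<^sup>2) = t - s"
proof -
  have pos: "0 < sqrt (t - s)" using assms by simp
  note D = W_normal[OF assms]
  have [measurable]: "W t \<in> borel_measurable M" "W s \<in> borel_measurable M"
    using assms by (auto intro: F_measurable_M[OF _ W_adapted])
  have "integrable M (\<lambda>\<omega>. (W t \<omega> - W s \<omega>)\<^sup>2)"
    using distributed_integrable[OF D, of "\<lambda>x. x\<^sup>2"] integrable_normal_moment[OF pos, of 0 2]
    by (simp add: normal_density_nonneg)
  then show "square_integrable M (\<lambda>\<omega>. W t \<omega> - W s \<omega>)"
    by (simp add: square_integrable_def)
  show E: "expectation (\<lambda>\<omega>. W t \<omega> - W s \<omega>) = 0"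
    by (rule normal_distributed_expectation[OF pos D])
  show "expectation (\<lambda>\<omega>. (W t \<omega> - W s \<omega>)\<^sup>2) = t - s"
    using normal_distributed_variance[OF pos D] assms by (simp add: E)
qed

lemma increment_indep:
  assumes st: "0 \<le> s" "s < t" and Z: "Z \<in> borel_measurable (F s)"
  shows "indep_var borel Z borel (\<lambda>\<omega>. W t \<omega> - W s \<omega>)"
  unfolding indep_var_eq
proof (intro conjI)
  have [measurable]: "W t \<in> borel_measurable M" "W s \<in> borel_measurable M" "Z \<in> borel_measurable M"
    using assms by (auto intro: F_measurable_M[OF _ W_adapted] F_measurable_M[OF st(1)])
  show "random_variable borel Z" "random_variable borel (\<lambda>\<omega>. W t \<omega> - W s \<omega>)" by measurable
  let ?V = "vimage_algebra (space M) (\<lambda>\<omega>. W t \<omega> - W s \<omega>) borel"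
  have "{Z -` A \<inter> space M |A. A \<in> sets borel} \<subseteq> sets (F s)"
    using measurable_sets[OF Z] space_F[OF st(1)] by auto
  then have 1: "sigma_sets (space M) {Z -` A \<inter> space M |A. A \<in> sets borel} \<subseteq> sets (F s)"
    using sets.sigma_sets_subset unfolding space_F[OF st(1), symmetric] by blast
  have 2: "sigma_sets (space M) {(\<lambda>\<omega>. W t \<omega> - W s \<omega>) -` A \<inter> space M |A. A \<in> sets borel} \<subseteq> sets ?V"
    by (simp add: sets_vimage_algebra)
  note ind = W_indep[OF st]
  show "indep_set (sigma_sets (space M) {Z -` A \<inter> space M |A. A \<in> sets borel})
     (sigma_sets (space M) {(\<lambda>\<omega>. W t \<omega> - W s \<omega>) -` A \<inter> space M |A. A \<in> sets borel})"
    by (rule indep_setI[OF subset_trans[OF 1 indep_setD_ev1[OF ind]] subset_trans[OF 2 indep_setD_ev2[OF ind]]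
          indep_setD[OF ind subsetD[OF 1] subsetD[OF 2]]])
qed

text \<open>
  An increment of the Brownian motion is centred, has the length of the time interval as variance, and
  is independent of the past. So the past factors out of these two expectations.
\<close>

lemma increment_orthogonal:
  assumes st: "0 \<le> s" "s \<le> t" and Z: "Z \<in> borel_measurable (F s)" "integrable M Z"
  shows "integrable M (\<lambda>\<omega>. Z \<omega> * (W t \<omega> - W s \<omega>))"
    and "expectation (\<lambda>\<omega>. Z \<omega> * (W t \<omega> - W s \<omega>)) = 0"
    and "integrable M (\<lambda>\<omega>. Z \<omega> * (W t \<omega> - W s \<omega>)\<^sup>2)"
    and "expectation (\<lambda>\<omega>. Z \<omega> * (W t \<omega> - W s \<omega>)\<^sup>2) = (t - s) * expectation Z"
proof -
  have "integrable M (\<lambda>\<omega>. Z \<omega> * (W t \<omega> - W s \<omega>)) \<and> expectation (\<lambda>\<omega>. Z \<omega> * (W t \<omega> - W s \<omega>)) = 0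
    \<and> integrable M (\<lambda>\<omega>. Z \<omega> * (W t \<omega> - W s \<omega>)\<^sup>2)
    \<and> expectation (\<lambda>\<omega>. Z \<omega> * (W t \<omega> - W s \<omega>)\<^sup>2) = (t - s) * expectation Z"
  proof (cases "s = t")
    case False
    then have st: "0 \<le> s" "s < t" using st by auto
    note m = increment_moments[OF st] and ind = increment_indep[OF st Z(1)]
    have ind2: "indep_var borel Z borel (\<lambda>\<omega>. (W t \<omega> - W s \<omega>)\<^sup>2)"
    proof -
      have "indep_var borel ((\<lambda>x. x) \<circ> Z) borel ((\<lambda>x. x\<^sup>2) \<circ> (\<lambda>\<omega>. W t \<omega> - W s \<omega>))"
        by (rule indep_var_compose[OF ind]) measurable
      then show ?thesis unfolding comp_def .
    qed
    have i: "integrable M (\<lambda>\<omega>. W t \<omega> - W s \<omega>)" "integrable M (\<lambda>\<omega>. (W t \<omega> - W s \<omega>)\<^sup>2)"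
      using square_integrable_integrable[OF m(1)] m(1)[unfolded square_integrable_def] by blast+
    show ?thesis
      using indep_var_integrable[OF ind Z(2) i(1)] indep_var_integrable[OF ind2 Z(2) i(2)]
      unfolding indep_var_lebesgue_integral[OF ind Z(2) i(1)]
        indep_var_lebesgue_integral[OF ind2 Z(2) i(2)] m(2,3) by (simp add: mult.commute)
  qed simp
  then show "integrable M (\<lambda>\<omega>. Z \<omega> * (W t \<omega> - W s \<omega>))"
    and "expectation (\<lambda>\<omega>. Z \<omega> * (W t \<omega> - W s \<omega>)) = 0"
    and "integrable M (\<lambda>\<omega>. Z \<omega> * (W t \<omega> - W s \<omega>)\<^sup>2)"
    and "expectation (\<lambda>\<omega>. Z \<omega> * (W t \<omega> - W s \<omega>)\<^sup>2) = (t - s) * expectation Z" by auto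
qed

lemma square_integrable_increment:
  assumes "0 \<le> a" "a \<le> b" "\<xi> \<in> borel_measurable (F a)" "\<And>\<omega>. \<omega> \<in> space M \<Longrightarrow> \<bar>\<xi> \<omega>\<bar> \<le> K"
  shows "square_integrable M (\<lambda>\<omega>. \<xi> \<omega> * (W b \<omega> - W a \<omega>))"
proof (rule square_integrable_bounded_mult)
  show "square_integrable M (\<lambda>\<omega>. W b \<omega> - W a \<omega>)"
    using increment_moments(1)[of a b] assms by (cases "a = b") (auto simp: square_integrable_def)
  show "\<xi> \<in> borel_measurable M" using assms by (intro F_measurable_M[of a])
qed (use assms in auto)

text \<open>
  If the second interval starts later, split the increments at \<open>c\<close> and at \<open>m = min b d\<close>. Every product
  of increments over disjoint intervals has expectation \<open>0\<close>, since the later increment is orthogonal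
  to what precedes it; what remains is the square of the increment over the overlap.
\<close>

lemma increment_cross_ordered:
  assumes ac: "0 \<le> a" "a \<le> c" and ab: "a \<le> b" and cd: "c \<le> d"
    and \<xi>: "\<xi> \<in> borel_measurable (F a)" "\<And>\<omega>. \<omega> \<in> space M \<Longrightarrow> \<bar>\<xi> \<omega>\<bar> \<le> K"
    and \<eta>: "\<eta> \<in> borel_measurable (F c)" "\<And>\<omega>. \<omega> \<in> space M \<Longrightarrow> \<bar>\<eta> \<omega>\<bar> \<le> L"
  shows "expectation (\<lambda>\<omega>. (\<xi> \<omega> * (W b \<omega> - W a \<omega>)) * (\<eta> \<omega> * (W d \<omega> - W c \<omega>)))
    = max 0 (min b d - c) * expectation (\<lambda>\<omega>. \<xi> \<omega> * \<eta> \<omega>)"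
proof -
  have c0: "0 \<le> c" using ac by simp
  have \<xi>c [measurable]: "\<xi> \<in> borel_measurable (F c)" using F_measurable_mono[OF ac \<xi>(1)] .
  have \<eta>c [measurable]: "\<eta> \<in> borel_measurable (F c)" by fact
  have b: "\<bar>\<xi> \<omega> * \<eta> \<omega>\<bar> \<le> K * L" if "\<omega> \<in> space M" for \<omega>
    using \<xi>(2)[OF that] \<eta>(2)[OF that] unfolding abs_mult by (intro mult_mono) auto
  have \<xi>\<eta>F [measurable]: "(\<lambda>\<omega>. \<xi> \<omega> * \<eta> \<omega>) \<in> borel_measurable (F c)" by measurable
  have \<xi>\<eta>M: "(\<lambda>\<omega>. \<xi> \<omega> * \<eta> \<omega>) \<in> borel_measurable M" using F_measurable_M[OF c0 \<xi>\<eta>F] .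
  have WF: "W s \<in> borel_measurable (F r)" if "0 \<le> s" "s \<le> r" for s r
    using F_measurable_mono[OF that W_adapted[OF that(1)]] .
  have Z: "(\<lambda>\<omega>. \<xi> \<omega> * \<eta> \<omega> * (W r \<omega> - W s \<omega>)) \<in> borel_measurable (F q)"
     "integrable M (\<lambda>\<omega>. \<xi> \<omega> * \<eta> \<omega> * (W r \<omega> - W s \<omega>))"
    if "0 \<le> s" "s \<le> r" "r \<le> q" "c \<le> q" for s r q
  proof -
    have [measurable]: "W r \<in> borel_measurable (F q)" "W s \<in> borel_measurable (F q)"
      "(\<lambda>\<omega>. \<xi> \<omega> * \<eta> \<omega>) \<in> borel_measurable (F q)"
      using WF[of r q] WF[of s q] F_measurable_mono[OF c0 _ \<xi>\<eta>F] that by auto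
    show "(\<lambda>\<omega>. \<xi> \<omega> * \<eta> \<omega> * (W r \<omega> - W s \<omega>)) \<in> borel_measurable (F q)" by measurable
    have "integrable M (\<lambda>\<omega>. 1 * (W r \<omega> - W s \<omega>))"
      by (rule increment_orthogonal(1)[OF that(1,2)]) simp_all
    then show "integrable M (\<lambda>\<omega>. \<xi> \<omega> * \<eta> \<omega> * (W r \<omega> - W s \<omega>))"
      using b by (intro integrable_bounded_mult[OF \<xi>\<eta>M, where K="K * L"]) simp_all
  qed
  have \<xi>\<eta>i: "integrable M (\<lambda>\<omega>. \<xi> \<omega> * \<eta> \<omega>)"
    using integrable_bounded_mult[OF \<xi>\<eta>M b integrable_const[of 1]] by simp
  show ?thesis
  proof (cases "b \<le> c")
    case True
    have "expectation (\<lambda>\<omega>. (\<xi> \<omega> * \<eta> \<omega> * (W b \<omega> - W a \<omega>)) * (W d \<omega> - W c \<omega>)) = 0"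
      by (rule increment_orthogonal(2)[OF c0 cd Z[OF ac(1) ab True order_refl]])
    then show ?thesis using True by (simp add: ac_simps)
  next
    case False
    define m where "m = min b d"
    \<comment> \<open>one of the increments after \<open>m\<close> vanishes, so their product does not appear below\<close>
    have m: "c \<le> m" "m \<le> b" "m \<le> d" "m = b \<or> m = d" using False cd by (auto simp: m_def)
    note t1 = increment_orthogonal(1,2)[OF c0 cd Z[OF ac(1) ac(2) order_refl order_refl]]
    note t2 = increment_orthogonal(3,4)[OF c0 m(1) \<xi>\<eta>F \<xi>\<eta>i]
    have m0: "0 \<le> m" using m c0 by simp
    note t3 = increment_orthogonal(1,2)[OF m0 m(3) Z[OF c0 m(1) order_refl m(1)]]
    note t4 = increment_orthogonal(1,2)[OF m0 m(2) Z[OF c0 m(1) order_refl m(1)]]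
    have "expectation (\<lambda>\<omega>. (\<xi> \<omega> * (W b \<omega> - W a \<omega>)) * (\<eta> \<omega> * (W d \<omega> - W c \<omega>)))
      = expectation (\<lambda>\<omega>. \<xi> \<omega> * \<eta> \<omega> * (W c \<omega> - W a \<omega>) * (W d \<omega> - W c \<omega>)
         + \<xi> \<omega> * \<eta> \<omega> * (W m \<omega> - W c \<omega>)\<^sup>2
         + \<xi> \<omega> * \<eta> \<omega> * (W m \<omega> - W c \<omega>) * (W d \<omega> - W m \<omega>)
         + \<xi> \<omega> * \<eta> \<omega> * (W m \<omega> - W c \<omega>) * (W b \<omega> - W m \<omega>))"
      using m(4) by (intro Bochner_Integration.integral_cong) (auto simp: power2_eq_square algebra_simps)
    also have "\<dots> = (m - c) * expectation (\<lambda>\<omega>. \<xi> \<omega> * \<eta> \<omega>)"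
      using t1 t2 t3 t4 by simp
    finally show ?thesis using m by (simp add: m_def)
  qed
qed

lemma increment_cross:
  assumes ab: "0 \<le> a" "a \<le> b" and cd: "0 \<le> c" "c \<le> d"
    and \<xi>: "\<xi> \<in> borel_measurable (F a)" "\<And>\<omega>. \<omega> \<in> space M \<Longrightarrow> \<bar>\<xi> \<omega>\<bar> \<le> K"
    and \<eta>: "\<eta> \<in> borel_measurable (F c)" "\<And>\<omega>. \<omega> \<in> space M \<Longrightarrow> \<bar>\<eta> \<omega>\<bar> \<le> L"
  shows "expectation (\<lambda>\<omega>. (\<xi> \<omega> * (W b \<omega> - W a \<omega>)) * (\<eta> \<omega> * (W d \<omega> - W c \<omega>)))
    = max 0 (min b d - max a c) * expectation (\<lambda>\<omega>. \<xi> \<omega> * \<eta> \<omega>)"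
proof (cases "a \<le> c")
  case True
  then show ?thesis
    using increment_cross_ordered[OF ab(1) True ab(2) cd(2) \<xi> \<eta>] by (simp add: max_def)
next
  case False
  then show ?thesis
    using increment_cross_ordered[OF cd(1) _ cd(2) ab(2) \<eta> \<xi>]
    by (simp add: max_def min.commute mult.commute)
qed

end

lemma sets_Leb [measurable_cong]: "sets (Leb t) = sets (restrict_space borel {0..t})"
  by (rule sets_restrict_space_cong) simp

lemma space_Leb [simp]: "space (Leb t) = {0..t}"
  by (simp add: space_restrict_space)

lemma finite_measure_Leb: "finite_measure (Leb t)"
  by (rule finite_measureI) (simp add: emeasure_restrict_space emeasure_lborel_Icc_eq)

lemma measurable_Leb_continuous: "continuous_on {0..t} f \<Longrightarrow> f \<in> borel_measurable (Leb t)"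
  for f :: "real \<Rightarrow> real"
  unfolding measurable_cong_sets[OF sets_Leb refl] by (rule borel_measurable_continuous_on_restrict)

lemma measurable_Leb_ident [measurable]: "(\<lambda>s. s) \<in> borel_measurable (Leb t)"
  by (rule measurable_Leb_continuous) (intro continuous_intros)

lemma measurable_Leb_fst [measurable]: "fst \<in> borel_measurable (Leb t \<Otimes>\<^sub>M M)"
  by (rule measurable_compose[OF measurable_fst measurable_Leb_ident])

lemma integrable_Leb_continuous:
  fixes f :: "real \<Rightarrow> real"
  assumes f: "continuous_on {0..t} f"
  shows "integrable (Leb t) f"
proof -
  interpret finite_measure "Leb t" by (rule finite_measure_Leb)
  obtain K where "\<forall>s\<in>{0..t}. norm (f s) \<le> K"
    using compact_imp_bounded[OF compact_continuous_image[OF f compact_Icc]]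
    unfolding bounded_iff by blast
  then show ?thesis
    by (intro integrable_const_bound[of _ K] AE_I2 measurable_Leb_continuous f) auto
qed

lemma integral_double_sum:
  fixes f :: "'a \<Rightarrow> 'b \<Rightarrow> 'c \<Rightarrow> real"
  assumes "\<And>i j. i \<in> I \<Longrightarrow> j \<in> H \<Longrightarrow> integrable M (f i j)"
  shows "(LINT x|M. (\<Sum>i\<in>I. \<Sum>j\<in>H. f i j x)) = (\<Sum>i\<in>I. \<Sum>j\<in>H. LINT x|M. f i j x)"
proof -
  have "(LINT x|M. (\<Sum>i\<in>I. \<Sum>j\<in>H. f i j x)) = (\<Sum>i\<in>I. LINT x|M. (\<Sum>j\<in>H. f i j x))"
    by (intro Bochner_Integration.integral_sum Bochner_Integration.integrable_sum assms)
  also have "\<dots> = (\<Sum>i\<in>I. \<Sum>j\<in>H. LINT x|M. f i j x)"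
    by (intro sum.cong refl Bochner_Integration.integral_sum assms)
  finally show ?thesis .
qed

lemma integral_pair_mult:
  fixes f g :: "_ \<Rightarrow> real"
  assumes P: "pair_sigma_finite M N" and f: "integrable M f" and g: "integrable N g"
  shows "(LINT p|(M \<Otimes>\<^sub>M N). f (fst p) * g (snd p)) = (LINT x|M. f x) * (LINT y|N. g y)"
proof -
  interpret pair_sigma_finite M N by fact
  show ?thesis
    using integral_fst'[OF integrable_pair_mult[OF P f g]] by simp
qed

context brownian_space
begin

lemma pair_Leb_M: "pair_sigma_finite (Leb t) M"
proof -
  interpret l: finite_measure "Leb t" by (rule finite_measure_Leb)
  show ?thesis ..
qed

lemma simple_processD:
  assumes S: "simple_process F T n \<tau> \<xi>" and i: "i < n"
  shows "0 \<le> \<tau> i" "\<tau> i \<le> \<tau> (Suc i)" "\<xi> i \<in> borel_measurable (F (\<tau> i))"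
    "\<exists>K. \<forall>\<omega>\<in>space M. \<bar>\<xi> i \<omega>\<bar> \<le> K"
proof -
  have "j \<le> n \<Longrightarrow> 0 \<le> \<tau> j" for j
    by (induction j) (use S in \<open>auto simp: simple_process_def intro: order_trans\<close>)
  then show "0 \<le> \<tau> i" using i by simp
  then show "\<exists>K. \<forall>\<omega>\<in>space M. \<bar>\<xi> i \<omega>\<bar> \<le> K"
    using S i space_F[of "\<tau> i"] unfolding simple_process_def bounded_iff by fastforce
qed (use S i in \<open>auto simp: simple_process_def\<close>)

text \<open>
  Stopping both increments at \<open>t\<close> turns the length of the overlap into the integral over \<open>[0, t]\<close> of the product
  of the indicators of the two intervals. An increment that starts after \<open>t\<close> vanishes; this
  case is separate, since \<open>\<xi>\<close> is then not known at time \<open>t\<close>.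
\<close>

lemma simple_term_cross:
  assumes ab: "0 \<le> a" "a \<le> b" and cd: "0 \<le> c" "c \<le> d" and t: "0 \<le> t"
    and \<xi>: "\<xi> \<in> borel_measurable (F a)" "\<And>\<omega>. \<omega> \<in> space M \<Longrightarrow> \<bar>\<xi> \<omega>\<bar> \<le> K"
    and \<eta>: "\<eta> \<in> borel_measurable (F c)" "\<And>\<omega>. \<omega> \<in> space M \<Longrightarrow> \<bar>\<eta> \<omega>\<bar> \<le> L"
  shows "expectation (\<lambda>\<omega>. (\<xi> \<omega> * (W (min b t) \<omega> - W (min a t) \<omega>)) * (\<eta> \<omega> * (W (min d t) \<omega> - W (min c t) \<omega>)))
    = (LINT s|(Leb t). indicator {a<..b} s * indicator {c<..d} s) * expectation (\<lambda>\<omega>. \<xi> \<omega> * \<eta> \<omega>)"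
proof (cases "a < t \<and> c < t")
  case True
  have "expectation (\<lambda>\<omega>. (\<xi> \<omega> * (W (min b t) \<omega> - W a \<omega>)) * (\<eta> \<omega> * (W (min d t) \<omega> - W c \<omega>)))
    = max 0 (min (min b t) (min d t) - max a c) * expectation (\<lambda>\<omega>. \<xi> \<omega> * \<eta> \<omega>)"
    by (rule increment_cross) (use ab cd True \<xi> \<eta> in auto)
  moreover have "(LINT s|(Leb t). indicator {a<..b} s * indicator {c<..d} s)
     = (LINT s|(Leb t). indicator {max a c<..min (min b t) (min d t)} s :: real)"
    by (intro Bochner_Integration.integral_cong) (auto simp: indicator_def)
  moreover have "\<dots> = max 0 (min (min b t) (min d t) - max a c)"
  proof -
    have "{max a c<..min (min b t) (min d t)} \<subseteq> {0..t}" using ab by auto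
    moreover have "measure lborel {u<..w} = max 0 (w - u)" for u w :: real
      by (cases "u \<le> w") auto
    ultimately show ?thesis
      by (simp add: Int_absorb2 measure_restrict_space del: measure_lborel_Ioc)
  qed
  moreover have "min a t = a" "min c t = c" using True by auto
  ultimately show ?thesis by (simp only:)
next
  case False
  then have "(LINT s|(Leb t). indicator {a<..b} s * indicator {c<..d} s) = (LINT s|(Leb t). 0 :: real)"
    by (intro Bochner_Integration.integral_cong) (auto simp: indicator_def)
  moreover have "(\<xi> \<omega> * (W (min b t) \<omega> - W (min a t) \<omega>)) * (\<eta> \<omega> * (W (min d t) \<omega> - W (min c t) \<omega>)) = 0" for \<omega>
  proof -
    have "min b t = min a t \<or> min d t = min c t" using False ab cd by (auto simp: min_def)
    then show ?thesis by auto
  qed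
  ultimately show ?thesis by (simp only: Bochner_Integration.integral_zero mult_zero_left)
qed

lemma square_integrable_simple_term:
  assumes ab: "0 \<le> a" "a \<le> b" and t: "0 \<le> t"
    and \<xi>: "\<xi> \<in> borel_measurable (F a)" "\<And>\<omega>. \<omega> \<in> space M \<Longrightarrow> \<bar>\<xi> \<omega>\<bar> \<le> K"
  shows "square_integrable M (\<lambda>\<omega>. \<xi> \<omega> * (W (min b t) \<omega> - W (min a t) \<omega>))"
proof (cases "a < t")
  case True
  then have "square_integrable M (\<lambda>\<omega>. \<xi> \<omega> * (W (min b t) \<omega> - W a \<omega>))"
    using ab by (intro square_integrable_increment[OF ab(1) _ \<xi>]) auto
  then show ?thesis using True by (simp add: min_absorb1)
next
  case False
  then show ?thesis using ab by (simp add: min_absorb2 square_integrable_def)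
qed

lemma square_integrable_simple_ito_integral:
  assumes "simple_process F T n \<tau> \<xi>" and t: "0 \<le> t"
  shows "square_integrable M (simple_ito_integral W n \<tau> \<xi> t)"
  unfolding simple_ito_integral_def[abs_def]
proof (rule square_integrable_sum)
  fix i assume "i \<in> {..<n}"
  then have "i < n" by simp
  note p = simple_processD[OF assms(1) this]
  obtain K where "\<forall>\<omega>\<in>space M. \<bar>\<xi> i \<omega>\<bar> \<le> K" using p(4) by blast
  then show "square_integrable M (\<lambda>\<omega>. \<xi> i \<omega> * (W (min (\<tau> (Suc i)) t) \<omega> - W (min (\<tau> i) t) \<omega>))"
    by (intro square_integrable_simple_term[OF p(1,2) t p(3)]) auto
qed

lemma integrable_bounded_M:
  fixes f :: "'w \<Rightarrow> real"
  assumes "f \<in> borel_measurable M" "\<And>\<omega>. \<omega> \<in> space M \<Longrightarrow> \<bar>f \<omega>\<bar> \<le> K"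
  shows "integrable M f"
  by (rule integrable_const_bound[of _ K]) (use assms in auto)

lemma integrable_Leb_indicators:
  "integrable (Leb t) (\<lambda>s. indicator {a<..b} s * indicator {c<..d} s :: real)"
proof -
  interpret l: finite_measure "Leb t" by (rule finite_measure_Leb)
  show ?thesis
    by (rule l.integrable_const_bound[of _ 1]) (auto simp: indicator_def)
qed

lemma square_integrable_simple_value:
  assumes S: "simple_process F T n \<tau> \<xi>"
  shows "square_integrable (Leb t \<Otimes>\<^sub>M M) (\<lambda>p. simple_value n \<tau> \<xi> (fst p) (snd p))"
  unfolding simple_value_def
proof (rule square_integrable_sum)
  fix i assume "i \<in> {..<n}"
  then have "i < n" by simp
  note p = simple_processD[OF S this]
  obtain K where K: "\<forall>\<omega>\<in>space M. \<bar>\<xi> i \<omega>\<bar> \<le> K" using p(4) by blast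
  have m: "\<xi> i \<in> borel_measurable M" by (rule F_measurable_M[OF p(1) p(3)])
  have "\<bar>(\<xi> i \<omega>)\<^sup>2\<bar> \<le> K\<^sup>2" if "\<omega> \<in> space M" for \<omega>
    using K that by (simp add: abs_le_square_iff[symmetric] order_trans[OF _ abs_ge_self])
  then have "integrable M (\<lambda>\<omega>. (\<xi> i \<omega>)\<^sup>2)" using m by (intro integrable_bounded_M) auto
  from integrable_pair_mult[OF pair_Leb_M integrable_Leb_indicators this]
  have "integrable (Leb t \<Otimes>\<^sub>M M) (\<lambda>p. (\<xi> i (snd p) * indicator {\<tau> i<..\<tau> (Suc i)} (fst p))\<^sup>2)"
    by (simp add: power_mult_distrib power2_eq_square ac_simps)
  moreover have "(\<lambda>p. \<xi> i (snd p) * indicator {\<tau> i<..\<tau> (Suc i)} (fst p)) \<in> borel_measurable (Leb t \<Otimes>\<^sub>M M)"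
    using integrable_pair_mult[OF pair_Leb_M integrable_Leb_indicators[of t "\<tau> i" "\<tau> (Suc i)" "\<tau> i" "\<tau> (Suc i)"] integrable_bounded_M[OF m, of K]] K
    by (auto dest!: borel_measurable_integrable simp: mult.commute indicator_inter_arith[symmetric])
  ultimately show "square_integrable (Leb t \<Otimes>\<^sub>M M) (\<lambda>p. \<xi> i (snd p) * indicator {\<tau> i<..\<tau> (Suc i)} (fst p))"
    by (simp add: square_integrable_def)
qed

text \<open>
  The Ito isometry, polarised and for two simple processes over unrelated partitions. Treating the
  integrals as a bilinear form avoids a common refinement of the partitions.
\<close>

lemma simple_isometry:
  assumes S: "simple_process F T n \<tau> \<xi>" and S': "simple_process F T n' \<tau>' \<xi>'" and t: "0 \<le> t"
  shows "expectation (\<lambda>\<omega>. simple_ito_integral W n \<tau> \<xi> t \<omega> * simple_ito_integral W n' \<tau>' \<xi>' t \<omega>)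
    = (LINT p|(Leb t \<Otimes>\<^sub>M M). simple_value n \<tau> \<xi> (fst p) (snd p) * simple_value n' \<tau>' \<xi>' (fst p) (snd p))"
proof -
  let ?a = "\<lambda>i \<omega>. \<xi> i \<omega> * (W (min (\<tau> (Suc i)) t) \<omega> - W (min (\<tau> i) t) \<omega>)"
  let ?b = "\<lambda>i \<omega>. \<xi>' i \<omega> * (W (min (\<tau>' (Suc i)) t) \<omega> - W (min (\<tau>' i) t) \<omega>)"
  let ?i = "\<lambda>i j s. indicator {\<tau> i<..\<tau> (Suc i)} s * indicator {\<tau>' j<..\<tau>' (Suc j)} s :: real"
  have summand: "integrable M (\<lambda>\<omega>. ?a i \<omega> * ?b j \<omega>)"
    "integrable (Leb t \<Otimes>\<^sub>M M) (\<lambda>p. ?i i j (fst p) * (\<xi> i (snd p) * \<xi>' j (snd p)))"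
    "expectation (\<lambda>\<omega>. ?a i \<omega> * ?b j \<omega>) = (LINT p|(Leb t \<Otimes>\<^sub>M M). ?i i j (fst p) * (\<xi> i (snd p) * \<xi>' j (snd p)))"
    if "i < n" "j < n'" for i j
  proof -
    note p = simple_processD[OF S that(1)] and p' = simple_processD[OF S' that(2)]
    obtain K where K: "\<And>\<omega>. \<omega> \<in> space M \<Longrightarrow> \<bar>\<xi> i \<omega>\<bar> \<le> K" using p(4) by blast
    obtain K' where K': "\<And>\<omega>. \<omega> \<in> space M \<Longrightarrow> \<bar>\<xi>' j \<omega>\<bar> \<le> K'" using p'(4) by blast
    show "integrable M (\<lambda>\<omega>. ?a i \<omega> * ?b j \<omega>)"
      by (intro square_integrable_mult square_integrable_simple_term[OF p(1,2) t p(3) K]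
          square_integrable_simple_term[OF p'(1,2) t p'(3) K'])
    have i: "integrable M (\<lambda>\<omega>. \<xi> i \<omega> * \<xi>' j \<omega>)"
      by (intro integrable_bounded_mult[OF F_measurable_M[OF p(1,3)] K] integrable_bounded_M[OF F_measurable_M[OF p'(1,3)] K'])
    show "integrable (Leb t \<Otimes>\<^sub>M M) (\<lambda>p. ?i i j (fst p) * (\<xi> i (snd p) * \<xi>' j (snd p)))"
      by (rule integrable_pair_mult[OF pair_Leb_M integrable_Leb_indicators i])
    show "expectation (\<lambda>\<omega>. ?a i \<omega> * ?b j \<omega>) = (LINT p|(Leb t \<Otimes>\<^sub>M M). ?i i j (fst p) * (\<xi> i (snd p) * \<xi>' j (snd p)))"
      unfolding integral_pair_mult[OF pair_Leb_M integrable_Leb_indicators i]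
      by (rule simple_term_cross[OF p(1,2) p'(1,2) t p(3) K p'(3) K'])
  qed
  have "expectation (\<lambda>\<omega>. simple_ito_integral W n \<tau> \<xi> t \<omega> * simple_ito_integral W n' \<tau>' \<xi>' t \<omega>)
    = (\<Sum>i<n. \<Sum>j<n'. expectation (\<lambda>\<omega>. ?a i \<omega> * ?b j \<omega>))"
    unfolding simple_ito_integral_def sum_product by (rule integral_double_sum) (auto intro!: summand(1))
  also have "\<dots> = (\<Sum>i<n. \<Sum>j<n'. (LINT p|(Leb t \<Otimes>\<^sub>M M). ?i i j (fst p) * (\<xi> i (snd p) * \<xi>' j (snd p))))"
    by (intro sum.cong refl summand(3)) auto
  also have "\<dots> = (LINT p|(Leb t \<Otimes>\<^sub>M M). (\<Sum>i<n. \<Sum>j<n'. ?i i j (fst p) * (\<xi> i (snd p) * \<xi>' j (snd p))))"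
    by (rule integral_double_sum[symmetric]) (auto intro!: summand(2))
  also have "\<dots> = (LINT p|(Leb t \<Otimes>\<^sub>M M). simple_value n \<tau> \<xi> (fst p) (snd p) * simple_value n' \<tau>' \<xi>' (fst p) (snd p))"
    unfolding simple_value_def sum_product by (simp add: ac_simps)
  finally show ?thesis .
qed

text \<open>
  Between \<open>s\<close> and \<open>t\<close> each summand grows by \<open>\<xi> i\<close> times the increment of \<open>W\<close> over the part of its interval
  that lies in \<open>[s, t]\<close>. That increment starts no earlier than \<open>s\<close> and \<open>\<tau> i\<close>, so it is orthogonal to \<open>\<xi> i G\<close>.
\<close>

lemma simple_martingale:
  assumes S: "simple_process F T n \<tau> \<xi>" and st: "0 \<le> s" "s \<le> t"
    and G: "G \<in> borel_measurable (F s)" "square_integrable M G"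
  shows "expectation (\<lambda>\<omega>. simple_ito_integral W n \<tau> \<xi> t \<omega> * G \<omega>) = expectation (\<lambda>\<omega>. simple_ito_integral W n \<tau> \<xi> s \<omega> * G \<omega>)"
proof -
  let ?a = "\<lambda>i t \<omega>. \<xi> i \<omega> * (W (min (\<tau> (Suc i)) t) \<omega> - W (min (\<tau> i) t) \<omega>)"
  have t: "0 \<le> t" using st by simp
  have summand: "integrable M (\<lambda>\<omega>. ?a i t \<omega> * G \<omega>)" "integrable M (\<lambda>\<omega>. ?a i s \<omega> * G \<omega>)"
    "expectation (\<lambda>\<omega>. ?a i t \<omega> * G \<omega>) = expectation (\<lambda>\<omega>. ?a i s \<omega> * G \<omega>)" if i: "i < n" for i
  proof -
    note p = simple_processD[OF S i]
    obtain K where K: "\<And>\<omega>. \<omega> \<in> space M \<Longrightarrow> \<bar>\<xi> i \<omega>\<bar> \<le> K" using p(4) by blast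
    show it: "integrable M (\<lambda>\<omega>. ?a i t \<omega> * G \<omega>)"
      by (intro square_integrable_mult square_integrable_simple_term[OF p(1,2) t p(3) K] G)
    show is': "integrable M (\<lambda>\<omega>. ?a i s \<omega> * G \<omega>)"
      by (intro square_integrable_mult square_integrable_simple_term[OF p(1,2) st(1) p(3) K] G)
    let ?b = "min (\<tau> (Suc i)) t" and ?c = "max (\<tau> i) s"
    consider "\<tau> (Suc i) \<le> s" | "t \<le> \<tau> i" | "\<tau> i < t" "s < \<tau> (Suc i)" by linarith
    then show "expectation (\<lambda>\<omega>. ?a i t \<omega> * G \<omega>) = expectation (\<lambda>\<omega>. ?a i s \<omega> * G \<omega>)"
    proof cases
      case 1
      then show ?thesis using st p by (simp add: min_absorb1)
    next
      case 2
      then show ?thesis using st p by (simp add: min_absorb2)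
    next
      case 3
      have c: "0 \<le> ?c" "?c \<le> ?b" using 3 st p by auto
      have [measurable]: "\<xi> i \<in> borel_measurable (F ?c)" "G \<in> borel_measurable (F ?c)"
        using p(3) G(1) by (auto intro: F_measurable_mono[OF p(1)] F_measurable_mono[OF st(1)])
      have "integrable M (\<lambda>\<omega>. \<xi> i \<omega> * G \<omega>)"
        by (intro integrable_bounded_mult[OF F_measurable_M[OF p(1,3)] K] square_integrable_integrable G)
      then have "expectation (\<lambda>\<omega>. (\<xi> i \<omega> * G \<omega>) * (W ?b \<omega> - W ?c \<omega>)) = 0"
        by (intro increment_orthogonal(2)[OF c]) measurable
      also have "(\<lambda>\<omega>. (\<xi> i \<omega> * G \<omega>) * (W ?b \<omega> - W ?c \<omega>)) = (\<lambda>\<omega>. ?a i t \<omega> * G \<omega> - ?a i s \<omega> * G \<omega>)"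
        using 3 st by (auto simp: fun_eq_iff min_def max_def algebra_simps)
      finally show ?thesis using it is' by simp
    qed
  qed
  show ?thesis
    unfolding simple_ito_integral_def sum_distrib_right
    by (subst (1 2) Bochner_Integration.integral_sum) (auto intro!: summand sum.cong)
qed

lemma ito_integral_L2_limits:
  assumes I: "ito_integral M F W T (\<lambda>t \<omega>. \<sigma> t) I" and \<sigma>: "continuous_on {0..T} \<sigma>"
  obtains n \<tau> \<xi> where "\<And>k::nat. simple_process F T (n k) (\<tau> k) (\<xi> k)"
    and "\<And>t. t \<in> {0..T} \<Longrightarrow> L2_tendsto M (\<lambda>k. simple_ito_integral W (n k) (\<tau> k) (\<xi> k) t) (I t)"
    and "\<And>t. t \<in> {0..T} \<Longrightarrow> L2_tendsto (Leb t \<Otimes>\<^sub>M M)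
      (\<lambda>k p. simple_value (n k) (\<tau> k) (\<xi> k) (fst p) (snd p)) (\<lambda>p. \<sigma> (fst p))"
proof -
  have ad: "adapted F T I" using I by (simp add: ito_integral_def)
  obtain n \<tau> \<xi> where *: "\<forall>k::nat. simple_process F T (n k) (\<tau> k) (\<xi> k)"
    and lim: "(\<lambda>k. \<integral>\<^sup>+\<omega>. (\<integral>\<^sup>+t\<in>{0..T}. ennreal ((simple_value (n k) (\<tau> k) (\<xi> k) t \<omega> - \<sigma> t)\<^sup>2) \<partial>lborel) \<partial>M)
         \<longlonglongrightarrow> 0"
    and **: "\<forall>t\<in>{0..T}. (\<lambda>k. \<integral>\<^sup>+\<omega>. ennreal ((simple_ito_integral W (n k) (\<tau> k) (\<xi> k) t \<omega> - I t \<omega>)\<^sup>2) \<partial>M)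
         \<longlonglongrightarrow> 0"
    using I unfolding ito_integral_def by (elim conjE exE) (rule that)
  note S = *[rule_format] and limI = **[rule_format]
  have L1: "L2_tendsto M (\<lambda>k. simple_ito_integral W (n k) (\<tau> k) (\<xi> k) t) (I t)" if t: "t \<in> {0..T}" for t
    unfolding L2_tendsto_def
  proof (intro conjI allI limI t)
    show "square_integrable M (simple_ito_integral W (n k) (\<tau> k) (\<xi> k) t)" for k
      by (rule square_integrable_simple_ito_integral[OF S]) (use t in auto)
    show "random_variable borel (I t)"
      using ad t by (intro F_measurable_M[of t]) (auto simp: adapted_def)
  qed
  have L2: "L2_tendsto (Leb t \<Otimes>\<^sub>M M)
      (\<lambda>k p. simple_value (n k) (\<tau> k) (\<xi> k) (fst p) (snd p)) (\<lambda>p. \<sigma> (fst p))" if t: "t \<in> {0..T}" for t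
    unfolding L2_tendsto_def
  proof (intro conjI allI)
    show "square_integrable (Leb t \<Otimes>\<^sub>M M) (\<lambda>p. simple_value (n k) (\<tau> k) (\<xi> k) (fst p) (snd p))" for k
      by (rule square_integrable_simple_value[OF S])
    then have [measurable]: "(\<lambda>p. simple_value (n k) (\<tau> k) (\<xi> k) (fst p) (snd p)) \<in> borel_measurable (Leb t \<Otimes>\<^sub>M M)" for k
      by (simp add: square_integrable_def)
    have "\<sigma> \<in> borel_measurable (Leb t)"
      using t by (intro measurable_Leb_continuous continuous_on_subset[OF \<sigma>]) auto
    from measurable_compose[OF measurable_fst this]
    show sm [measurable]: "(\<lambda>p. \<sigma> (fst p)) \<in> borel_measurable (Leb t \<Otimes>\<^sub>M M)" .
    let ?d = "\<lambda>k s \<omega>. ennreal ((simple_value (n k) (\<tau> k) (\<xi> k) s \<omega> - \<sigma> s)\<^sup>2)"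
    interpret P: pair_sigma_finite "Leb t" M by (rule pair_Leb_M)
    have "(\<integral>\<^sup>+p. ?d k (fst p) (snd p) \<partial>(Leb t \<Otimes>\<^sub>M M)) \<le> (\<integral>\<^sup>+\<omega>. (\<integral>\<^sup>+s\<in>{0..T}. ?d k s \<omega> \<partial>lborel) \<partial>M)" for k
    proof -
      have "(\<integral>\<^sup>+p. ?d k (fst p) (snd p) \<partial>(Leb t \<Otimes>\<^sub>M M)) = (\<integral>\<^sup>+\<omega>. (\<integral>\<^sup>+s. ?d k s \<omega> \<partial>Leb t) \<partial>M)"
        by (subst P.nn_integral_snd[symmetric]) auto
      also have "\<dots> \<le> (\<integral>\<^sup>+\<omega>. (\<integral>\<^sup>+s\<in>{0..T}. ?d k s \<omega> \<partial>lborel) \<partial>M)"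
        using t by (intro nn_integral_mono) (auto simp: nn_integral_restrict_space intro!: nn_integral_mono split: split_indicator)
      finally show ?thesis .
    qed
    then show "(\<lambda>k. \<integral>\<^sup>+p. ?d k (fst p) (snd p) \<partial>(Leb t \<Otimes>\<^sub>M M)) \<longlonglongrightarrow> 0"
      by (intro tendsto_sandwich[OF _ _ tendsto_const lim]) auto
  qed
  from S L1 L2 show thesis by (rule that)
qed

lemma ito_integral_square_integrable:
  assumes I: "ito_integral M F W T (\<lambda>t \<omega>. \<sigma> t) I" and \<sigma>: "continuous_on {0..T} \<sigma>" and t: "t \<in> {0..T}"
  shows "square_integrable M (I t)"
proof -
  obtain n \<tau> \<xi> where "\<And>k::nat. simple_process F T (n k) (\<tau> k) (\<xi> k)"
    and L: "\<And>t. t \<in> {0..T} \<Longrightarrow> L2_tendsto M (\<lambda>k. simple_ito_integral W (n k) (\<tau> k) (\<xi> k) t) (I t)"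
    by (rule ito_integral_L2_limits[OF I \<sigma>]) (rule that)
  show ?thesis by (rule L2_tendsto_square_integrable[OF L[OF t]])
qed

text \<open>
  For a deterministic integrand two Ito integrals may be built from different approximating sequences.
  Their inner product is the limit of the inner products of the approximations, hence again
  \<open>\<integral>\<sigma>\<^sup>2\<close>. This covers the isometry (\<open>I = I'\<close>) and yields uniqueness below.
\<close>

lemma ito_isometry:
  assumes I: "ito_integral M F W T (\<lambda>t \<omega>. \<sigma> t) I" and I': "ito_integral M F W T (\<lambda>t \<omega>. \<sigma> t) I'"
    and \<sigma>: "continuous_on {0..T} \<sigma>" and t: "t \<in> {0..T}"
  shows "expectation (\<lambda>\<omega>. I t \<omega> * I' t \<omega>) = (LINT s|(Leb t). (\<sigma> s)\<^sup>2)"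
proof -
  obtain n \<tau> \<xi> where S: "\<And>k::nat. simple_process F T (n k) (\<tau> k) (\<xi> k)"
    and L: "\<And>t. t \<in> {0..T} \<Longrightarrow> L2_tendsto M (\<lambda>k. simple_ito_integral W (n k) (\<tau> k) (\<xi> k) t) (I t)"
    and V: "\<And>t. t \<in> {0..T} \<Longrightarrow> L2_tendsto (Leb t \<Otimes>\<^sub>M M) (\<lambda>k p. simple_value (n k) (\<tau> k) (\<xi> k) (fst p) (snd p)) (\<lambda>p. \<sigma> (fst p))"
    by (rule ito_integral_L2_limits[OF I \<sigma>]) (rule that)
  obtain n' \<tau>' \<xi>' where S': "\<And>k::nat. simple_process F T (n' k) (\<tau>' k) (\<xi>' k)"
    and L': "\<And>t. t \<in> {0..T} \<Longrightarrow> L2_tendsto M (\<lambda>k. simple_ito_integral W (n' k) (\<tau>' k) (\<xi>' k) t) (I' t)"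
    and V': "\<And>t. t \<in> {0..T} \<Longrightarrow> L2_tendsto (Leb t \<Otimes>\<^sub>M M) (\<lambda>k p. simple_value (n' k) (\<tau>' k) (\<xi>' k) (fst p) (snd p)) (\<lambda>p. \<sigma> (fst p))"
    by (rule ito_integral_L2_limits[OF I' \<sigma>]) (rule that)
  have t0: "0 \<le> t" using t by simp
  have "expectation (\<lambda>\<omega>. I t \<omega> * I' t \<omega>) = (LINT p|(Leb t \<Otimes>\<^sub>M M). \<sigma> (fst p) * \<sigma> (fst p))"
    using L2_tendsto_inner[OF V[OF t] V'[OF t]] unfolding simple_isometry[OF S S' t0, symmetric]
    by (rule LIMSEQ_unique[OF L2_tendsto_inner[OF L[OF t] L'[OF t]]])
  also have "\<dots> = (LINT p|(Leb t \<Otimes>\<^sub>M M). (\<sigma> (fst p))\<^sup>2 * 1)"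
    by (simp add: power2_eq_square)
  also have "\<dots> = (LINT s|(Leb t). (\<sigma> s)\<^sup>2) * expectation (\<lambda>_. 1)"
  proof (rule integral_pair_mult[OF pair_Leb_M])
    have "continuous_on {0..t} (\<lambda>s. (\<sigma> s)\<^sup>2)"
      using t by (intro continuous_intros continuous_on_subset[OF \<sigma>]) auto
    then show "integrable (Leb t) (\<lambda>s. (\<sigma> s)\<^sup>2)"
      by (rule integrable_Leb_continuous)
  qed simp
  finally show ?thesis by (simp add: prob_space)
qed

lemma ito_martingale:
  assumes I: "ito_integral M F W T (\<lambda>t \<omega>. \<sigma> t) I" and \<sigma>: "continuous_on {0..T} \<sigma>"
    and st: "0 \<le> s" "s \<le> t" "t \<le> T" and G: "G \<in> borel_measurable (F s)" "square_integrable M G"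
  shows "expectation (\<lambda>\<omega>. I t \<omega> * G \<omega>) = expectation (\<lambda>\<omega>. I s \<omega> * G \<omega>)"
proof -
  obtain n \<tau> \<xi> where S: "\<And>k::nat. simple_process F T (n k) (\<tau> k) (\<xi> k)"
    and L: "\<And>t. t \<in> {0..T} \<Longrightarrow> L2_tendsto M (\<lambda>k. simple_ito_integral W (n k) (\<tau> k) (\<xi> k) t) (I t)"
    by (rule ito_integral_L2_limits[OF I \<sigma>]) (rule that)
  have "t \<in> {0..T}" "s \<in> {0..T}" using st by auto
  from L2_tendsto_inner[OF L[OF this(1)] L2_tendsto_const[OF G(2)]]
    L2_tendsto_inner[OF L[OF this(2)] L2_tendsto_const[OF G(2)]]
  show ?thesis
    unfolding simple_martingale[OF S st(1,2) G] by (rule LIMSEQ_unique)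
qed

text \<open>
  By the polarised isometry all three terms of the expanded square of \<open>I t - I' t\<close> have the same mean.
\<close>

lemma ito_integral_unique:
  assumes I: "ito_integral M F W T (\<lambda>t \<omega>. \<sigma> t) I" and I': "ito_integral M F W T (\<lambda>t \<omega>. \<sigma> t) I'"
    and \<sigma>: "continuous_on {0..T} \<sigma>" and t: "t \<in> {0..T}"
  shows "AE \<omega> in M. I t \<omega> = I' t \<omega>"
proof -
  note s = ito_integral_square_integrable[OF I \<sigma> t] and s' = ito_integral_square_integrable[OF I' \<sigma> t]
  have d: "integrable M (\<lambda>\<omega>. (I t \<omega> - I' t \<omega>)\<^sup>2)"
    using square_integrable_diff[OF s s'] by (simp add: square_integrable_def)
  have "expectation (\<lambda>\<omega>. (I t \<omega> - I' t \<omega>)\<^sup>2)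
     = expectation (\<lambda>\<omega>. I t \<omega> * I t \<omega> - 2 * (I t \<omega> * I' t \<omega>) + I' t \<omega> * I' t \<omega>)"
    by (simp add: power2_eq_square algebra_simps)
  also have "\<dots> = 0"
    using square_integrable_mult[OF s s] square_integrable_mult[OF s s'] square_integrable_mult[OF s' s']
    by (simp add: ito_isometry[OF I I \<sigma> t] ito_isometry[OF I I' \<sigma> t] ito_isometry[OF I' I' \<sigma> t])
  finally show ?thesis
    using integral_nonneg_eq_0_iff_AE[OF d] by simp
qed

end

section \<open>Calculus on a time interval\<close>

lemma Leb_integral_continuous:
  fixes f :: "real \<Rightarrow> real"
  assumes f: "continuous_on {0..t} f"
  shows "(LINT s|(Leb t). f s) = integral {0..t} f"
proof -
  have "set_integrable lborel {0..t} f"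
    unfolding set_integrable_def by (rule borel_integrable_compact[OF compact_Icc f])
  from set_borel_integral_eq_integral(2)[OF this] show ?thesis
    by (simp add: integral_restrict_space set_lebesgue_integral_def)
qed

lemma Leb_integral_initial:
  fixes f :: "real \<Rightarrow> real"
  assumes "t \<in> {0..T}"
  shows "(LINT s|(Leb t). f s) = (LINT s|(Leb T). indicator {..t} s * f s)"
  using assms
  by (auto simp: integral_restrict_space intro!: Bochner_Integration.integral_cong split: split_indicator)

lemma integrable_Leb_indicator:
  fixes f :: "real \<Rightarrow> real"
  assumes "integrable (Leb T) f"
  shows "integrable (Leb T) (\<lambda>s. indicator {..t} s * f s)"
  using integrable_real_mult_indicator[OF _ assms, of "{..t} \<inter> {0..T}"]
  by (rule Bochner_Integration.integrable_cong[THEN iffD1, rotated -1])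
    (auto simp: sets_Leb sets_restrict_space_iff split: split_indicator)

lemma integrable_Leb_initial:
  fixes f :: "real \<Rightarrow> real"
  assumes "t \<in> {0..T}" "integrable (Leb T) f"
  shows "integrable (Leb t) f"
proof -
  have "integrable lborel (\<lambda>s. indicator {0..T} s *\<^sub>R (indicator {..t} s * f s))"
    using integrable_Leb_indicator[OF assms(2), of t] by (simp add: integrable_restrict_space)
  also have "(\<lambda>s. indicator {0..T} s *\<^sub>R (indicator {..t} s * f s)) = (\<lambda>s. indicator {0..t} s *\<^sub>R f s)"
    using assms(1) by (auto simp: fun_eq_iff split: split_indicator)
  finally show ?thesis by (simp add: integrable_restrict_space)
qed

lemma Leb_integral_cong_AE:
  fixes f g :: "real \<Rightarrow> real"
  assumes [measurable]: "f \<in> borel_measurable (Leb T)" "g \<in> borel_measurable (Leb T)"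
    and t: "t \<in> {0..T}" and eq: "AE s in Leb T. s \<le> t \<longrightarrow> f s = g s"
  shows "(LINT s|(Leb t). f s) = (LINT s|(Leb t). g s)"
  unfolding Leb_integral_initial[OF t]
proof (rule integral_cong_AE)
  show "(\<lambda>s. indicator {..t} s * f s) \<in> borel_measurable (Leb T)"
    "(\<lambda>s. indicator {..t} s * g s) \<in> borel_measurable (Leb T)" by measurable
  show "AE s in Leb T. indicator {..t} s * f s = indicator {..t} s * g s"
    using eq by eventually_elim (auto split: split_indicator)
qed

text \<open>
  Gronwall's inequality in integral form, for a bound \<open>K\<close> that may vary in time. With \<open>\<Phi>\<close> the integral of
  \<open>f\<close> and \<open>\<kappa>\<close> that of \<open>K\<close>, the function \<open>exp (- \<alpha> t) \<Phi> t - \<kappa> t\<close> starts at \<open>0\<close> and is nonincreasing. A bound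
  that varies in time can contain the Ito integral at time \<open>t\<close>, whose mean square the isometry gives.
\<close>

lemma gronwall:
  fixes f K :: "real \<Rightarrow> real"
  assumes f: "continuous_on {0..T} f" and K: "continuous_on {0..T} K" "\<And>s. s \<in> {0..T} \<Longrightarrow> 0 \<le> K s"
    and \<alpha>: "0 \<le> \<alpha>" and le: "\<And>t. t \<in> {0..T} \<Longrightarrow> f t \<le> K t + \<alpha> * (LINT s|(Leb t). f s)"
    and t: "t \<in> {0..T}"
  shows "f t \<le> K t + \<alpha> * exp (\<alpha> * T) * (LINT s|(Leb T). K s)"
proof -
  have sub: "{0..s} \<subseteq> {0..T}" if "s \<in> {0..T}" for s using that by auto
  define \<Phi> where "\<Phi> r = integral {0..r} f" for r
  define \<kappa> where "\<kappa> r = integral {0..r} K" for r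
  define \<Psi> where "\<Psi> r = exp (- \<alpha> * r) * \<Phi> r - \<kappa> r" for r
  have le': "f s \<le> K s + \<alpha> * \<Phi> s" if "s \<in> {0..T}" for s
    using le[OF that] Leb_integral_continuous[OF continuous_on_subset[OF f sub[OF that]]] by (simp add: \<Phi>_def)
  have D: "(\<Phi> has_real_derivative f s) (at s within {0..T})"
          "(\<kappa> has_real_derivative K s) (at s within {0..T})" if "s \<in> {0..T}" for s
    unfolding \<Phi>_def[abs_def] \<kappa>_def[abs_def] using that
    by (simp_all add: integral_has_real_derivative[OF f] integral_has_real_derivative[OF K(1)])
  have D\<Psi>: "(\<Psi> has_real_derivative (exp (- \<alpha> * s) * (f s - \<alpha> * \<Phi> s) - K s)) (at s within {0..T})"
    if "s \<in> {0..T}" for s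
    unfolding \<Psi>_def[abs_def] using D[OF that]
    by (auto intro!: derivative_eq_intros simp: algebra_simps)
  have "\<Psi> t \<le> \<Psi> 0"
  proof (rule DERIV_nonpos_imp_decreasing_open[where f=\<Psi>])
    show "0 \<le> t" using t by simp
    show "continuous_on {0..t} \<Psi>"
      using D\<Psi> t by (intro continuous_on_subset[OF DERIV_continuous_on[of "{0..T}"]]) auto
    fix s assume s: "0 < s" "s < t"
    then have sT: "s \<in> {0..T}" and "s \<in> interior {0..T}" using t by auto
    then have deriv: "(\<Psi> has_real_derivative (exp (- \<alpha> * s) * (f s - \<alpha> * \<Phi> s) - K s)) (at s)"
      using D\<Psi>[OF sT] at_within_interior[of s "{0..T}"] by simp
    have "exp (- \<alpha> * s) * (f s - \<alpha> * \<Phi> s) \<le> exp (- \<alpha> * s) * K s"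
      using le'[OF sT] by (intro mult_left_mono) auto
    also have "exp (- \<alpha> * s) * K s \<le> K s"
      using \<alpha> s K(2)[OF sT] by (intro mult_left_le_one_le) auto
    finally show "\<exists>y. DERIV \<Psi> s :> y \<and> y \<le> 0"
      using deriv by (intro exI conjI) (assumption, linarith)
  qed
  then have "exp (- \<alpha> * t) * \<Phi> t \<le> \<kappa> t" by (simp add: \<Psi>_def \<Phi>_def \<kappa>_def)
  then have "exp (\<alpha> * t) * (exp (- \<alpha> * t) * \<Phi> t) \<le> exp (\<alpha> * t) * \<kappa> t"
    by (rule mult_left_mono) simp
  then have "\<Phi> t \<le> exp (\<alpha> * t) * \<kappa> t" by (simp add: exp_minus field_simps)
  also have "\<dots> \<le> exp (\<alpha> * T) * \<kappa> T"
  proof (rule mult_mono)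
    show "exp (\<alpha> * t) \<le> exp (\<alpha> * T)" using t \<alpha> by (auto intro: mult_left_mono)
    show "\<kappa> t \<le> \<kappa> T" "0 \<le> \<kappa> t" unfolding \<kappa>_def
      using t K continuous_on_subset[OF K(1) sub[OF t]]
      by (auto intro!: integral_subset_le Henstock_Kurzweil_Integration.integral_nonneg integrable_continuous_real)
  qed simp
  finally have "\<alpha> * \<Phi> t \<le> \<alpha> * (exp (\<alpha> * T) * \<kappa> T)" using \<alpha> by (intro mult_left_mono)
  then show ?thesis
    using le'[OF t] Leb_integral_continuous[OF K(1)] by (simp add: \<kappa>_def mult.assoc)
qed

lemma AE_Leb_neq: "AE s in Leb T. s \<noteq> r"
proof -
  have "AE s in lborel. s \<noteq> r" by (rule AE_lborel_singleton)
  then show ?thesis by (subst AE_restrict_space_iff) auto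
qed

text \<open>
  The product of two indefinite integrals is an integral over a square. Cutting the square along the
  diagonal and applying Fubini's theorem to each triangle gives the two terms of the rule. No
  differentiability is involved, as the densities are only integrable.
\<close>

lemma product_rule:
  fixes f g :: "real \<Rightarrow> real"
  assumes f: "integrable (Leb T) f" and g: "integrable (Leb T) g" and T: "0 \<le> T"
    and F: "\<And>t. t \<in> {0..T} \<Longrightarrow> F t = F0 + (LINT s|(Leb t). f s)"
    and G: "\<And>t. t \<in> {0..T} \<Longrightarrow> G t = G0 + (LINT s|(Leb t). g s)"
  shows "F T * G T = F0 * G0 + (LINT s|(Leb T). f s * G s + F s * g s)"
    and "integrable (Leb T) (\<lambda>s. f s * G s)" and "integrable (Leb T) (\<lambda>s. F s * g s)"
proof -
  interpret L: finite_measure "Leb T" by (rule finite_measure_Leb)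
  interpret P: pair_sigma_finite "Leb T" "Leb T" ..
  have [measurable]: "f \<in> borel_measurable (Leb T)" "g \<in> borel_measurable (Leb T)" using f g by auto
  have [measurable]: "snd \<in> borel_measurable (Leb T \<Otimes>\<^sub>M Leb T)"
    by (rule measurable_compose[OF measurable_snd measurable_Leb_ident])
  let ?h = "\<lambda>p. f (fst p) * g (snd p)"
  have h: "integrable (Leb T \<Otimes>\<^sub>M Leb T) ?h"
    by (rule integrable_pair_mult[OF P.pair_sigma_finite_axioms f g])
  have h1: "integrable (Leb T \<Otimes>\<^sub>M Leb T) (\<lambda>p. (if snd p \<le> fst p then 1 else 0) * ?h p)"
    and h2: "integrable (Leb T \<Otimes>\<^sub>M Leb T) (\<lambda>p. (if fst p < snd p then 1 else 0) * ?h p)"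
    by (rule integrable_bounded_mult[where K=1, OF _ _ h]; simp)+
  have e1: "f s * (LINT r|(Leb s). g r) = (LINT r|(Leb T). (if r \<le> s then 1 else 0) * (f s * g r))" if "s \<in> {0..T}" for s
  proof -
    have "f s * (LINT r|(Leb s). g r) = (LINT r|(Leb T). f s * (indicator {..s} r * g r))"
      unfolding Leb_integral_initial[OF that] by simp
    also have "\<dots> = (LINT r|(Leb T). (if r \<le> s then 1 else 0) * (f s * g r))"
      by (intro Bochner_Integration.integral_cong) (auto split: split_indicator)
    finally show ?thesis .
  qed
  have e2: "(LINT s|(Leb r). f s) * g r = (LINT s|(Leb T). (if s < r then 1 else 0) * (f s * g r))" if "r \<in> {0..T}" for r
  proof -
    have "(LINT s|(Leb r). f s) * g r = (LINT s|(Leb T). (indicator {..r} s * f s) * g r)"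
      unfolding Leb_integral_initial[OF that] by simp
    also have "\<dots> = (LINT s|(Leb T). (if s < r then 1 else 0) * (f s * g r))"
    proof (rule integral_cong_AE)
      show "AE s in Leb T. indicator {..r} s * f s * g r = (if s < r then 1 else 0) * (f s * g r)"
        using AE_Leb_neq[of r T] by eventually_elim (auto split: split_indicator)
    qed measurable
    finally show ?thesis .
  qed
  have i1: "integrable (Leb T) (\<lambda>s. f s * (LINT r|(Leb s). g r))"
    using P.integrable_fst'[OF h1]
    by (rule Bochner_Integration.integrable_cong[THEN iffD2, rotated -1]) (simp_all add: e1)
  have h2': "integrable (Leb T \<Otimes>\<^sub>M Leb T) (\<lambda>(s, r). (if s < r then 1 else 0) * (f s * g r))"
    using h2 by (simp add: case_prod_beta')
  have i2: "integrable (Leb T) (\<lambda>r. (LINT s|(Leb r). f s) * g r)"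
    using P.integrable_snd[OF h2']
    by (rule Bochner_Integration.integrable_cong[THEN iffD2, rotated -1]) (simp_all add: e2)
  have "(LINT s|(Leb T). f s) * (LINT s|(Leb T). g s) = (LINT p|(Leb T \<Otimes>\<^sub>M Leb T). ?h p)"
    by (rule integral_pair_mult[OF P.pair_sigma_finite_axioms f g, symmetric])
  also have "\<dots> = (LINT p|(Leb T \<Otimes>\<^sub>M Leb T). (if snd p \<le> fst p then 1 else 0) * ?h p + (if fst p < snd p then 1 else 0) * ?h p)"
    by (intro Bochner_Integration.integral_cong) auto
  also have "\<dots> = (LINT p|(Leb T \<Otimes>\<^sub>M Leb T). (if snd p \<le> fst p then 1 else 0) * ?h p)
      + (LINT p|(Leb T \<Otimes>\<^sub>M Leb T). (if fst p < snd p then 1 else 0) * ?h p)"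
    by (rule Bochner_Integration.integral_add[OF h1 h2])
  also have "(LINT p|(Leb T \<Otimes>\<^sub>M Leb T). (if snd p \<le> fst p then 1 else 0) * ?h p)
      = (LINT s|(Leb T). f s * (LINT r|(Leb s). g r))"
    unfolding P.integral_fst'[OF h1, symmetric] by (intro Bochner_Integration.integral_cong) (simp_all add: e1)
  also have "(LINT p|(Leb T \<Otimes>\<^sub>M Leb T). (if fst p < snd p then 1 else 0) * ?h p)
      = (LINT r|(Leb T). (LINT s|(Leb r). f s) * g r)"
  proof -
    have "(LINT p|(Leb T \<Otimes>\<^sub>M Leb T). (if fst p < snd p then 1 else 0) * ?h p)
        = (LINT r|(Leb T). LINT s|(Leb T). (if s < r then 1 else 0) * (f s * g r))"
      using P.integral_snd[OF h2'] by (simp add: case_prod_beta')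
    also have "\<dots> = (LINT r|(Leb T). (LINT s|(Leb r). f s) * g r)"
      by (intro Bochner_Integration.integral_cong) (simp_all add: e2)
    finally show ?thesis .
  qed
  finally have prod: "(LINT s|(Leb T). f s) * (LINT s|(Leb T). g s) =
    (LINT s|(Leb T). f s * (LINT r|(Leb s). g r)) + (LINT r|(Leb T). (LINT s|(Leb r). f s) * g r)" .
  have eG: "f s * G s = G0 * f s + f s * (LINT r|(Leb s). g r)" if "s \<in> {0..T}" for s
    using G[OF that] by (simp add: algebra_simps)
  have eF: "F s * g s = F0 * g s + (LINT r|(Leb s). f r) * g s" if "s \<in> {0..T}" for s
    using F[OF that] by (simp add: algebra_simps)
  show iG: "integrable (Leb T) (\<lambda>s. f s * G s)"
    by (rule Bochner_Integration.integrable_cong[THEN iffD2, OF refl eG]) (use f i1 in auto)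
  show iF: "integrable (Leb T) (\<lambda>s. F s * g s)"
    by (rule Bochner_Integration.integrable_cong[THEN iffD2, OF refl eF]) (use g i2 in auto)
  have "(LINT s|(Leb T). f s * G s) = G0 * (LINT s|(Leb T). f s) + (LINT s|(Leb T). f s * (LINT r|(Leb s). g r))"
    using f i1 by (subst Bochner_Integration.integral_cong[OF refl eG]) auto
  moreover have "(LINT s|(Leb T). F s * g s) = F0 * (LINT s|(Leb T). g s) + (LINT s|(Leb T). (LINT r|(Leb s). f r) * g s)"
    using g i2 by (subst Bochner_Integration.integral_cong[OF refl eF]) auto
  ultimately have "(LINT s|(Leb T). f s * G s + F s * g s) = G0 * (LINT s|(Leb T). f s) + F0 * (LINT s|(Leb T). g s)
     + (LINT s|(Leb T). f s) * (LINT s|(Leb T). g s)"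
    unfolding Bochner_Integration.integral_add[OF iG iF] prod by simp
  moreover have "F T = F0 + (LINT s|(Leb T). f s)" "G T = G0 + (LINT s|(Leb T). g s)"
    using F G T by auto
  ultimately show "F T * G T = F0 * G0 + (LINT s|(Leb T). f s * G s + F s * g s)"
    by (simp add: algebra_simps)
qed

text \<open>
  A process with continuous paths is the limit of the processes that are sampled at the times
  \<open>\<lfloor>s n\<rfloor> / n\<close>, which are jointly measurable as they involve countably many random variables. The truncation to
  \<open>[0, T]\<close> keeps the sampled times inside the interval.
\<close>

lemma continuous_process_measurable:
  fixes X :: "real \<Rightarrow> 'w \<Rightarrow> real"
  assumes T: "0 \<le> T" and m: "\<And>t. t \<in> {0..T} \<Longrightarrow> X t \<in> borel_measurable M"
    and c: "\<And>\<omega>. \<omega> \<in> space M \<Longrightarrow> continuous_on {0..T} (\<lambda>t. X t \<omega>)"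
  shows "(\<lambda>p. X (fst p) (snd p)) \<in> borel_measurable (Leb T \<Otimes>\<^sub>M M)"
proof -
  define r :: "nat \<Rightarrow> int \<Rightarrow> real" where "r n k = max 0 (min T (of_int k / real (Suc n)))" for n k
  define k :: "nat \<Rightarrow> real \<Rightarrow> int" where "k n s = \<lfloor>s * real (Suc n)\<rfloor>" for n s
  have r: "r n j \<in> {0..T}" for n j using T by (auto simp: r_def)
  have "(\<lambda>p. X (r n (k n (fst p))) (snd p)) \<in> borel_measurable (Leb T \<Otimes>\<^sub>M M)" for n
  proof (rule measurable_compose_countable[where f="\<lambda>j p. X (r n j) (snd p)" and g="\<lambda>p. k n (fst p)"])
    show "(\<lambda>p. X (r n j) (snd p)) \<in> borel_measurable (Leb T \<Otimes>\<^sub>M M)" for j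
      by (rule measurable_compose[OF measurable_snd m[OF r]])
    show "(\<lambda>p. k n (fst p)) \<in> measurable (Leb T \<Otimes>\<^sub>M M) (count_space UNIV)"
      unfolding k_def by measurable
  qed
  then show ?thesis
  proof (rule borel_measurable_LIMSEQ_real[rotated])
    fix p assume "p \<in> space (Leb T \<Otimes>\<^sub>M M)"
    then have s: "fst p \<in> {0..T}" and w: "snd p \<in> space M" by (auto simp: space_pair_measure)
    have "(\<lambda>n. r n (k n (fst p))) \<longlonglongrightarrow> fst p"
    proof (rule tendsto_sandwich[where f="\<lambda>n. fst p - 1 / real (Suc n)" and h="\<lambda>_. fst p"])
      have b: "fst p - 1 / real (Suc n) \<le> of_int (k n (fst p)) / real (Suc n)"
        "of_int (k n (fst p)) / real (Suc n) \<le> fst p" for n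
      proof -
        have N: "0 < real (Suc n)" by simp
        have k: "fst p * real (Suc n) - 1 \<le> of_int (k n (fst p))" "of_int (k n (fst p)) \<le> fst p * real (Suc n)"
          unfolding k_def by linarith+
        have "fst p - 1 / real (Suc n) = (fst p * real (Suc n) - 1) / real (Suc n)"
          using N by (simp only: diff_divide_distrib) simp
        also have "\<dots> \<le> of_int (k n (fst p)) / real (Suc n)"
          using k(1) N by (intro divide_right_mono) auto
        finally show "fst p - 1 / real (Suc n) \<le> of_int (k n (fst p)) / real (Suc n)" .
        show "of_int (k n (fst p)) / real (Suc n) \<le> fst p"
          using k(2) N by (simp only: pos_divide_le_eq)
      qed
      show "\<forall>\<^sub>F n in sequentially. fst p - 1 / real (Suc n) \<le> r n (k n (fst p))"
      proof (intro always_eventually allI)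
        fix n
        have "0 \<le> 1 / real (Suc n)" by simp
        then have "fst p - 1 / real (Suc n) \<le> T" using s by (simp only: atLeastAtMost_iff) linarith
        then have "fst p - 1 / real (Suc n) \<le> min T (of_int (k n (fst p)) / real (Suc n))"
          using b(1)[of n] by (simp only: min.bounded_iff)
        then show "fst p - 1 / real (Suc n) \<le> r n (k n (fst p))"
          unfolding r_def by (rule order_trans[OF _ max.cobounded2])
      qed
      show "\<forall>\<^sub>F n in sequentially. r n (k n (fst p)) \<le> fst p"
        unfolding r_def using s
        by (intro always_eventually allI max.boundedI order_trans[OF min.cobounded2 b(2)]) auto
      have "(\<lambda>n. fst p - 1 / real (Suc n)) \<longlonglongrightarrow> fst p - 0"
        by (intro tendsto_intros LIMSEQ_Suc[OF lim_1_over_n])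
      then show "(\<lambda>n. fst p - 1 / real (Suc n)) \<longlonglongrightarrow> fst p" by simp
    qed simp
    then show "(\<lambda>n. X (r n (k n (fst p))) (snd p)) \<longlonglongrightarrow> X (fst p) (snd p)"
      by (intro continuous_on_tendsto_compose[OF c[OF w]]) (use s r in auto)
  qed
qed

lemma
  fixes h :: "real \<Rightarrow> 'w \<Rightarrow> real"
  assumes M: "finite_measure M" and h: "integrable (Leb T \<Otimes>\<^sub>M M) (\<lambda>p. h (fst p) (snd p))"
  shows time_fubini_AE: "AE s in Leb T. integrable M (h s)"
    and time_fubini_integrable: "integrable (Leb T) (\<lambda>s. LINT \<omega>|M. h s \<omega>)"
    and time_fubini_path: "AE \<omega> in M. integrable (Leb T) (\<lambda>s. h s \<omega>)"
    and time_fubini_integrable': "t \<in> {0..T} \<Longrightarrow> integrable M (\<lambda>\<omega>. LINT s|(Leb t). h s \<omega>)"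
    and time_fubini: "t \<in> {0..T} \<Longrightarrow>
      (LINT \<omega>|M. LINT s|(Leb t). h s \<omega>) = (LINT s|(Leb t). LINT \<omega>|M. h s \<omega>)"
proof -
  interpret M: finite_measure M by fact
  interpret L: finite_measure "Leb T" by (rule finite_measure_Leb)
  interpret P: pair_sigma_finite "Leb T" M ..
  have h': "integrable (Leb T \<Otimes>\<^sub>M M) (\<lambda>(s, \<omega>). h s \<omega>)" using h by (simp add: case_prod_beta')
  show "AE s in Leb T. integrable M (h s)" by (rule P.AE_integrable_fst[OF h'])
  show "integrable (Leb T) (\<lambda>s. LINT \<omega>|M. h s \<omega>)" by (rule P.integrable_fst[OF h'])
  show "AE \<omega> in M. integrable (Leb T) (\<lambda>s. h s \<omega>)" by (rule P.AE_integrable_snd[OF h'])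
  assume t: "t \<in> {0..T}"
  have "integrable (Leb T \<Otimes>\<^sub>M M) (\<lambda>p. indicator {..t} (fst p) * h (fst p) (snd p))"
    by (rule integrable_bounded_mult[OF _ _ h, where K=1]) (auto simp: indicator_def)
  then have i: "integrable (Leb T \<Otimes>\<^sub>M M) (\<lambda>(s, \<omega>). indicator {..t} s * h s \<omega>)"
    by (simp add: case_prod_beta')
  show "integrable M (\<lambda>\<omega>. LINT s|(Leb t). h s \<omega>)"
    unfolding Leb_integral_initial[OF t] by (rule P.integrable_snd[OF i])
  show "(LINT \<omega>|M. LINT s|(Leb t). h s \<omega>) = (LINT s|(Leb t). LINT \<omega>|M. h s \<omega>)"
    unfolding Leb_integral_initial[OF t] P.Fubini_integral[OF i] by simp
qed

text \<open>
  Cauchy-Schwarz in time: the squared integral of \<open>\<bar>h\<bar>\<close> over \<open>[0, T]\<close> is at most \<open>T\<close> times the integral of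
  \<open>h\<^sup>2\<close>.
\<close>

lemma square_integrable_time_integral:
  fixes h :: "real \<Rightarrow> 'w \<Rightarrow> real"
  assumes M: "finite_measure M" and h: "square_integrable (Leb T \<Otimes>\<^sub>M M) (\<lambda>p. h (fst p) (snd p))" and T: "0 \<le> T"
  shows "square_integrable M (\<lambda>\<omega>. LINT s|(Leb T). \<bar>h s \<omega>\<bar>)"
proof -
  interpret M: finite_measure M by fact
  interpret L: finite_measure "Leb T" by (rule finite_measure_Leb)
  interpret P: pair_sigma_finite "Leb T" M ..
  have h1: "integrable (Leb T \<Otimes>\<^sub>M M) (\<lambda>p. (h (fst p) (snd p))\<^sup>2)"
    and hm [measurable]: "(\<lambda>p. h (fst p) (snd p)) \<in> borel_measurable (Leb T \<Otimes>\<^sub>M M)"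
    using h by (auto simp: square_integrable_def)
  have pathm: "(\<lambda>s. h s \<omega>) \<in> borel_measurable (Leb T)" if "\<omega> \<in> space M" for \<omega>
    using measurable_compose[OF measurable_Pair2'[OF that] hm] by simp
  have T1: "(LINT s|(Leb T). 1\<^sup>2) = T" using T by (simp add: measure_restrict_space)
  have m: "(\<lambda>\<omega>. LINT s|(Leb T). \<bar>h s \<omega>\<bar>) \<in> borel_measurable M"
  proof (rule L.borel_measurable_lebesgue_integral)
    have "(\<lambda>p. \<bar>h (fst p) (snd p)\<bar>) \<in> borel_measurable (Leb T \<Otimes>\<^sub>M M)" by measurable
    from measurable_compose[OF measurable_pair_swap' this]
    show "(\<lambda>(\<omega>, s). \<bar>h s \<omega>\<bar>) \<in> borel_measurable (M \<Otimes>\<^sub>M Leb T)" by (simp add: case_prod_beta')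
  qed
  have "integrable M (\<lambda>\<omega>. (LINT s|(Leb T). \<bar>h s \<omega>\<bar>)\<^sup>2)"
  proof (rule Bochner_Integration.integrable_bound)
    show "integrable M (\<lambda>\<omega>. T * (LINT s|(Leb T). (h s \<omega>)\<^sup>2))"
      using time_fubini_integrable'[OF M h1, of T] T by simp
    show "(\<lambda>\<omega>. (LINT s|(Leb T). \<bar>h s \<omega>\<bar>)\<^sup>2) \<in> borel_measurable M" using m by measurable
    show "AE \<omega> in M. norm ((LINT s|(Leb T). \<bar>h s \<omega>\<bar>)\<^sup>2) \<le> norm (T * (LINT s|(Leb T). (h s \<omega>)\<^sup>2))"
      using time_fubini_path[OF M h1] AE_space
    proof eventually_elim
      fix \<omega> assume i: "integrable (Leb T) (\<lambda>s. (h s \<omega>)\<^sup>2)" and w: "\<omega> \<in> space M"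
      have sq: "square_integrable (Leb T) (\<lambda>s. h s \<omega>)" "square_integrable (Leb T) (\<lambda>s. 1)"
        using i pathm[OF w] by (auto simp: square_integrable_def)
      have "(LINT s|(Leb T). \<bar>h s \<omega>\<bar>) \<le> sqrt (LINT s|(Leb T). (h s \<omega>)\<^sup>2) * sqrt T"
        using integral_abs_mult_le[OF sq] unfolding T1 by simp
      then have "(LINT s|(Leb T). \<bar>h s \<omega>\<bar>)\<^sup>2 \<le> (sqrt (LINT s|(Leb T). (h s \<omega>)\<^sup>2) * sqrt T)\<^sup>2"
        by (intro power_mono) auto
      also have "\<dots> = T * (LINT s|(Leb T). (h s \<omega>)\<^sup>2)"
        using T by (simp add: power_mult_distrib)
      finally show "norm ((LINT s|(Leb T). \<bar>h s \<omega>\<bar>)\<^sup>2) \<le> norm (T * (LINT s|(Leb T). (h s \<omega>)\<^sup>2))"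
        by (simp add: order_trans[OF _ abs_ge_self])
    qed
  qed
  with m show ?thesis by (simp add: square_integrable_def)
qed

section \<open>Moments of a linear state equation\<close>

text \<open>
  The state equation with every pathwise property holding at every point of the sample space, so that
  \<open>X\<close> and \<open>I\<close> are jointly measurable. Of the Ito integral only what the moments see is kept: mean,
  variance, and orthogonality of its increments to the state and the control at earlier times.
\<close>

locale linear_state = prob_space M for M :: "'w measure" +
  fixes T x :: real and A B \<sigma> :: "real \<Rightarrow> real" and u X I :: "real \<Rightarrow> 'w \<Rightarrow> real"
  assumes T: "0 < T"
    and A: "continuous_on {0..T} A" and B: "continuous_on {0..T} B" and \<sigma>: "continuous_on {0..T} \<sigma>"
    and u_L2: "square_integrable (Leb T \<Otimes>\<^sub>M M) (\<lambda>p. u (fst p) (snd p))"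
    and u_path: "\<omega> \<in> space M \<Longrightarrow> square_integrable (Leb T) (\<lambda>s. u s \<omega>)"
    and X_meas: "t \<in> {0..T} \<Longrightarrow> X t \<in> borel_measurable M"
    and X_cont: "\<omega> \<in> space M \<Longrightarrow> continuous_on {0..T} (\<lambda>t. X t \<omega>)"
    and I_L2: "t \<in> {0..T} \<Longrightarrow> square_integrable M (I t)"
    and I_cont: "\<omega> \<in> space M \<Longrightarrow> continuous_on {0..T} (\<lambda>t. I t \<omega>)"
    and I_mean: "t \<in> {0..T} \<Longrightarrow> expectation (I t) = 0"
    and I_isometry: "t \<in> {0..T} \<Longrightarrow> expectation (\<lambda>\<omega>. (I t \<omega>)\<^sup>2) = (LINT s|(Leb t). (\<sigma> s)\<^sup>2)"
    and I_martingale: "0 \<le> s \<Longrightarrow> s \<le> t \<Longrightarrow> t \<le> T \<Longrightarrow> square_integrable M (\<lambda>\<omega>. a * X s \<omega> + b * u s \<omega>) \<Longrightarrow>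
      expectation (\<lambda>\<omega>. I t \<omega> * (a * X s \<omega> + b * u s \<omega>)) = expectation (\<lambda>\<omega>. I s \<omega> * (a * X s \<omega> + b * u s \<omega>))"
    and state_eq: "\<omega> \<in> space M \<Longrightarrow> t \<in> {0..T} \<Longrightarrow>
      X t \<omega> = x + (LINT s|(Leb t). A s * X s \<omega> + B s * u s \<omega>) + I t \<omega>"
begin

lemma T0: "0 \<le> T" using T by simp

lemma fin_M: "finite_measure M"
  by (rule finite_measureI) (simp add: emeasure_space_1)

sublocale L: finite_measure "Leb T" by (rule finite_measure_Leb)
sublocale P: pair_sigma_finite "Leb T" M ..
sublocale PF: finite_measure "Leb T \<Otimes>\<^sub>M M" by (rule finite_measure_pair_measure) unfold_locales

definition drift :: "real \<Rightarrow> 'w \<Rightarrow> real" where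
  "drift s \<omega> = A s * X s \<omega> + B s * u s \<omega>"

lemma coeff_bound:
  assumes "continuous_on {0..T} f"
  obtains K where "0 \<le> K" "\<And>s. s \<in> {0..T} \<Longrightarrow> \<bar>f s :: real\<bar> \<le> K"
proof -
  obtain K where "\<forall>s\<in>{0..T}. norm (f s) \<le> K"
    using compact_imp_bounded[OF compact_continuous_image[OF assms compact_Icc]]
    unfolding bounded_iff by blast
  then show thesis
    by (intro that[of "max 0 K"]) (auto simp: le_max_iff_disj)
qed

lemma coeff_meas: "continuous_on {0..T} f \<Longrightarrow> (\<lambda>p. f (fst p)) \<in> borel_measurable (Leb T \<Otimes>\<^sub>M M)"
  for f :: "real \<Rightarrow> real"
  by (rule measurable_compose[OF measurable_fst measurable_Leb_continuous])

lemma square_integrable_fst_cmult: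
  assumes f: "continuous_on {0..T} f" and g: "square_integrable (Leb T \<Otimes>\<^sub>M M) (\<lambda>p. g (fst p) (snd p))"
  shows "square_integrable (Leb T \<Otimes>\<^sub>M M) (\<lambda>p. f (fst p) * g (fst p) (snd p))"
proof -
  obtain K where "\<And>s. s \<in> {0..T} \<Longrightarrow> \<bar>f s\<bar> \<le> K" using coeff_bound[OF f] by metis
  then show ?thesis
    by (intro square_integrable_bounded_mult[OF coeff_meas[OF f] _ g, of K]) (auto simp: space_pair_measure)
qed

lemma square_integrable_snd:
  assumes g: "square_integrable M g"
  shows "square_integrable (Leb T \<Otimes>\<^sub>M M) (\<lambda>p. g (snd p))"
  using integrable_pair_mult[OF P.pair_sigma_finite_axioms, of "\<lambda>_. 1" "\<lambda>\<omega>. (g \<omega>)\<^sup>2"] g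
    measurable_compose[OF measurable_snd, of g M borel "Leb T"]
  by (auto simp: square_integrable_def)

lemma I_joint_L2: "square_integrable (Leb T \<Otimes>\<^sub>M M) (\<lambda>p. I (fst p) (snd p))"
proof -
  have m [measurable]: "(\<lambda>p. I (fst p) (snd p)) \<in> borel_measurable (Leb T \<Otimes>\<^sub>M M)"
    by (rule continuous_process_measurable[OF T0])
      (use I_L2 I_cont in \<open>auto simp: square_integrable_def\<close>)
  have s2: "continuous_on {0..T} (\<lambda>s. (\<sigma> s)\<^sup>2)" by (intro continuous_intros \<sigma>)
  have "integrable (Leb T \<Otimes>\<^sub>M M) (\<lambda>p. (I (fst p) (snd p))\<^sup>2)"
  proof (rule P.Fubini_integrable)
    have "continuous_on {0..T} (\<lambda>t. integral {0..t} (\<lambda>s. (\<sigma> s)\<^sup>2))"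
      by (rule indefinite_integral_continuous_1) (rule integrable_continuous_real[OF s2])
    from integrable_Leb_continuous[OF this]
    show "integrable (Leb T) (\<lambda>s. LINT y|M. norm ((I (fst (s, y)) (snd (s, y)))\<^sup>2))"
      by (rule Bochner_Integration.integrable_cong[THEN iffD2, rotated -1])
        (use Leb_integral_continuous[OF continuous_on_subset[OF s2]] in \<open>auto simp: I_isometry\<close>)
    show "AE s in Leb T. integrable M (\<lambda>y. (I (fst (s, y)) (snd (s, y)))\<^sup>2)"
      using I_L2 by (intro AE_I2) (auto simp: square_integrable_def)
  qed measurable
  with m show ?thesis by (simp add: square_integrable_def)
qed

lemma X_joint_meas [measurable]: "(\<lambda>p. X (fst p) (snd p)) \<in> borel_measurable (Leb T \<Otimes>\<^sub>M M)"
  by (rule continuous_process_measurable[OF T0 X_meas X_cont])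

lemma drift_path:
  assumes w: "\<omega> \<in> space M"
  shows "integrable (Leb T) (\<lambda>s. drift s \<omega>)"
proof -
  obtain \<beta> where \<beta>: "\<And>s. s \<in> {0..T} \<Longrightarrow> \<bar>B s\<bar> \<le> \<beta>" using coeff_bound[OF B] by metis
  have "integrable (Leb T) (\<lambda>s. A s * X s \<omega>)"
    by (intro integrable_Leb_continuous continuous_intros A X_cont w)
  moreover have "integrable (Leb T) (\<lambda>s. B s * u s \<omega>)"
    by (rule integrable_bounded_mult[OF measurable_Leb_continuous[OF B] _ L.square_integrable_integrable[OF u_path[OF w]], of \<beta>])
      (use \<beta> in auto)
  ultimately show ?thesis by (simp add: drift_def)
qed

text \<open>
  Gronwall's inequality, with \<open>K\<close> the sum of \<open>\<bar>x\<bar>\<close>, a multiple of the time integral of \<open>\<bar>u\<bar>\<close>, and \<open>\<bar>I\<bar>\<close>,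
  bounds each path by square-integrable quantities.
\<close>

lemma X_bound:
  obtains R where "square_integrable M R"
    "\<And>t \<omega>. t \<in> {0..T} \<Longrightarrow> \<omega> \<in> space M \<Longrightarrow> \<bar>X t \<omega>\<bar> \<le> R \<omega> + \<bar>I t \<omega>\<bar>"
proof -
  obtain \<alpha> where \<alpha>: "0 \<le> \<alpha>" "\<And>s. s \<in> {0..T} \<Longrightarrow> \<bar>A s\<bar> \<le> \<alpha>" using coeff_bound[OF A] by metis
  obtain \<beta> where \<beta>: "0 \<le> \<beta>" "\<And>s. s \<in> {0..T} \<Longrightarrow> \<bar>B s\<bar> \<le> \<beta>" using coeff_bound[OF B] by metis
  define U where "U \<omega> = (LINT s|(Leb T). \<bar>u s \<omega>\<bar>)" for \<omega>
  define V where "V \<omega> = (LINT s|(Leb T). \<bar>I s \<omega>\<bar>)" for \<omega>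
  define c where "c = \<alpha> * exp (\<alpha> * T)"
  define R where "R \<omega> = (1 + c * T) * (\<bar>x\<bar> + \<beta> * U \<omega>) + c * V \<omega>" for \<omega>
  have "square_integrable M U" "square_integrable M V"
    unfolding U_def V_def by (intro square_integrable_time_integral[OF fin_M _ T0] u_L2 I_joint_L2)+
  moreover have "square_integrable M (\<lambda>_. \<bar>x\<bar>)" by (simp add: square_integrable_def)
  ultimately have R: "square_integrable M R"
    unfolding R_def by (intro square_integrable_add square_integrable_cmult)
  have "\<bar>X t \<omega>\<bar> \<le> R \<omega> + \<bar>I t \<omega>\<bar>" if t: "t \<in> {0..T}" and w: "\<omega> \<in> space M" for t \<omega>
  proof -
    have ui: "integrable (Leb T) (\<lambda>s. u s \<omega>)"
      using L.square_integrable_integrable[OF u_path[OF w]] .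
    have Xi: "integrable (Leb T) (\<lambda>s. X s \<omega>)" by (rule integrable_Leb_continuous[OF X_cont[OF w]])
    define K where "K s = \<bar>x\<bar> + \<beta> * U \<omega> + \<bar>I s \<omega>\<bar>" for s
    have U0: "0 \<le> U \<omega>" by (simp add: U_def)
    have Kc: "continuous_on {0..T} K" unfolding K_def by (intro continuous_intros I_cont w)
    have K0: "0 \<le> K s" for s using \<beta>(1) U0 by (simp add: K_def)
    have le: "\<bar>X r \<omega>\<bar> \<le> K r + \<alpha> * (LINT s|(Leb r). \<bar>X s \<omega>\<bar>)" if r: "r \<in> {0..T}" for r
    proof -
      note ui' = integrable_Leb_initial[OF r integrable_abs[OF ui]] and Xi' = integrable_Leb_initial[OF r integrable_abs[OF Xi]]
      have "\<bar>LINT s|(Leb r). A s * X s \<omega> + B s * u s \<omega>\<bar> \<le> (LINT s|(Leb r). \<alpha> * \<bar>X s \<omega>\<bar> + \<beta> * \<bar>u s \<omega>\<bar>)"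
        unfolding real_norm_def[symmetric]
      proof (rule Bochner_Integration.integral_norm_bound_integral)
        show "integrable (Leb r) (\<lambda>s. A s * X s \<omega> + B s * u s \<omega>)"
          using integrable_Leb_initial[OF r drift_path[OF w]] by (simp add: drift_def)
        show "integrable (Leb r) (\<lambda>s. \<alpha> * norm (X s \<omega>) + \<beta> * norm (u s \<omega>))" using ui' Xi' by simp
        fix s assume "s \<in> space (Leb r)"
        then have s: "s \<in> {0..T}" using r by auto
        show "norm (A s * X s \<omega> + B s * u s \<omega>) \<le> \<alpha> * norm (X s \<omega>) + \<beta> * norm (u s \<omega>)"
          unfolding real_norm_def by (rule order_trans[OF abs_triangle_ineq]) (simp add: abs_mult add_mono mult_right_mono \<alpha>(2)[OF s] \<beta>(2)[OF s])
      qed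
      also have "\<dots> = \<alpha> * (LINT s|(Leb r). \<bar>X s \<omega>\<bar>) + \<beta> * (LINT s|(Leb r). \<bar>u s \<omega>\<bar>)"
        using ui' Xi' by simp
      also have "(LINT s|(Leb r). \<bar>u s \<omega>\<bar>) \<le> U \<omega>"
        unfolding U_def Leb_integral_initial[OF r]
        by (intro integral_mono integrable_Leb_indicator integrable_abs ui) (auto split: split_indicator)
      finally have "\<bar>LINT s|(Leb r). A s * X s \<omega> + B s * u s \<omega>\<bar> \<le> \<alpha> * (LINT s|(Leb r). \<bar>X s \<omega>\<bar>) + \<beta> * U \<omega>"
        using \<beta>(1) by (simp add: mult_left_mono)
      then show ?thesis unfolding state_eq[OF w r] K_def by linarith
    qed
    have "\<bar>X t \<omega>\<bar> \<le> K t + c * (LINT s|(Leb T). K s)"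
      unfolding c_def
      by (rule gronwall[OF _ Kc K0 \<alpha>(1) le t]) (intro continuous_intros X_cont w)
    also have "(LINT s|(Leb T). K s) = T * (\<bar>x\<bar> + \<beta> * U \<omega>) + V \<omega>"
      unfolding K_def V_def using T0 integrable_Leb_continuous[OF I_cont[OF w]]
      by (simp add: measure_restrict_space)
    finally show ?thesis by (simp add: K_def R_def algebra_simps)
  qed
  with R show thesis by (rule that)
qed

lemma X_L2: "t \<in> {0..T} \<Longrightarrow> square_integrable M (X t)"
  and X_joint_L2: "square_integrable (Leb T \<Otimes>\<^sub>M M) (\<lambda>p. X (fst p) (snd p))"
proof -
  obtain R where R: "square_integrable M R"
    and le: "\<And>t \<omega>. t \<in> {0..T} \<Longrightarrow> \<omega> \<in> space M \<Longrightarrow> \<bar>X t \<omega>\<bar> \<le> R \<omega> + \<bar>I t \<omega>\<bar>"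
    by (rule X_bound) (rule that)
  have sq: "(X t \<omega>)\<^sup>2 \<le> (R \<omega> + \<bar>I t \<omega>\<bar>)\<^sup>2" if "t \<in> {0..T}" "\<omega> \<in> space M" for t \<omega>
    using power_mono[OF le[OF that] abs_ge_zero, of 2] by simp
  show "square_integrable M (X t)" if t: "t \<in> {0..T}"
  proof -
    have "square_integrable M (\<lambda>\<omega>. R \<omega> + \<bar>I t \<omega>\<bar>)"
      by (intro square_integrable_add R square_integrable_abs I_L2 t)
    then show ?thesis
      unfolding square_integrable_def using X_meas[OF t] sq[OF t]
      by (auto elim!: Bochner_Integration.integrable_bound)
  qed
  have "square_integrable (Leb T \<Otimes>\<^sub>M M) (\<lambda>p. R (snd p) + \<bar>I (fst p) (snd p)\<bar>)"
    by (intro square_integrable_add square_integrable_snd R square_integrable_abs I_joint_L2)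
  then show "square_integrable (Leb T \<Otimes>\<^sub>M M) (\<lambda>p. X (fst p) (snd p))"
    unfolding square_integrable_def using X_joint_meas sq
    by (auto elim!: Bochner_Integration.integrable_bound simp: space_pair_measure)
qed

lemma drift_joint_L2: "square_integrable (Leb T \<Otimes>\<^sub>M M) (\<lambda>p. drift (fst p) (snd p))"
  unfolding drift_def by (intro square_integrable_add square_integrable_fst_cmult A B X_joint_L2 u_L2)

lemma AE_square_integrable_u: "AE s in Leb T. square_integrable M (u s)"
proof -
  have i: "integrable (Leb T \<Otimes>\<^sub>M M) (\<lambda>p. (u (fst p) (snd p))\<^sup>2)" and m: "(\<lambda>p. u (fst p) (snd p)) \<in> borel_measurable (Leb T \<Otimes>\<^sub>M M)"
    using u_L2 by (auto simp: square_integrable_def)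
  have um: "u s \<in> borel_measurable M" if "s \<in> space (Leb T)" for s
    using measurable_compose[OF measurable_Pair1'[OF that] m] by (simp add: eta_contract_eq)
  show ?thesis
    using time_fubini_AE[OF fin_M i] AE_space
    by eventually_elim (auto simp: square_integrable_def intro: um)
qed

lemma AE_square_integrable_drift: "AE s in Leb T. square_integrable M (drift s)"
  using AE_square_integrable_u AE_space
proof eventually_elim
  case (elim s)
  then show ?case
    unfolding drift_def[abs_def] by (intro square_integrable_add square_integrable_cmult X_L2) auto
qed

lemma mean_eq:
  assumes t: "t \<in> {0..T}"
  shows "expectation (X t) = x + (LINT s|(Leb t). A s * expectation (X s) + B s * expectation (u s))"
    and "integrable (Leb T) (\<lambda>s. A s * expectation (X s) + B s * expectation (u s))"
proof -
  note g1 = PF.square_integrable_integrable[OF drift_joint_L2]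
  have gE: "AE s in Leb T. expectation (drift s) = A s * expectation (X s) + B s * expectation (u s)"
    using AE_square_integrable_u AE_space
  proof eventually_elim
    case (elim s)
    then have "integrable M (u s)" "integrable M (X s)"
      using square_integrable_integrable X_L2 by auto
    then show ?case by (simp add: drift_def[abs_def])
  qed
  have m [measurable]: "(\<lambda>s. expectation (X s)) \<in> borel_measurable (Leb T)" "(\<lambda>s. expectation (u s)) \<in> borel_measurable (Leb T)"
    using time_fubini_integrable[OF fin_M PF.square_integrable_integrable[OF X_joint_L2]]
      time_fubini_integrable[OF fin_M PF.square_integrable_integrable[OF u_L2]] by auto
  have [measurable]: "A \<in> borel_measurable (Leb T)" "B \<in> borel_measurable (Leb T)"
    using A B by (auto intro: measurable_Leb_continuous)
  have gm: "(\<lambda>s. expectation (drift s)) \<in> borel_measurable (Leb T)"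
    using time_fubini_integrable[OF fin_M g1] by auto
  show "integrable (Leb T) (\<lambda>s. A s * expectation (X s) + B s * expectation (u s))"
    by (rule integrable_cong_AE_imp[OF time_fubini_integrable[OF fin_M g1]]) (measurable, use gE in \<open>auto elim: eventually_mono\<close>)
  have "expectation (X t) = expectation (\<lambda>\<omega>. x + (LINT s|(Leb t). drift s \<omega>) + I t \<omega>)"
    by (intro Bochner_Integration.integral_cong) (auto simp: state_eq[OF _ t] drift_def)
  also have "\<dots> = x + expectation (\<lambda>\<omega>. LINT s|(Leb t). drift s \<omega>)"
    using time_fubini_integrable'[OF fin_M g1 t] square_integrable_integrable[OF I_L2[OF t]] I_mean[OF t]
    by (simp add: prob_space)
  also have "\<dots> = x + (LINT s|(Leb t). expectation (drift s))"
    by (simp add: time_fubini[OF fin_M g1 t])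
  also have "(LINT s|(Leb t). expectation (drift s)) = (LINT s|(Leb t). A s * expectation (X s) + B s * expectation (u s))"
    by (rule Leb_integral_cong_AE[OF gm _ t]) (measurable, use gE in \<open>auto elim: eventually_mono\<close>)
  finally show "expectation (X t) = x + (LINT s|(Leb t). A s * expectation (X s) + B s * expectation (u s))" .
qed

end

context linear_state
begin

text \<open>
  The expectation of Ito's formula for \<open>X\<^sup>2\<close>, derived without it. Write \<open>X = Y + I\<close>, where \<open>Y\<close> is an indefinite
  integral of the drift. The ordinary product rule on each path gives the mean of \<open>Y\<^sup>2\<close>, and the isometry that of \<open>I\<^sup>2\<close>.
  In the mean of \<open>Y t * I t\<close>, after Fubini's theorem, the martingale property replaces
  \<open>I t\<close> by \<open>I s\<close> against the drift at time \<open>s\<close>. The two terms with the drift add up to the drift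
  against \<open>X s\<close>.
\<close>

lemma second_moment_eq:
  assumes t: "t \<in> {0..T}"
  shows "expectation (\<lambda>\<omega>. (X t \<omega>)\<^sup>2) = x\<^sup>2 + (LINT s|(Leb t).
      2 * (A s * expectation (\<lambda>\<omega>. (X s \<omega>)\<^sup>2) + B s * expectation (\<lambda>\<omega>. X s \<omega> * u s \<omega>)) + (\<sigma> s)\<^sup>2)"
    and "integrable (Leb T) (\<lambda>s. 2 * (A s * expectation (\<lambda>\<omega>. (X s \<omega>)\<^sup>2) + B s * expectation (\<lambda>\<omega>. X s \<omega> * u s \<omega>)) + (\<sigma> s)\<^sup>2)"
proof -
  define Y where "Y s \<omega> = X s \<omega> - I s \<omega>" for s \<omega>
  have Y_L2: "square_integrable M (Y s)" if "s \<in> {0..T}" for s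
    unfolding Y_def[abs_def] by (intro square_integrable_diff X_L2 I_L2 that)
  have Y_joint: "square_integrable (Leb T \<Otimes>\<^sub>M M) (\<lambda>p. Y (fst p) (snd p))"
    unfolding Y_def by (intro square_integrable_diff X_joint_L2 I_joint_L2)
  have Y_eq: "Y s \<omega> = x + (LINT r|(Leb s). drift r \<omega>)" if "s \<in> {0..T}" "\<omega> \<in> space M" for s \<omega>
    using state_eq[OF that(2,1)] by (simp add: Y_def drift_def)
  have sub: "s \<in> {0..T}" if "s \<in> {0..t}" for s using that t by auto
  have hY: "integrable (Leb T \<Otimes>\<^sub>M M) (\<lambda>p. 2 * (Y (fst p) (snd p) * drift (fst p) (snd p)))"
    using square_integrable_mult[OF Y_joint drift_joint_L2] by simp
  have hIt: "integrable (Leb T \<Otimes>\<^sub>M M) (\<lambda>p. I t (snd p) * drift (fst p) (snd p))"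
    by (rule square_integrable_mult[OF square_integrable_snd[OF I_L2[OF t]] drift_joint_L2])
  have hI: "integrable (Leb T \<Otimes>\<^sub>M M) (\<lambda>p. I (fst p) (snd p) * drift (fst p) (snd p))"
    by (rule square_integrable_mult[OF I_joint_L2 drift_joint_L2])
  have hX: "integrable (Leb T \<Otimes>\<^sub>M M) (\<lambda>p. (X (fst p) (snd p))\<^sup>2)"
    using X_joint_L2 by (simp add: square_integrable_def)
  have hXu: "integrable (Leb T \<Otimes>\<^sub>M M) (\<lambda>p. X (fst p) (snd p) * u (fst p) (snd p))"
    by (rule square_integrable_mult[OF X_joint_L2 u_L2])
  note mY = borel_measurable_integrable[OF time_fubini_integrable[OF fin_M hY]]
    and mIt = borel_measurable_integrable[OF time_fubini_integrable[OF fin_M hIt]]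
    and mI = borel_measurable_integrable[OF time_fubini_integrable[OF fin_M hI]]
    and mX = borel_measurable_integrable[OF time_fubini_integrable[OF fin_M hX]]
    and mXu = borel_measurable_integrable[OF time_fubini_integrable[OF fin_M hXu]]
  note [measurable] = mY mIt mI mX mXu
  have [measurable]: "A \<in> borel_measurable (Leb T)" "B \<in> borel_measurable (Leb T)" "\<sigma> \<in> borel_measurable (Leb T)"
    using A B \<sigma> by (auto intro: measurable_Leb_continuous)
  have s2: "integrable (Leb T) (\<lambda>s. (\<sigma> s)\<^sup>2)"
    by (intro integrable_Leb_continuous continuous_intros \<sigma>)
  have iY: "integrable (Leb T) (\<lambda>s. expectation (\<lambda>\<omega>. 2 * (Y s \<omega> * drift s \<omega>)))"
    by (rule time_fubini_integrable[OF fin_M hY])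
  have iI: "integrable (Leb T) (\<lambda>s. expectation (\<lambda>\<omega>. I s \<omega> * drift s \<omega>))"
    by (rule time_fubini_integrable[OF fin_M hI])
  have AEeq: "AE s in Leb T. expectation (\<lambda>\<omega>. 2 * (Y s \<omega> * drift s \<omega>)) + 2 * expectation (\<lambda>\<omega>. I s \<omega> * drift s \<omega>) + (\<sigma> s)\<^sup>2
      = 2 * (A s * expectation (\<lambda>\<omega>. (X s \<omega>)\<^sup>2) + B s * expectation (\<lambda>\<omega>. X s \<omega> * u s \<omega>)) + (\<sigma> s)\<^sup>2"
    using AE_square_integrable_drift AE_square_integrable_u AE_space
  proof eventually_elim
    case (elim s)
    then have s: "s \<in> {0..T}" by simp
    have "expectation (\<lambda>\<omega>. 2 * (Y s \<omega> * drift s \<omega>)) + 2 * expectation (\<lambda>\<omega>. I s \<omega> * drift s \<omega>)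
      = expectation (\<lambda>\<omega>. 2 * (Y s \<omega> * drift s \<omega>) + 2 * (I s \<omega> * drift s \<omega>))"
      using square_integrable_mult[OF Y_L2[OF s] elim(1)] square_integrable_mult[OF I_L2[OF s] elim(1)] by simp
    also have "\<dots> = expectation (\<lambda>\<omega>. 2 * (A s * (X s \<omega>)\<^sup>2 + B s * (X s \<omega> * u s \<omega>)))"
      by (intro Bochner_Integration.integral_cong) (auto simp: Y_def drift_def power2_eq_square algebra_simps)
    also have "\<dots> = 2 * (A s * expectation (\<lambda>\<omega>. (X s \<omega>)\<^sup>2) + B s * expectation (\<lambda>\<omega>. X s \<omega> * u s \<omega>))"
      using X_L2[OF s] square_integrable_mult[OF X_L2[OF s] elim(2)] by (simp add: square_integrable_def)
    finally show ?case by simp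
  qed
  show "integrable (Leb T) (\<lambda>s. 2 * (A s * expectation (\<lambda>\<omega>. (X s \<omega>)\<^sup>2) + B s * expectation (\<lambda>\<omega>. X s \<omega> * u s \<omega>)) + (\<sigma> s)\<^sup>2)"
    by (rule integrable_cong_AE_imp[OF Bochner_Integration.integrable_add[OF Bochner_Integration.integrable_add[OF iY integrable_mult_right[OF iI, of 2]] s2]])
      (measurable, use AEeq in \<open>auto elim: eventually_mono\<close>)
  have Y2: "(Y t \<omega>)\<^sup>2 = x\<^sup>2 + (LINT s|(Leb t). 2 * (Y s \<omega> * drift s \<omega>))" if w: "\<omega> \<in> space M" for \<omega>
  proof -
    have "Y t \<omega> * Y t \<omega> = x * x + (LINT s|(Leb t). drift s \<omega> * Y s \<omega> + Y s \<omega> * drift s \<omega>)"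
      by (rule product_rule(1)[where F="\<lambda>s. Y s \<omega>" and G="\<lambda>s. Y s \<omega>"])
        (use t Y_eq[OF sub w] integrable_Leb_initial[OF t drift_path[OF w]] in auto)
    then show ?thesis by (simp add: power2_eq_square mult.commute)
  qed
  have EY: "expectation (\<lambda>\<omega>. (Y t \<omega>)\<^sup>2) = x\<^sup>2 + (LINT s|(Leb t). expectation (\<lambda>\<omega>. 2 * (Y s \<omega> * drift s \<omega>)))"
  proof -
    have "expectation (\<lambda>\<omega>. (Y t \<omega>)\<^sup>2) = expectation (\<lambda>\<omega>. x\<^sup>2 + (LINT s|(Leb t). 2 * (Y s \<omega> * drift s \<omega>)))"
      by (intro Bochner_Integration.integral_cong Y2) auto
    also have "\<dots> = x\<^sup>2 + expectation (\<lambda>\<omega>. LINT s|(Leb t). 2 * (Y s \<omega> * drift s \<omega>))"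
      using time_fubini_integrable'[OF fin_M hY t] by (subst Bochner_Integration.integral_add) (simp_all add: prob_space)
    finally show ?thesis unfolding time_fubini[OF fin_M hY t] .
  qed
  have EI: "expectation (\<lambda>\<omega>. Y t \<omega> * I t \<omega>) = (LINT s|(Leb t). expectation (\<lambda>\<omega>. I s \<omega> * drift s \<omega>))"
  proof -
    have "expectation (\<lambda>\<omega>. Y t \<omega> * I t \<omega>) = expectation (\<lambda>\<omega>. x * I t \<omega> + (LINT s|(Leb t). I t \<omega> * drift s \<omega>))"
      by (intro Bochner_Integration.integral_cong) (auto simp: Y_eq[OF t] algebra_simps)
    also have "\<dots> = expectation (\<lambda>\<omega>. LINT s|(Leb t). I t \<omega> * drift s \<omega>)"
      using time_fubini_integrable'[OF fin_M hIt t] square_integrable_integrable[OF I_L2[OF t]] I_mean[OF t]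
      by (subst Bochner_Integration.integral_add) simp_all
    also have "\<dots> = (LINT s|(Leb t). expectation (\<lambda>\<omega>. I t \<omega> * drift s \<omega>))"
      by (rule time_fubini[OF fin_M hIt t])
    also have "\<dots> = (LINT s|(Leb t). expectation (\<lambda>\<omega>. I s \<omega> * drift s \<omega>))"
    proof (rule Leb_integral_cong_AE[OF mIt mI t])
      show "AE s in Leb T. s \<le> t \<longrightarrow> expectation (\<lambda>\<omega>. I t \<omega> * drift s \<omega>) = expectation (\<lambda>\<omega>. I s \<omega> * drift s \<omega>)"
        using AE_square_integrable_drift AE_space
      proof eventually_elim
        case (elim s)
        then show ?case
          using I_martingale[of s t "A s" "B s"] t unfolding drift_def[abs_def] by auto
      qed
    qed
    finally show ?thesis .
  qed
  have Yt: "integrable M (\<lambda>\<omega>. (Y t \<omega>)\<^sup>2)" "integrable M (\<lambda>\<omega>. Y t \<omega> * I t \<omega>)" "integrable M (\<lambda>\<omega>. (I t \<omega>)\<^sup>2)"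
    using Y_L2[OF t] I_L2[OF t] square_integrable_mult[OF Y_L2[OF t] I_L2[OF t]] by (auto simp: square_integrable_def)
  have "expectation (\<lambda>\<omega>. (X t \<omega>)\<^sup>2) = expectation (\<lambda>\<omega>. (Y t \<omega>)\<^sup>2 + 2 * (Y t \<omega> * I t \<omega>) + (I t \<omega>)\<^sup>2)"
    by (intro Bochner_Integration.integral_cong) (auto simp: Y_def power2_eq_square algebra_simps)
  also have "\<dots> = expectation (\<lambda>\<omega>. (Y t \<omega>)\<^sup>2) + 2 * expectation (\<lambda>\<omega>. Y t \<omega> * I t \<omega>) + expectation (\<lambda>\<omega>. (I t \<omega>)\<^sup>2)"
    using Yt by simp
  also have "\<dots> = x\<^sup>2 + ((LINT s|(Leb t). expectation (\<lambda>\<omega>. 2 * (Y s \<omega> * drift s \<omega>)))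
      + 2 * (LINT s|(Leb t). expectation (\<lambda>\<omega>. I s \<omega> * drift s \<omega>)) + (LINT s|(Leb t). (\<sigma> s)\<^sup>2))"
    unfolding EY EI I_isometry[OF t] by simp
  also have "\<dots> = x\<^sup>2 + (LINT s|(Leb t). expectation (\<lambda>\<omega>. 2 * (Y s \<omega> * drift s \<omega>)) + 2 * expectation (\<lambda>\<omega>. I s \<omega> * drift s \<omega>) + (\<sigma> s)\<^sup>2)"
    by (simp add: integrable_Leb_initial[OF t iY] integrable_Leb_initial[OF t iI] integrable_Leb_initial[OF t s2]
        del: Bochner_Integration.integral_mult_right_zero)
  also have "(LINT s|(Leb t). expectation (\<lambda>\<omega>. 2 * (Y s \<omega> * drift s \<omega>)) + 2 * expectation (\<lambda>\<omega>. I s \<omega> * drift s \<omega>) + (\<sigma> s)\<^sup>2)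
    = (LINT s|(Leb t). 2 * (A s * expectation (\<lambda>\<omega>. (X s \<omega>)\<^sup>2) + B s * expectation (\<lambda>\<omega>. X s \<omega> * u s \<omega>)) + (\<sigma> s)\<^sup>2)"
    by (rule Leb_integral_cong_AE[OF _ _ t]) (measurable, use AEeq in \<open>auto elim: eventually_mono\<close>)
  finally show "expectation (\<lambda>\<omega>. (X t \<omega>)\<^sup>2) = x\<^sup>2 + (LINT s|(Leb t).
      2 * (A s * expectation (\<lambda>\<omega>. (X s \<omega>)\<^sup>2) + B s * expectation (\<lambda>\<omega>. X s \<omega> * u s \<omega>)) + (\<sigma> s)\<^sup>2)" .
qed

end

lemma Leb_ftc:
  fixes f f' :: "real \<Rightarrow> real"
  assumes f: "continuous_on {0..T} f" and f': "continuous_on {0..T} f'"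
    and d: "\<And>s. s \<in> {0<..<T} \<Longrightarrow> (f has_real_derivative f' s) (at s)" and t: "t \<in> {0..T}"
  shows "f t = f 0 + (LINT s|(Leb t). f' s)"
proof -
  have sub: "{0..t} \<subseteq> {0..T}" using t by auto
  have "(f' has_integral f t - f 0) {0..t}"
    by (rule fundamental_theorem_of_calculus_interior)
      (use t d continuous_on_subset[OF f sub] in \<open>auto simp flip: has_real_derivative_iff_has_vector_derivative\<close>)
  then show ?thesis
    using Leb_integral_continuous[OF continuous_on_subset[OF f' sub]] by (simp add: integral_unique)
qed

context linear_state
begin

text \<open>
  The squared mean is at most the second moment.
\<close>

lemma mean_joint_L2: "square_integrable (Leb T \<Otimes>\<^sub>M M) (\<lambda>p. expectation (X (fst p)))"
proof -
  have hX: "integrable (Leb T \<Otimes>\<^sub>M M) (\<lambda>p. (X (fst p) (snd p))\<^sup>2)"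
    using X_joint_L2 by (simp add: square_integrable_def)
  have m: "(\<lambda>s. expectation (X s)) \<in> borel_measurable (Leb T)"
    using time_fubini_integrable[OF fin_M PF.square_integrable_integrable[OF X_joint_L2]] by auto
  have "integrable (Leb T) (\<lambda>s. (expectation (X s))\<^sup>2)"
  proof (rule Bochner_Integration.integrable_bound[OF time_fubini_integrable[OF fin_M hX]])
    show "AE s in Leb T. norm ((expectation (X s))\<^sup>2) \<le> norm (expectation (\<lambda>\<omega>. (X s \<omega>)\<^sup>2))"
    proof (rule AE_I2)
      fix s assume "s \<in> space (Leb T)"
      then have s: "square_integrable M (X s)" using X_L2 by simp
      have "(expectation (X s))\<^sup>2 \<le> expectation (\<lambda>\<omega>. (X s \<omega>)\<^sup>2)"
      proof -
        have "expectation (\<lambda>\<omega>. (X s \<omega> - expectation (X s))\<^sup>2) = expectation (\<lambda>\<omega>. (X s \<omega>)\<^sup>2) - (expectation (X s))\<^sup>2"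
          using square_integrable_integrable[OF s] s by (intro variance_eq) (auto simp: square_integrable_def)
        moreover have "0 \<le> expectation (\<lambda>\<omega>. (X s \<omega> - expectation (X s))\<^sup>2)" by (rule variance_positive)
        ultimately show ?thesis by linarith
      qed
      then show "norm ((expectation (X s))\<^sup>2) \<le> norm (expectation (\<lambda>\<omega>. (X s \<omega>)\<^sup>2))" by simp
    qed
  qed (use m in measurable)
  from integrable_pair_mult[OF P.pair_sigma_finite_axioms this, of "\<lambda>_. 1"] measurable_compose[OF measurable_fst m]
  show ?thesis by (simp add: square_integrable_def)
qed

text \<open>
  By the moment equations and the product rule, \<open>\<phi>1\<close> times the second moment, \<open>\<phi>2\<close> times the squared mean
  and \<open>\<phi>3\<close> are indefinite integrals on \<open>[0, T]\<close>. Expressing their terminal values through the initial ones and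
  inserting the Riccati equations leaves, besides the initial values, the integral of \<open>Q\<close> times the squared
  distance of the control from the candidate feedback.
\<close>

lemma completed_square_cost:
  fixes Q \<phi>1 \<phi>2 \<phi>3 :: "real \<Rightarrow> real"
  assumes Q: "continuous_on {0..T} Q" and Qpos: "\<And>s. s \<in> {0..T} \<Longrightarrow> 0 < Q s"
    and c: "continuous_on {0..T} \<phi>1" "continuous_on {0..T} \<phi>2" "continuous_on {0..T} \<phi>3"
    and d1: "\<And>s. s \<in> {0<..<T} \<Longrightarrow>
      (\<phi>1 has_real_derivative (B s)\<^sup>2 / Q s * (\<phi>1 s)\<^sup>2 - 2 * A s * \<phi>1 s) (at s)"
    and d2: "\<And>s. s \<in> {0<..<T} \<Longrightarrow>
      (\<phi>2 has_real_derivative (B s)\<^sup>2 / Q s * (\<phi>2 s)\<^sup>2 + 2 * (B s)\<^sup>2 / Q s * \<phi>1 s * \<phi>2 s - 2 * A s * \<phi>2 s) (at s)"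
    and d3: "\<And>s. s \<in> {0<..<T} \<Longrightarrow> (\<phi>3 has_real_derivative - ((\<sigma> s)\<^sup>2 * \<phi>1 s)) (at s)"
  shows "expectation (\<lambda>\<omega>. LINT s|(Leb T). Q s * (u s \<omega>)\<^sup>2)
      + \<phi>1 T * expectation (\<lambda>\<omega>. (X T \<omega>)\<^sup>2) + \<phi>2 T * (expectation (X T))\<^sup>2 + \<phi>3 T
    = \<phi>1 0 * x\<^sup>2 + \<phi>2 0 * x\<^sup>2 + \<phi>3 0
      + expectation (\<lambda>\<omega>. LINT s|(Leb T). Q s * (u s \<omega> + B s / Q s * (\<phi>1 s * X s \<omega> + \<phi>2 s * expectation (X s)))\<^sup>2)"
    (is "?cost = ?v0 + ?gap")
    and "AE s in Leb T. AE \<omega> in M. u s \<omega> = - (B s / Q s) * (\<phi>1 s * X s \<omega> + \<phi>2 s * expectation (X s))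
      \<Longrightarrow> expectation (\<lambda>\<omega>. LINT s|(Leb T). Q s * (u s \<omega> + B s / Q s * (\<phi>1 s * X s \<omega> + \<phi>2 s * expectation (X s)))\<^sup>2) = 0"
proof -
  define m where "m s = expectation (X s)" for s
  define p where "p s = expectation (\<lambda>\<omega>. (X s \<omega>)\<^sup>2)" for s
  define r where "r s = expectation (\<lambda>\<omega>. X s \<omega> * u s \<omega>)" for s
  define ub where "ub s = expectation (u s)" for s
  define w where "w s \<omega> = u s \<omega> + B s / Q s * (\<phi>1 s * X s \<omega> + \<phi>2 s * m s)" for s \<omega>
  define e1 where "e1 s = (B s)\<^sup>2 / Q s * (\<phi>1 s)\<^sup>2 - 2 * A s * \<phi>1 s" for s
  define e2 where "e2 s = (B s)\<^sup>2 / Q s * (\<phi>2 s)\<^sup>2 + 2 * (B s)\<^sup>2 / Q s * \<phi>1 s * \<phi>2 s - 2 * A s * \<phi>2 s" for s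
  define e3 where "e3 s = - ((\<sigma> s)\<^sup>2 * \<phi>1 s)" for s
  define gm where "gm s = A s * m s + B s * ub s" for s
  define gp where "gp s = 2 * (A s * p s + B s * r s) + (\<sigma> s)\<^sup>2" for s
  have Q0: "Q s \<noteq> 0" if "s \<in> {0..T}" for s using Qpos[OF that] by simp
  have cont: "continuous_on {0..T} e1" "continuous_on {0..T} e2" "continuous_on {0..T} e3"
    unfolding e1_def e2_def e3_def by (intro continuous_intros A B Q \<sigma> c; use Q0 in simp)+
  have TT: "T \<in> {0..T}" using T0 by simp
  have sub: "s \<in> {0..T}" if "s \<in> {0..t}" "t \<in> {0..T}" for s t using that by auto
  have f1: "\<phi>1 t = \<phi>1 0 + (LINT s|(Leb t). e1 s)" and f2: "\<phi>2 t = \<phi>2 0 + (LINT s|(Leb t). e2 s)"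
    and f3: "\<phi>3 t = \<phi>3 0 + (LINT s|(Leb t). e3 s)" if "t \<in> {0..T}" for t
    using Leb_ftc[OF c(1) cont(1) _ that] Leb_ftc[OF c(2) cont(2) _ that] Leb_ftc[OF c(3) cont(3) _ that] d1 d2 d3
    by (simp_all add: e1_def e2_def e3_def)
  have ie: "integrable (Leb T) e1" "integrable (Leb T) e2" "integrable (Leb T) e3"
    by (intro integrable_Leb_continuous cont)+
  have mt: "m t = x + (LINT s|(Leb t). gm s)" and pt: "p t = x\<^sup>2 + (LINT s|(Leb t). gp s)" if "t \<in> {0..T}" for t
    using mean_eq(1)[OF that] second_moment_eq(1)[OF that] by (simp_all add: m_def p_def gm_def gp_def ub_def r_def)
  have igm: "integrable (Leb T) gm" and igp: "integrable (Leb T) gp"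
    using mean_eq(2)[OF TT] second_moment_eq(2)[OF TT]
    by (simp_all add: m_def p_def gm_def[abs_def] gp_def[abs_def] ub_def r_def)
  have m2: "m t * m t = x * x + (LINT s|(Leb t). gm s * m s + m s * gm s)"
    and im2: "integrable (Leb t) (\<lambda>s. gm s * m s)" "integrable (Leb t) (\<lambda>s. m s * gm s)" if t: "t \<in> {0..T}" for t
    by (rule product_rule[where F=m and G=m and f=gm and g=gm and T=t];
        use t mt[OF sub[OF _ t]] integrable_Leb_initial[OF t igm] in simp)+
  have im2': "integrable (Leb T) (\<lambda>s. gm s * m s + m s * gm s)"
    using im2[OF TT] by simp
  have P1: "\<phi>1 T * p T = \<phi>1 0 * x\<^sup>2 + (LINT s|(Leb T). e1 s * p s + \<phi>1 s * gp s)"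
    and iP1: "integrable (Leb T) (\<lambda>s. e1 s * p s)" "integrable (Leb T) (\<lambda>s. \<phi>1 s * gp s)"
    by (rule product_rule[OF ie(1) igp T0 f1 pt]; assumption)+
  have P2: "\<phi>2 T * (m T * m T) = \<phi>2 0 * (x * x) + (LINT s|(Leb T). e2 s * (m s * m s) + \<phi>2 s * (gm s * m s + m s * gm s))"
    and iP2: "integrable (Leb T) (\<lambda>s. e2 s * (m s * m s))" "integrable (Leb T) (\<lambda>s. \<phi>2 s * (gm s * m s + m s * gm s))"
    by (rule product_rule[OF ie(2) im2' T0 f2 m2]; assumption)+
  have w_L2: "square_integrable (Leb T \<Otimes>\<^sub>M M) (\<lambda>q. w (fst q) (snd q))"
  proof -
    have "square_integrable (Leb T \<Otimes>\<^sub>M M) (\<lambda>q. (B (fst q) / Q (fst q) * \<phi>1 (fst q)) * X (fst q) (snd q))"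
      by (rule square_integrable_fst_cmult[OF _ X_joint_L2]) (intro continuous_intros B Q c, use Q0 in simp)
    moreover have "square_integrable (Leb T \<Otimes>\<^sub>M M) (\<lambda>q. (B (fst q) / Q (fst q) * \<phi>2 (fst q)) * m (fst q))"
      unfolding m_def by (rule square_integrable_fst_cmult[OF _ mean_joint_L2]) (intro continuous_intros B Q c, use Q0 in simp)
    ultimately have "square_integrable (Leb T \<Otimes>\<^sub>M M) (\<lambda>q. u (fst q) (snd q)
       + ((B (fst q) / Q (fst q) * \<phi>1 (fst q)) * X (fst q) (snd q) + (B (fst q) / Q (fst q) * \<phi>2 (fst q)) * m (fst q)))"
      by (intro square_integrable_add u_L2)
    then show ?thesis by (simp add: w_def algebra_simps)
  qed
  obtain K where K: "\<And>s. s \<in> {0..T} \<Longrightarrow> \<bar>Q s\<bar> \<le> K" using coeff_bound[OF Q] by metis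
  have Qsq: "integrable (Leb T \<Otimes>\<^sub>M M) (\<lambda>q. Q (fst q) * (h (fst q) (snd q))\<^sup>2)"
    if "square_integrable (Leb T \<Otimes>\<^sub>M M) (\<lambda>q. h (fst q) (snd q))" for h :: "real \<Rightarrow> 'w \<Rightarrow> real"
    by (rule integrable_bounded_mult[OF coeff_meas[OF Q], of K])
      (use that K in \<open>auto simp: square_integrable_def space_pair_measure\<close>)
  note hu = Qsq[OF u_L2] and hw = Qsq[OF w_L2]
  have iu: "integrable (Leb T) (\<lambda>s. expectation (\<lambda>\<omega>. Q s * (u s \<omega>)\<^sup>2))"
    and iw: "integrable (Leb T) (\<lambda>s. expectation (\<lambda>\<omega>. Q s * (w s \<omega>)\<^sup>2))"
    by (rule time_fubini_integrable[OF fin_M hu] time_fubini_integrable[OF fin_M hw])+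
  \<comment> \<open>the control has a second moment at almost every time only\<close>
  have key: "AE s in Leb T. expectation (\<lambda>\<omega>. Q s * (u s \<omega>)\<^sup>2) + (e1 s * p s + \<phi>1 s * gp s)
      + (e2 s * (m s * m s) + \<phi>2 s * (gm s * m s + m s * gm s)) + e3 s = expectation (\<lambda>\<omega>. Q s * (w s \<omega>)\<^sup>2)"
    using AE_square_integrable_u AE_space
  proof eventually_elim
    case (elim s)
    then have s: "s \<in> {0..T}" by simp
    note XL = X_L2[OF s] and uL = elim(1)
    have ints: "integrable M (X s)" "integrable M (u s)" "integrable M (\<lambda>\<omega>. (X s \<omega>)\<^sup>2)" "integrable M (\<lambda>\<omega>. (u s \<omega>)\<^sup>2)"
      "integrable M (\<lambda>\<omega>. X s \<omega> * u s \<omega>)"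
      using square_integrable_integrable[OF XL] square_integrable_integrable[OF uL] XL uL square_integrable_mult[OF XL uL]
      by (auto simp: square_integrable_def)
    have "expectation (\<lambda>\<omega>. Q s * (w s \<omega>)\<^sup>2) = expectation (\<lambda>\<omega>. Q s * (u s \<omega>)\<^sup>2 + 2 * B s * \<phi>1 s * (X s \<omega> * u s \<omega>)
        + 2 * B s * \<phi>2 s * m s * u s \<omega> + (B s)\<^sup>2 / Q s * (\<phi>1 s)\<^sup>2 * (X s \<omega>)\<^sup>2
        + 2 * (B s)\<^sup>2 / Q s * \<phi>1 s * \<phi>2 s * m s * X s \<omega> + (B s)\<^sup>2 / Q s * (\<phi>2 s)\<^sup>2 * (m s)\<^sup>2)"
      using Q0[OF s] by (intro Bochner_Integration.integral_cong) (auto simp: w_def power2_eq_square field_simps)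
    also have "\<dots> = expectation (\<lambda>\<omega>. Q s * (u s \<omega>)\<^sup>2) + 2 * B s * \<phi>1 s * r s
        + 2 * B s * \<phi>2 s * m s * ub s + (B s)\<^sup>2 / Q s * (\<phi>1 s)\<^sup>2 * p s
        + 2 * (B s)\<^sup>2 / Q s * \<phi>1 s * \<phi>2 s * m s * m s + (B s)\<^sup>2 / Q s * (\<phi>2 s)\<^sup>2 * (m s)\<^sup>2"
      unfolding m_def[of s] ub_def p_def r_def using ints by (simp add: prob_space)
    also have "\<dots> = expectation (\<lambda>\<omega>. Q s * (u s \<omega>)\<^sup>2) + (e1 s * p s + \<phi>1 s * gp s)
      + (e2 s * (m s * m s) + \<phi>2 s * (gm s * m s + m s * gm s)) + e3 s"
      by (simp add: e1_def e2_def e3_def gp_def gm_def power2_eq_square algebra_simps add_divide_distrib)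
    finally show ?case by simp
  qed
  have "?cost = (LINT s|(Leb T). expectation (\<lambda>\<omega>. Q s * (u s \<omega>)\<^sup>2)) + \<phi>1 T * p T + \<phi>2 T * (m T * m T) + \<phi>3 T"
    unfolding time_fubini[OF fin_M hu TT] by (simp add: p_def m_def power2_eq_square)
  also have "\<dots> = ?v0 + ((LINT s|(Leb T). expectation (\<lambda>\<omega>. Q s * (u s \<omega>)\<^sup>2)) + (LINT s|(Leb T). e1 s * p s + \<phi>1 s * gp s)
      + (LINT s|(Leb T). e2 s * (m s * m s) + \<phi>2 s * (gm s * m s + m s * gm s)) + (LINT s|(Leb T). e3 s))"
    unfolding P1 P2 f3[OF TT] by (simp add: power2_eq_square)
  also have "(LINT s|(Leb T). expectation (\<lambda>\<omega>. Q s * (u s \<omega>)\<^sup>2)) + (LINT s|(Leb T). e1 s * p s + \<phi>1 s * gp s)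
      + (LINT s|(Leb T). e2 s * (m s * m s) + \<phi>2 s * (gm s * m s + m s * gm s)) + (LINT s|(Leb T). e3 s)
    = (LINT s|(Leb T). expectation (\<lambda>\<omega>. Q s * (u s \<omega>)\<^sup>2) + (e1 s * p s + \<phi>1 s * gp s)
      + (e2 s * (m s * m s) + \<phi>2 s * (gm s * m s + m s * gm s)) + e3 s)"
    using Bochner_Integration.integral_add[OF iu Bochner_Integration.integrable_add[OF iP1]]
      Bochner_Integration.integral_add[OF Bochner_Integration.integrable_add[OF iu Bochner_Integration.integrable_add[OF iP1]]
        Bochner_Integration.integrable_add[OF iP2]]
      Bochner_Integration.integral_add[OF Bochner_Integration.integrable_add[OF Bochner_Integration.integrable_add[OF iu Bochner_Integration.integrable_add[OF iP1]]
        Bochner_Integration.integrable_add[OF iP2]] ie(3)] by linarith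
  also have "\<dots> = (LINT s|(Leb T). expectation (\<lambda>\<omega>. Q s * (w s \<omega>)\<^sup>2))"
  proof (rule integral_cong_AE[OF _ _ key])
    show "(\<lambda>s. expectation (\<lambda>\<omega>. Q s * (u s \<omega>)\<^sup>2) + (e1 s * p s + \<phi>1 s * gp s)
      + (e2 s * (m s * m s) + \<phi>2 s * (gm s * m s + m s * gm s)) + e3 s) \<in> borel_measurable (Leb T)"
      by (intro borel_measurable_integrable Bochner_Integration.integrable_add iu iP1 iP2 ie)
  qed (use iw in auto)
  also have "\<dots> = ?gap"
    unfolding time_fubini[OF fin_M hw TT, symmetric] by (simp add: w_def m_def)
  finally show "?cost = ?v0 + ?gap" .
  assume opt: "AE s in Leb T. AE \<omega> in M. u s \<omega> = - (B s / Q s) * (\<phi>1 s * X s \<omega> + \<phi>2 s * expectation (X s))"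
  have "?gap = (LINT s|(Leb T). expectation (\<lambda>\<omega>. Q s * (w s \<omega>)\<^sup>2))"
    unfolding time_fubini[OF fin_M hw TT, symmetric] by (simp add: w_def m_def)
  also have "\<dots> = 0"
  proof (rule integral_eq_zero_AE)
    show "AE s in Leb T. expectation (\<lambda>\<omega>. Q s * (w s \<omega>)\<^sup>2) = 0"
      using opt
    proof eventually_elim
      case (elim s)
      show ?case
        by (rule integral_eq_zero_AE) (use elim in \<open>eventually_elim, simp add: w_def m_def\<close>)
    qed
  qed
  finally show "?gap = 0" .
qed

end

section \<open>Regular versions and uniqueness of the state\<close>

lemma set_integral_Leb: "(LINT s:{0..t}|lborel. f s) = (LINT s|(Leb t). f s)" for f :: "real \<Rightarrow> real"
  by (simp add: set_lebesgue_integral_def integral_restrict_space)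

lemma set_nn_integral_Leb: "(\<integral>\<^sup>+s\<in>{0..t}. f s \<partial>lborel) = (\<integral>\<^sup>+s. f s \<partial>Leb t)"
  by (simp add: nn_integral_restrict_space)

lemma square_integrable_cong_AE:
  assumes "square_integrable M f" "g \<in> borel_measurable M" "AE x in M. f x = g x"
  shows "square_integrable M g"
  unfolding square_integrable_def
proof (intro conjI assms(2))
  show "integrable M (\<lambda>x. (g x)\<^sup>2)"
    by (rule integrable_cong_AE_imp[of M "\<lambda>x. (f x)\<^sup>2"])
      (use assms in \<open>auto simp: square_integrable_def elim: eventually_mono\<close>)
qed

context brownian_space
begin

lemma progressive_measurable_joint:
  assumes "progressively_measurable F T u" and T: "0 \<le> T"
  shows "(\<lambda>p. u (fst p) (snd p)) \<in> borel_measurable (Leb T \<Otimes>\<^sub>M M)"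
proof -
  have u: "(\<lambda>(s, \<omega>). u s \<omega>) \<in> borel_measurable (restrict_space borel {0..T} \<Otimes>\<^sub>M F T)"
    using assms by (auto simp: progressively_measurable_def)
  have "(\<lambda>\<omega>. \<omega>) \<in> measurable M (F T)"
    by (rule measurable_from_subalg[OF F_subalgebra[OF T] measurable_ident_sets[OF refl]])
  from measurable_compose[OF measurable_snd this]
  have s: "snd \<in> measurable (Leb T \<Otimes>\<^sub>M M) (F T)" .
  have f: "fst \<in> measurable (Leb T \<Otimes>\<^sub>M M) (restrict_space borel {0..T})"
    using measurable_fst[of "Leb T" M] unfolding measurable_cong_sets[OF refl sets_Leb] .
  from measurable_compose[OF measurable_Pair[OF f s] u] show ?thesis by simp
qed

lemma progressive_adapted:
  assumes u: "progressively_measurable F T u" and s: "s \<in> {0..T}"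
  shows "u s \<in> borel_measurable (F s)"
proof -
  have m: "(\<lambda>(r, \<omega>). u r \<omega>) \<in> borel_measurable (restrict_space borel {0..s} \<Otimes>\<^sub>M F s)"
    using assms by (auto simp: progressively_measurable_def)
  have "s \<in> space (restrict_space borel {0..s})" using s by (simp add: space_restrict_space)
  from measurable_compose[OF measurable_Pair1'[OF this] m] show ?thesis by simp
qed

text \<open>
  At time \<open>0\<close> the isometry gives \<open>E (I 0)\<^sup>2 = 0\<close>; the martingale property carries the vanishing mean to
  time \<open>t\<close>.
\<close>

lemma ito_integral_mean:
  assumes I: "ito_integral M F W T (\<lambda>t \<omega>. \<sigma> t) I" and \<sigma>: "continuous_on {0..T} \<sigma>" and t: "t \<in> {0..T}"
  shows "expectation (I t) = 0"
proof -
  have 0: "0 \<in> {0..T}" using t by auto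
  note I0 = ito_integral_square_integrable[OF I \<sigma> 0]
  have "(LINT s|(Leb 0). (\<sigma> s)\<^sup>2) = 0"
    by (subst Leb_integral_continuous) auto
  then have "expectation (\<lambda>\<omega>. (I 0 \<omega>)\<^sup>2) = 0"
    using ito_isometry[OF I I \<sigma> 0] by (simp add: power2_eq_square)
  then have "AE \<omega> in M. I 0 \<omega> = 0"
    using integral_nonneg_eq_0_iff_AE[of M "\<lambda>\<omega>. (I 0 \<omega>)\<^sup>2"] I0 by (simp add: square_integrable_def)
  then have "expectation (I 0) = 0" by (rule integral_eq_zero_AE)
  moreover have "expectation (\<lambda>\<omega>. I t \<omega> * 1) = expectation (\<lambda>\<omega>. I 0 \<omega> * 1)"
    by (rule ito_martingale[OF I \<sigma>]) (use t in \<open>auto simp: square_integrable_def\<close>)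
  ultimately show ?thesis by simp
qed

end

locale lq_problem = brownian_space M F W
  for M :: "'w measure" and F :: "real \<Rightarrow> 'w measure" and W :: "real \<Rightarrow> 'w \<Rightarrow> real" +
  fixes T :: real and A B \<sigma> Q :: "real \<Rightarrow> real"
  assumes T: "0 < T" and A: "continuous_on {0..T} A" and B: "continuous_on {0..T} B"
    and \<sigma>: "continuous_on {0..T} \<sigma>" and Q: "continuous_on {0..T} Q" and Qpos: "\<And>t. t \<in> {0..T} \<Longrightarrow> 0 < Q t"
begin

text \<open>
  Outside a null set \<open>N\<close> all almost sure properties of a state process hold. On \<open>N\<close> the state and the control
  are replaced by \<open>0\<close> and the Ito integral by \<open>- x\<close>, a choice for which the state equation
  \<open>0 = x + 0 - x\<close> still holds there.
\<close>

lemma state_process_regular_version: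
  assumes u: "progressively_measurable F T u" and X: "state_process M F W T x A B \<sigma> u X"
    and wd: "cost_well_defined M T Q u X"
  obtains u' X' I I' where "linear_state M T x A B \<sigma> u' X' I'"
    and "ito_integral M F W T (\<lambda>t \<omega>. \<sigma> t) I"
    and "AE \<omega> in M. \<forall>t. X' t \<omega> = X t \<omega> \<and> u' t \<omega> = u t \<omega> \<and> I' t \<omega> = I t \<omega>"
proof -
  have T0: "0 \<le> T" using T by simp
  interpret L: finite_measure "Leb T" by (rule finite_measure_Leb)
  interpret P: pair_sigma_finite "Leb T" M by (rule pair_Leb_M)
  have ad: "adapted F T X"
    and path: "AE \<omega> in M. set_integrable lborel {0..T} (\<lambda>s. A s * X s \<omega> + B s * u s \<omega>)"
    using X by (auto simp: state_process_def)
  obtain I where I: "ito_integral M F W T (\<lambda>t \<omega>. \<sigma> t) I"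
    and eq: "AE \<omega> in M. \<forall>t\<in>{0..T}. X t \<omega> = x + (LINT s:{0..t}|lborel. A s * X s \<omega> + B s * u s \<omega>) + I t \<omega>"
    using X unfolding state_process_def by blast
  have Icont: "AE \<omega> in M. continuous_on {0..T} (\<lambda>t. I t \<omega>)"
    using I by (simp add: ito_integral_def)
  note um [measurable] = progressive_measurable_joint[OF u T0]
  have Qinv: "continuous_on {0..T} (\<lambda>t. 1 / Q t)"
    by (intro continuous_intros Q) (use Qpos in force)
  have Q0: "Q t \<noteq> 0" if "t \<in> {0..T}" for t using Qpos[OF that] by simp
  obtain k where k: "\<forall>t\<in>{0..T}. norm (1 / Q t) \<le> k"
    using compact_imp_bounded[OF compact_continuous_image[OF Qinv compact_Icc]]
    unfolding bounded_iff by blast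
  have Qm [measurable]: "(\<lambda>p. Q (fst p)) \<in> borel_measurable (Leb T \<Otimes>\<^sub>M M)"
    by (rule measurable_compose[OF measurable_fst measurable_Leb_continuous[OF Q]])
  have Qim: "(\<lambda>p. 1 / Q (fst p)) \<in> borel_measurable (Leb T \<Otimes>\<^sub>M M)"
    by (rule measurable_compose[OF measurable_fst measurable_Leb_continuous[OF Qinv]])
  \<comment> \<open>dividing by \<open>Q\<close> turns the running cost into an \<open>L\<^sup>2\<close> bound on the control\<close>
  have "(\<integral>\<^sup>+p. ennreal (norm (Q (fst p) * (u (fst p) (snd p))\<^sup>2)) \<partial>(Leb T \<Otimes>\<^sub>M M))
      = (\<integral>\<^sup>+p. ennreal (Q (fst p) * (u (fst p) (snd p))\<^sup>2) \<partial>(Leb T \<Otimes>\<^sub>M M))"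
    using Qpos by (intro nn_integral_cong) (auto simp: space_pair_measure less_imp_le abs_mult)
  also have "\<dots> = (\<integral>\<^sup>+\<omega>. (\<integral>\<^sup>+s. ennreal (Q s * (u s \<omega>)\<^sup>2) \<partial>Leb T) \<partial>M)"
    by (subst P.nn_integral_snd[symmetric]) auto
  also have "\<dots> < \<infinity>"
    using wd unfolding cost_well_defined_def set_nn_integral_Leb by simp
  finally have "integrable (Leb T \<Otimes>\<^sub>M M) (\<lambda>p. Q (fst p) * (u (fst p) (snd p))\<^sup>2)"
    by (intro integrableI_bounded) measurable
  from integrable_bounded_mult[OF Qim _ this, of k]
  have "integrable (Leb T \<Otimes>\<^sub>M M) (\<lambda>p. 1 / Q (fst p) * (Q (fst p) * (u (fst p) (snd p))\<^sup>2))"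
    using k by (auto simp: space_pair_measure)
  then have u2: "integrable (Leb T \<Otimes>\<^sub>M M) (\<lambda>p. (u (fst p) (snd p))\<^sup>2)"
    by (rule Bochner_Integration.integrable_cong[THEN iffD1, rotated -1])
      (use Q0 in \<open>auto simp: space_pair_measure\<close>)
  have um_path: "(\<lambda>s. u s \<omega>) \<in> borel_measurable (Leb T)" if "\<omega> \<in> space M" for \<omega>
    using measurable_compose[OF measurable_Pair2'[OF that] um] by simp
  have upath: "AE \<omega> in M. square_integrable (Leb T) (\<lambda>s. u s \<omega>)"
    using time_fubini_path[OF finite_measure_axioms u2] AE_space
    by eventually_elim (auto simp: square_integrable_def intro: um_path)
  have "AE \<omega> in M. set_integrable lborel {0..T} (\<lambda>s. A s * X s \<omega> + B s * u s \<omega>)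
      \<and> (\<forall>t\<in>{0..T}. X t \<omega> = x + (LINT s:{0..t}|lborel. A s * X s \<omega> + B s * u s \<omega>) + I t \<omega>)
      \<and> continuous_on {0..T} (\<lambda>t. I t \<omega>) \<and> square_integrable (Leb T) (\<lambda>s. u s \<omega>)"
    using path eq Icont upath by eventually_elim blast
  then obtain N where N: "\<And>\<omega>. \<omega> \<in> space M - N \<Longrightarrow>
      set_integrable lborel {0..T} (\<lambda>s. A s * X s \<omega> + B s * u s \<omega>)
      \<and> (\<forall>t\<in>{0..T}. X t \<omega> = x + (LINT s:{0..t}|lborel. A s * X s \<omega> + B s * u s \<omega>) + I t \<omega>)
      \<and> continuous_on {0..T} (\<lambda>t. I t \<omega>) \<and> square_integrable (Leb T) (\<lambda>s. u s \<omega>)" and Nn: "N \<in> null_sets M"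
    by (rule AE_E3) (rule that)
  have N1: "set_integrable lborel {0..T} (\<lambda>s. A s * X s \<omega> + B s * u s \<omega>)"
    and N2: "t \<in> {0..T} \<Longrightarrow> X t \<omega> = x + (LINT s:{0..t}|lborel. A s * X s \<omega> + B s * u s \<omega>) + I t \<omega>"
    and N3: "continuous_on {0..T} (\<lambda>t. I t \<omega>)" and N4: "square_integrable (Leb T) (\<lambda>s. u s \<omega>)"
    if "\<omega> \<in> space M" "\<omega> \<notin> N" for \<omega> t
    using N[of \<omega>] that by blast+
  have [measurable]: "N \<in> sets M" using Nn by auto
  have notN: "AE \<omega> in M. \<omega> \<notin> N" by (rule AE_not_in[OF Nn])
  define X' where "X' t \<omega> = (if \<omega> \<in> N then 0 else X t \<omega>)" for t \<omega>
  define u' where "u' t \<omega> = (if \<omega> \<in> N then 0 else u t \<omega>)" for t \<omega>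
  define I' where "I' t \<omega> = (if \<omega> \<in> N then - x else I t \<omega>)" for t \<omega>
  have same: "AE \<omega> in M. \<forall>t. X' t \<omega> = X t \<omega> \<and> u' t \<omega> = u t \<omega> \<and> I' t \<omega> = I t \<omega>"
    using notN by eventually_elim (auto simp: X'_def u'_def I'_def)
  have XF: "X t \<in> borel_measurable (F t)" if "t \<in> {0..T}" for t
    using ad that by (auto simp: adapted_def)
  have XM [measurable]: "X t \<in> borel_measurable M" if "t \<in> {0..T}" for t
    using F_measurable_M[OF _ XF[OF that]] that by auto
  note IL2 = ito_integral_square_integrable[OF I \<sigma>]
  have IM: "I t \<in> borel_measurable M" if "t \<in> {0..T}" for t
    using IL2[OF that] by (simp add: square_integrable_def)
  have IM' : "I' t \<in> borel_measurable M" if "t \<in> {0..T}" for t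
    using IM[OF that] unfolding I'_def[abs_def] by measurable
  have I'_same: "AE \<omega> in M. I t \<omega> = I' t \<omega>" for t using same by eventually_elim auto
  have IL2': "square_integrable M (I' t)" if "t \<in> {0..T}" for t
    by (rule square_integrable_cong_AE[OF IL2[OF that] IM'[OF that] I'_same])
  have state': "X' t \<omega> = x + (LINT s|(Leb t). A s * X' s \<omega> + B s * u' s \<omega>) + I' t \<omega>"
    if w: "\<omega> \<in> space M" and t: "t \<in> {0..T}" for \<omega> t
  proof (cases "\<omega> \<in> N")
    case False
    then show ?thesis using N2[OF w False t] by (simp add: X'_def u'_def I'_def set_integral_Leb)
  qed (simp add: X'_def u'_def I'_def)
  have cont': "continuous_on {0..T} (\<lambda>t. I' t \<omega>)" "continuous_on {0..T} (\<lambda>t. X' t \<omega>)" if w: "\<omega> \<in> space M" for \<omega>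
  proof -
    show I'c: "continuous_on {0..T} (\<lambda>t. I' t \<omega>)" using N3[OF w] by (cases "\<omega> \<in> N") (simp_all add: I'_def)
    show "continuous_on {0..T} (\<lambda>t. X' t \<omega>)"
    proof (cases "\<omega> \<in> N")
      case False
      define g where "g s = A s * X s \<omega> + B s * u s \<omega>" for s
      have g: "set_integrable lborel {0..T} g" using N1[OF w False] by (simp add: g_def[abs_def])
      have "continuous_on {0..T} (\<lambda>t. x + integral {0..t} g + I t \<omega>)"
        by (intro continuous_intros indefinite_integral_continuous_1 N3[OF w False] set_borel_integral_eq_integral(1)[OF g])
      moreover have "x + integral {0..t} g + I t \<omega> = X' t \<omega>" if t: "t \<in> {0..T}" for t
      proof -
        have "set_integrable lborel {0..t} g"
          by (rule set_integrable_subset[OF g]) (use t in auto)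
        from set_borel_integral_eq_integral(2)[OF this]
        show ?thesis using N2[OF w False t] False by (simp add: X'_def g_def)
      qed
      ultimately show ?thesis by (rule continuous_on_eq)
    qed (simp add: X'_def)
  qed
  have "linear_state M T x A B \<sigma> u' X' I'"
  proof unfold_locales
    show "0 < T" "continuous_on {0..T} A" "continuous_on {0..T} B" "continuous_on {0..T} \<sigma>"
      by (rule T A B \<sigma>)+
    have "square_integrable (Leb T \<Otimes>\<^sub>M M) (\<lambda>p. (if snd p \<in> N then 0 else 1) * u (fst p) (snd p))"
      by (rule square_integrable_bounded_mult[where K=1]) (use u2 in \<open>auto simp: square_integrable_def\<close>)
    then show "square_integrable (Leb T \<Otimes>\<^sub>M M) (\<lambda>p. u' (fst p) (snd p))"
      by (rule back_subst[of "square_integrable (Leb T \<Otimes>\<^sub>M M)"]) (auto simp: u'_def)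
    show "square_integrable (Leb T) (\<lambda>s. u' s \<omega>)" if "\<omega> \<in> space M" for \<omega>
      using N4[OF that] by (cases "\<omega> \<in> N") (simp_all add: u'_def square_integrable_def)
    show "X' t \<in> borel_measurable M" if "t \<in> {0..T}" for t
      using XM[OF that] unfolding X'_def[abs_def] by measurable
    show "continuous_on {0..T} (\<lambda>t. X' t \<omega>)" "continuous_on {0..T} (\<lambda>t. I' t \<omega>)" if "\<omega> \<in> space M" for \<omega>
      using cont'[OF that] by auto
    show "square_integrable M (I' t)" if "t \<in> {0..T}" for t by (rule IL2'[OF that])
    show "expectation (I' t) = 0" if t: "t \<in> {0..T}" for t
      using integral_cong_AE[OF IM[OF t] IM'[OF t] I'_same] ito_integral_mean[OF I \<sigma> t] by simp
    show "expectation (\<lambda>\<omega>. (I' t \<omega>)\<^sup>2) = (LINT s|(Leb t). (\<sigma> s)\<^sup>2)" if t: "t \<in> {0..T}" for t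
    proof -
      have "expectation (\<lambda>\<omega>. (I' t \<omega>)\<^sup>2) = expectation (\<lambda>\<omega>. I t \<omega> * I t \<omega>)"
        by (rule integral_cong_AE) (use IM[OF t] IM'[OF t] I'_same[of t] in \<open>auto simp: power2_eq_square elim: eventually_mono\<close>)
      then show ?thesis using ito_isometry[OF I I \<sigma> t] by simp
    qed
    show "X' t \<omega> = x + (LINT s|(Leb t). A s * X' s \<omega> + B s * u' s \<omega>) + I' t \<omega>"
      if "\<omega> \<in> space M" "t \<in> {0..T}" for \<omega> t by (rule state'[OF that])
    show "expectation (\<lambda>\<omega>. I' t \<omega> * (a * X' s \<omega> + b * u' s \<omega>)) = expectation (\<lambda>\<omega>. I' s \<omega> * (a * X' s \<omega> + b * u' s \<omega>))"
      if st: "0 \<le> s" "s \<le> t" "t \<le> T" and G': "square_integrable M (\<lambda>\<omega>. a * X' s \<omega> + b * u' s \<omega>)" for s t a b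
    proof -
      have t: "t \<in> {0..T}" and s: "s \<in> {0..T}" using st by auto
      define G where "G \<omega> = a * X s \<omega> + b * u s \<omega>" for \<omega>
      have GF: "G \<in> borel_measurable (F s)"
        unfolding G_def[abs_def] using XF[OF s] progressive_adapted[OF u s] by measurable
      have GM: "G \<in> borel_measurable M" by (rule F_measurable_M[OF st(1) GF])
      have GG: "AE \<omega> in M. a * X' s \<omega> + b * u' s \<omega> = G \<omega>"
        using same by eventually_elim (simp add: G_def)
      have GL: "square_integrable M G" by (rule square_integrable_cong_AE[OF G' GM GG])
      have e: "expectation (\<lambda>\<omega>. I' r \<omega> * (a * X' s \<omega> + b * u' s \<omega>)) = expectation (\<lambda>\<omega>. I r \<omega> * G \<omega>)" if r: "r \<in> {0..T}" for r
      proof (rule integral_cong_AE)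
        show "(\<lambda>\<omega>. I' r \<omega> * (a * X' s \<omega> + b * u' s \<omega>)) \<in> borel_measurable M"
          using IM'[OF r] G' by (auto simp: square_integrable_def)
        show "(\<lambda>\<omega>. I r \<omega> * G \<omega>) \<in> borel_measurable M" using IM[OF r] GM by measurable
        show "AE \<omega> in M. I' r \<omega> * (a * X' s \<omega> + b * u' s \<omega>) = I r \<omega> * G \<omega>"
          using same by eventually_elim (simp add: G_def)
      qed
      show ?thesis unfolding e[OF t] e[OF s] by (rule ito_martingale[OF I \<sigma> st GF GL])
    qed
  qed
  from this I same show thesis by (rule that)
qed

text \<open>
  Two states for the same control may be driven by different versions of the Ito integral. These agree
  almost surely at each time, so the time integral of their distance has mean \<open>0\<close>, and Gronwall's
  inequality bounds the distance of the states by it.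
\<close>

lemma state_process_unique:
  assumes u: "progressively_measurable F T u"
    and X: "state_process M F W T x A B \<sigma> u X" "cost_well_defined M T Q u X"
    and Y: "state_process M F W T x A B \<sigma> u Y" "cost_well_defined M T Q u Y"
  shows "AE \<omega> in M. X T \<omega> = Y T \<omega>"
proof -
  obtain u1 X' I I' where lX: "linear_state M T x A B \<sigma> u1 X' I'" and I: "ito_integral M F W T (\<lambda>t \<omega>. \<sigma> t) I"
    and eqX: "AE \<omega> in M. \<forall>t. X' t \<omega> = X t \<omega> \<and> u1 t \<omega> = u t \<omega> \<and> I' t \<omega> = I t \<omega>"
    by (rule state_process_regular_version[OF u X])
  obtain u2 Y' K K' where lY: "linear_state M T x A B \<sigma> u2 Y' K'" and K: "ito_integral M F W T (\<lambda>t \<omega>. \<sigma> t) K"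
    and eqY: "AE \<omega> in M. \<forall>t. Y' t \<omega> = Y t \<omega> \<and> u2 t \<omega> = u t \<omega> \<and> K' t \<omega> = K t \<omega>"
    by (rule state_process_regular_version[OF u Y])
  interpret X: linear_state M T x A B \<sigma> u1 X' I' by fact
  interpret Y: linear_state M T x A B \<sigma> u2 Y' K' by fact
  define d where "d t \<omega> = I' t \<omega> - K' t \<omega>" for t \<omega>
  have TT: "T \<in> {0..T}" using X.T0 by simp
  have d0: "AE \<omega> in M. d t \<omega> = 0" if "t \<in> {0..T}" for t
    using eqX eqY ito_integral_unique[OF I K \<sigma> that] by eventually_elim (simp add: d_def)
  have "square_integrable (Leb T \<Otimes>\<^sub>M M) (\<lambda>p. \<bar>d (fst p) (snd p)\<bar>)"
    unfolding d_def by (intro square_integrable_abs square_integrable_diff X.I_joint_L2 Y.I_joint_L2)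
  then have i: "integrable (Leb T \<Otimes>\<^sub>M M) (\<lambda>p. \<bar>d (fst p) (snd p)\<bar>)"
    by (rule X.PF.square_integrable_integrable)
  have "expectation (\<lambda>\<omega>. \<bar>d s \<omega>\<bar>) = 0" if "s \<in> {0..T}" for s
    by (rule integral_eq_zero_AE) (use d0[OF that] in \<open>eventually_elim, simp\<close>)
  then have "expectation (\<lambda>\<omega>. LINT s|(Leb T). \<bar>d s \<omega>\<bar>) = (LINT s|(Leb T). 0)"
    unfolding time_fubini[OF X.fin_M i TT] by (intro Bochner_Integration.integral_cong) auto
  then have "AE \<omega> in M. (LINT s|(Leb T). \<bar>d s \<omega>\<bar>) = 0"
    using integral_nonneg_eq_0_iff_AE[OF time_fubini_integrable'[OF X.fin_M i TT]] by simp
  then show ?thesis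
    using eqX eqY d0[OF TT] AE_space
  proof eventually_elim
    case (elim \<omega>)
    then have w: "\<omega> \<in> space M" by blast
    define f where "f t = \<bar>X' t \<omega> - Y' t \<omega>\<bar>" for t
    obtain \<alpha> where \<alpha>: "0 \<le> \<alpha>" "\<And>s. s \<in> {0..T} \<Longrightarrow> \<bar>A s\<bar> \<le> \<alpha>" using X.coeff_bound[OF X.A] by metis
    have fc: "continuous_on {0..T} f" unfolding f_def by (intro continuous_intros X.X_cont Y.X_cont w)
    have dc: "continuous_on {0..T} (\<lambda>t. \<bar>d t \<omega>\<bar>)" unfolding d_def by (intro continuous_intros X.I_cont Y.I_cont w)
    have "f T \<le> \<bar>d T \<omega>\<bar> + \<alpha> * exp (\<alpha> * T) * (LINT s|(Leb T). \<bar>d s \<omega>\<bar>)"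
    proof (rule gronwall[OF fc dc _ \<alpha>(1) _ TT])
      fix t assume t: "t \<in> {0..T}"
      note iX = integrable_Leb_initial[OF t X.drift_path[OF w]] and iY = integrable_Leb_initial[OF t Y.drift_path[OF w]]
      have D: "X.drift s \<omega> - Y.drift s \<omega> = A s * (X' s \<omega> - Y' s \<omega>)" for s
        using elim by (simp add: X.drift_def Y.drift_def algebra_simps)
      have "\<bar>LINT s|(Leb t). X.drift s \<omega> - Y.drift s \<omega>\<bar> \<le> (LINT s|(Leb t). \<alpha> * f s)"
        unfolding real_norm_def[symmetric]
      proof (rule Bochner_Integration.integral_norm_bound_integral)
        show "integrable (Leb t) (\<lambda>s. X.drift s \<omega> - Y.drift s \<omega>)" using iX iY by simp
        show "integrable (Leb t) (\<lambda>s. \<alpha> * f s)"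
          using t by (intro integrable_mult_right integrable_Leb_continuous continuous_on_subset[OF fc]) auto
        show "norm (X.drift s \<omega> - Y.drift s \<omega>) \<le> \<alpha> * f s" if "s \<in> space (Leb t)" for s
          unfolding D f_def real_norm_def abs_mult using that t by (intro mult_right_mono \<alpha>(2)) auto
      qed
      moreover have "X' t \<omega> - Y' t \<omega> = (LINT s|(Leb t). X.drift s \<omega> - Y.drift s \<omega>) + d t \<omega>"
        using X.state_eq[OF w t] Y.state_eq[OF w t] Bochner_Integration.integral_diff[OF iX iY]
        by (simp add: X.drift_def Y.drift_def d_def)
      ultimately show "f t \<le> \<bar>d t \<omega>\<bar> + \<alpha> * (LINT s|(Leb t). f s)"
        unfolding f_def by simp
    qed simp
    then have "f T = 0" using elim by (simp add: f_def)
    then show ?case using elim by (simp add: f_def)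
  qed
qed

text \<open>
  \<open>J\<close> is a definite description over all states that belong to \<open>u\<close>. The cost depends on the state
  through its law at time \<open>T\<close> only, so uniqueness of the state makes the description well defined.
\<close>

lemma cost_unique:
  assumes u: "progressively_measurable F T u"
    and X: "state_process M F W T x A B \<sigma> u X" "cost_well_defined M T Q u X"
  shows "J M F W T x A B \<sigma> Q D1 D2 u = cost M T Q D1 D2 u X"
  unfolding J_def
proof (rule the_equality)
  show "\<exists>X'. state_process M F W T x A B \<sigma> u X' \<and> cost_well_defined M T Q u X' \<and>
      cost M T Q D1 D2 u X = cost M T Q D1 D2 u X'"
    using X by blast
  have meas: "Y T \<in> borel_measurable M" if "state_process M F W T x A B \<sigma> u Y" for Y
    using that T by (intro F_measurable_M[of T]) (auto simp: state_process_def adapted_def)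
  fix j assume "\<exists>X. state_process M F W T x A B \<sigma> u X \<and> cost_well_defined M T Q u X \<and> j = cost M T Q D1 D2 u X"
  then obtain Y where Y: "state_process M F W T x A B \<sigma> u Y" "cost_well_defined M T Q u Y"
    and j: "j = cost M T Q D1 D2 u Y" by blast
  have "law M Y T = law M X T"
    unfolding law_def
    by (rule distr_cong_AE[OF refl refl state_process_unique[OF u Y X] meas[OF Y(1)] meas[OF X(1)]])
  then show "j = cost M T Q D1 D2 u X" unfolding j cost_def by simp
qed

end

section \<open>The verification theorem\<close>

locale riccati_solution = lq_problem M F W T A B \<sigma> Q
  for M :: "'w measure" and F :: "real \<Rightarrow> 'w measure" and W :: "real \<Rightarrow> 'w \<Rightarrow> real"
    and T :: real and A B \<sigma> Q :: "real \<Rightarrow> real" +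
  fixes \<phi>1 \<phi>2 \<phi>3 :: "real \<Rightarrow> real"
  assumes \<phi>_cont: "continuous_on {0..T} \<phi>1" "continuous_on {0..T} \<phi>2" "continuous_on {0..T} \<phi>3"
    and \<phi>1: "\<And>t. t \<in> {0<..<T} \<Longrightarrow>
      (\<phi>1 has_real_derivative (B t)\<^sup>2 / Q t * (\<phi>1 t)\<^sup>2 - 2 * A t * \<phi>1 t) (at t)"
    and \<phi>2: "\<And>t. t \<in> {0<..<T} \<Longrightarrow>
      (\<phi>2 has_real_derivative (B t)\<^sup>2 / Q t * (\<phi>2 t)\<^sup>2 + 2 * (B t)\<^sup>2 / Q t * \<phi>1 t * \<phi>2 t - 2 * A t * \<phi>2 t) (at t)"
    and \<phi>3: "\<And>t. t \<in> {0<..<T} \<Longrightarrow> (\<phi>3 has_real_derivative - ((\<sigma> t)\<^sup>2 * \<phi>1 t)) (at t)"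
    and \<phi>3T: "\<phi>3 T = 0"
begin

text \<open>
  The squared distance from the candidate feedback is nonnegative, and vanishes for the candidate.
\<close>

lemma cost_verification:
  assumes u: "progressively_measurable F T u"
    and X: "state_process M F W T x A B \<sigma> u X" and wd: "cost_well_defined M T Q u X"
  shows "\<phi>1 0 * x\<^sup>2 + \<phi>2 0 * x\<^sup>2 + \<phi>3 0 \<le> cost M T Q (\<phi>1 T) (\<phi>2 T) u X"
    and "feedback_form M T (\<lambda>t \<mu> y. - (B t / Q t) * (\<phi>1 t * y + \<phi>2 t * moment 1 \<mu>)) u X \<Longrightarrow>
      cost M T Q (\<phi>1 T) (\<phi>2 T) u X = \<phi>1 0 * x\<^sup>2 + \<phi>2 0 * x\<^sup>2 + \<phi>3 0"
proof -
  obtain u' X' I I' where l: "linear_state M T x A B \<sigma> u' X' I'" and I: "ito_integral M F W T (\<lambda>t \<omega>. \<sigma> t) I"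
    and same: "AE \<omega> in M. \<forall>t. X' t \<omega> = X t \<omega> \<and> u' t \<omega> = u t \<omega> \<and> I' t \<omega> = I t \<omega>"
    by (rule state_process_regular_version[OF u X wd])
  interpret l: linear_state M T x A B \<sigma> u' X' I' by fact
  have TT: "T \<in> {0..T}" using T by simp
  have XM: "X t \<in> borel_measurable M" if "t \<in> {0..T}" for t
    using X that by (intro F_measurable_M[of t]) (auto simp: state_process_def adapted_def)
  have mom: "moment k (law M X t) = expectation (\<lambda>\<omega>. X' t \<omega> ^ k)" if t: "t \<in> {0..T}" for k t
  proof -
    have "moment k (law M X t) = expectation (\<lambda>\<omega>. X t \<omega> ^ k)"
      unfolding moment_def law_def by (rule integral_distr[OF XM[OF t]]) simp
    also have "\<dots> = expectation (\<lambda>\<omega>. X' t \<omega> ^ k)"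
    proof (rule integral_cong_AE)
      show "(\<lambda>\<omega>. X t \<omega> ^ k) \<in> borel_measurable M" "(\<lambda>\<omega>. X' t \<omega> ^ k) \<in> borel_measurable M"
        using XM[OF t] l.X_meas[OF t] by auto
      show "AE \<omega> in M. X t \<omega> ^ k = X' t \<omega> ^ k" using same by eventually_elim simp
    qed
    finally show ?thesis .
  qed
  have run: "expectation (\<lambda>\<omega>. LINT t:{0..T}|lborel. Q t * (u t \<omega>)\<^sup>2) = expectation (\<lambda>\<omega>. LINT s|(Leb T). Q s * (u' s \<omega>)\<^sup>2)"
  proof -
    have i: "integrable (Leb T \<Otimes>\<^sub>M M) (\<lambda>q. Q (fst q) * (u' (fst q) (snd q))\<^sup>2)"
    proof -
      obtain K where K: "\<And>s. s \<in> {0..T} \<Longrightarrow> \<bar>Q s\<bar> \<le> K" using l.coeff_bound[OF Q] by metis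
      show ?thesis
        by (rule integrable_bounded_mult[OF l.coeff_meas[OF Q], of K])
          (use l.u_L2 K in \<open>auto simp: square_integrable_def space_pair_measure\<close>)
    qed
    note m' = borel_measurable_integrable[OF time_fubini_integrable'[OF l.fin_M i TT]]
    have ae: "AE \<omega> in M. (LINT s|(Leb T). Q s * (u' s \<omega>)\<^sup>2) = (LINT t:{0..T}|lborel. Q t * (u t \<omega>)\<^sup>2)"
      unfolding set_integral_Leb using same by eventually_elim simp
    have m: "(\<lambda>\<omega>. LINT t:{0..T}|lborel. Q t * (u t \<omega>)\<^sup>2) \<in> borel_measurable M"
      unfolding set_integral_Leb
    proof (rule l.L.borel_measurable_lebesgue_integral)
      have um: "(\<lambda>p. u (fst p) (snd p)) \<in> borel_measurable (Leb T \<Otimes>\<^sub>M M)"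
        using progressive_measurable_joint[OF u] T by simp
      have "(\<lambda>p. Q (fst p) * (u (fst p) (snd p))\<^sup>2) \<in> borel_measurable (Leb T \<Otimes>\<^sub>M M)"
        using um l.coeff_meas[OF Q] by measurable
      from measurable_compose[OF measurable_pair_swap' this]
      show "(\<lambda>(\<omega>, s). Q s * (u s \<omega>)\<^sup>2) \<in> borel_measurable (M \<Otimes>\<^sub>M Leb T)" by (simp add: case_prod_beta')
    qed
    show ?thesis by (rule integral_cong_AE[OF m m']) (use ae in \<open>auto elim: eventually_mono\<close>)
  qed
  note sq = l.completed_square_cost[OF Q Qpos \<phi>_cont \<phi>1 \<phi>2 \<phi>3]
  let ?gap = "expectation (\<lambda>\<omega>. LINT s|(Leb T). Q s * (u' s \<omega> + B s / Q s * (\<phi>1 s * X' s \<omega> + \<phi>2 s * expectation (X' s)))\<^sup>2)"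
  have cost: "cost M T Q (\<phi>1 T) (\<phi>2 T) u X = \<phi>1 0 * x\<^sup>2 + \<phi>2 0 * x\<^sup>2 + \<phi>3 0 + ?gap"
    using sq(1) \<phi>3T unfolding cost_def run mom[OF TT] by simp
  moreover have "0 \<le> ?gap"
    using Qpos by (intro Bochner_Integration.integral_nonneg) (auto simp: less_imp_le)
  ultimately show "\<phi>1 0 * x\<^sup>2 + \<phi>2 0 * x\<^sup>2 + \<phi>3 0 \<le> cost M T Q (\<phi>1 T) (\<phi>2 T) u X" by linarith
  assume fb: "feedback_form M T (\<lambda>t \<mu> y. - (B t / Q t) * (\<phi>1 t * y + \<phi>2 t * moment 1 \<mu>)) u X"
  have ae: "AE s in Leb T. AE \<omega> in M. u' s \<omega> = - (B s / Q s) * (\<phi>1 s * X' s \<omega> + \<phi>2 s * expectation (X' s))"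
  proof (rule AE_I2)
    fix s assume "s \<in> space (Leb T)"
    then have s: "s \<in> {0..T}" by simp
    have "AE \<omega> in M. u s \<omega> = - (B s / Q s) * (\<phi>1 s * X s \<omega> + \<phi>2 s * moment 1 (law M X s))"
      using fb s unfolding feedback_form_def by blast
    then show "AE \<omega> in M. u' s \<omega> = - (B s / Q s) * (\<phi>1 s * X' s \<omega> + \<phi>2 s * expectation (X' s))"
      using same unfolding mom[OF s] by eventually_elim simp
  qed
  have "?gap = 0" by (rule l.completed_square_cost(2)[OF Q Qpos \<phi>_cont \<phi>1 \<phi>2 \<phi>3 ae])
  with cost show "cost M T Q (\<phi>1 T) (\<phi>2 T) u X = \<phi>1 0 * x\<^sup>2 + \<phi>2 0 * x\<^sup>2 + \<phi>3 0" by simp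
qed

end

lemma C1_differentiable_on_DERIV:
  fixes f :: "real \<Rightarrow> real"
  assumes "f C1_differentiable_on S" "t \<in> S"
  shows "(f has_real_derivative deriv f t) (at t)"
proof -
  obtain D where "(f has_vector_derivative D t) (at t)"
    using assms by (auto simp: C1_differentiable_on_def)
  then have "(f has_real_derivative D t) (at t)"
    by (simp add: has_real_derivative_iff_has_vector_derivative)
  then show ?thesis using DERIV_imp_deriv by metis
qed

theorem theorem3:
  fixes M :: "'w measure" and F :: "real \<Rightarrow> 'w measure" and W :: "real \<Rightarrow> 'w \<Rightarrow> real"
    and T x D1 D2 :: real and A B Q \<sigma> :: "real \<Rightarrow> real"
    and \<phi>1 \<phi>2 \<phi>3 :: "real \<Rightarrow> real"
    and v :: "real \<Rightarrow> real measure \<Rightarrow> real"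
    and a_star :: "real \<Rightarrow> real measure \<Rightarrow> real \<Rightarrow> real"
  assumes "brownian_space M F W"
    and "T > 0"
    and "continuous_on {0..T} A" and "bounded (A ` {0..T})"
    and "continuous_on {0..T} B" and "bounded (B ` {0..T})"
    and "continuous_on {0..T} Q" and "bounded (Q ` {0..T})"
    and "continuous_on {0..T} \<sigma>"
    and "\<And>t. t \<in> {0..T} \<Longrightarrow> Q t > 0"
    and "\<phi>1 C1_differentiable_on {0<..<T}" and "continuous_on {0..T} \<phi>1"
    and "\<phi>2 C1_differentiable_on {0<..<T}" and "continuous_on {0..T} \<phi>2"
    and "\<phi>3 C1_differentiable_on {0<..<T}" and "continuous_on {0..T} \<phi>3"
    and "\<And>t. t \<in> {0<..<T} \<Longrightarrow>
      deriv \<phi>1 t - (B t)\<^sup>2 / Q t * (\<phi>1 t)\<^sup>2 + 2 * A t * \<phi>1 t = 0"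
    and "\<And>t. t \<in> {0<..<T} \<Longrightarrow>
      deriv \<phi>2 t - (B t)\<^sup>2 / Q t * (\<phi>2 t)\<^sup>2 - 2 * (B t)\<^sup>2 / Q t * \<phi>1 t * \<phi>2 t + 2 * A t * \<phi>2 t = 0"
    and "\<And>t. t \<in> {0<..<T} \<Longrightarrow> deriv \<phi>3 t + (\<sigma> t)\<^sup>2 * \<phi>1 t = 0"
    and "\<phi>1 T = D1" and "\<phi>2 T = D2" and "\<phi>3 T = 0"
    and "v = (\<lambda>t \<mu>. \<phi>1 t * moment 2 \<mu> + \<phi>2 t * (moment 1 \<mu>)\<^sup>2 + \<phi>3 t)"
    and "a_star = (\<lambda>t \<mu> y. - (B t / Q t) * (\<phi>1 t * y + \<phi>2 t * moment 1 \<mu>))"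
  shows "solves_master_equation T A B Q \<sigma> v \<and>
    (\<forall>\<mu>\<in>prob_moment 2. v T \<mu> = D1 * moment 2 \<mu> + D2 * (moment 1 \<mu>)\<^sup>2) \<and>
    (\<forall>t\<in>{0<..<T}. \<forall>\<mu>\<in>prob_moment 2. \<forall>y.
       ereal (hamiltonian A B Q t y \<mu> v (a_star t \<mu> y)) = (INF a. ereal (hamiltonian A B Q t y \<mu> v a))) \<and>
    (\<forall>X_star u_star.
       progressively_measurable F T u_star \<and>
       state_process M F W T x A B \<sigma> u_star X_star \<and>
       feedback_form M T a_star u_star X_star \<and>
       cost_well_defined M T Q u_star X_star \<longrightarrow>
         u_star \<in> admissible_controls M F W T x A B \<sigma> Q \<and>
         J M F W T x A B \<sigma> Q D1 D2 u_star = cost M T Q D1 D2 u_star X_star \<and>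
         ereal (J M F W T x A B \<sigma> Q D1 D2 u_star) = optimal_value M F W T x A B \<sigma> Q D1 D2 \<and>
         optimal_value M F W T x A B \<sigma> Q D1 D2 = ereal (v 0 (return borel x)))"
proof -
  interpret brownian_space M F W by fact
  note T = assms(2) and A = assms(3) and B = assms(5) and Q = assms(7) and \<sigma> = assms(9) and Qpos = assms(10)
    and c = assms(12,14,16)
  have d1: "(\<phi>1 has_real_derivative (B t)\<^sup>2 / Q t * (\<phi>1 t)\<^sup>2 - 2 * A t * \<phi>1 t) (at t)" if "t \<in> {0<..<T}" for t
  proof -
    have "deriv \<phi>1 t = (B t)\<^sup>2 / Q t * (\<phi>1 t)\<^sup>2 - 2 * A t * \<phi>1 t"
      using assms(17)[OF that] by linarith
    then show ?thesis using C1_differentiable_on_DERIV[OF assms(11) that] by simp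
  qed
  have d2: "(\<phi>2 has_real_derivative (B t)\<^sup>2 / Q t * (\<phi>2 t)\<^sup>2 + 2 * (B t)\<^sup>2 / Q t * \<phi>1 t * \<phi>2 t - 2 * A t * \<phi>2 t) (at t)"
    if "t \<in> {0<..<T}" for t
  proof -
    have "deriv \<phi>2 t = (B t)\<^sup>2 / Q t * (\<phi>2 t)\<^sup>2 + 2 * (B t)\<^sup>2 / Q t * \<phi>1 t * \<phi>2 t - 2 * A t * \<phi>2 t"
      using assms(18)[OF that] by linarith
    then show ?thesis using C1_differentiable_on_DERIV[OF assms(13) that] by simp
  qed
  have d3: "(\<phi>3 has_real_derivative - ((\<sigma> t)\<^sup>2 * \<phi>1 t)) (at t)" if "t \<in> {0<..<T}" for t
  proof -
    have "deriv \<phi>3 t = - ((\<sigma> t)\<^sup>2 * \<phi>1 t)" using assms(19)[OF that] by linarith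
    then show ?thesis using C1_differentiable_on_DERIV[OF assms(15) that] by simp
  qed
  interpret riccati_solution M F W T A B \<sigma> Q \<phi>1 \<phi>2 \<phi>3
    by unfold_locales (use T A B \<sigma> Q Qpos c d1 d2 d3 assms(22) in auto)
  note D = assms(20,21) and v = assms(23) and a_star = assms(24)
  have master: "solves_master_equation T A B Q \<sigma> v"
    unfolding v by (rule quadratic_solves_master_equation[OF _ d1 d2 d3]) (use Qpos in auto)
  have terminal: "\<forall>\<mu>\<in>prob_moment 2. v T \<mu> = D1 * moment 2 \<mu> + D2 * (moment 1 \<mu>)\<^sup>2"
    by (simp add: v D \<phi>3T)
  have optimality: "ereal (hamiltonian A B Q t y \<mu> v (a_star t \<mu> y)) = (INF a. ereal (hamiltonian A B Q t y \<mu> v a))"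
    if t: "t \<in> {0<..<T}" and \<mu>: "\<mu> \<in> prob_moment 2" for t \<mu> y
  proof (rule antisym)
    have "hamiltonian A B Q t y \<mu> v (a_star t \<mu> y) \<le> hamiltonian A B Q t y \<mu> v a" for a
      unfolding v a_star by (rule hamiltonian_minimizer[OF _ \<mu>]) (use Qpos t in auto)
    then show "ereal (hamiltonian A B Q t y \<mu> v (a_star t \<mu> y)) \<le> (INF a. ereal (hamiltonian A B Q t y \<mu> v a))"
      by (intro INF_greatest) simp
  qed (rule INF_lower, simp)
  let ?J = "J M F W T x A B \<sigma> Q D1 D2"
  have v0: "v 0 (return borel x) = \<phi>1 0 * x\<^sup>2 + \<phi>2 0 * x\<^sup>2 + \<phi>3 0"
    by (simp add: v return_prob_moment(2))
  have J_cost: "?J u = cost M T Q D1 D2 u X"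
    if "progressively_measurable F T u" "state_process M F W T x A B \<sigma> u X" "cost_well_defined M T Q u X" for u X
    by (rule cost_unique[OF that])
  have lower: "ereal (v 0 (return borel x)) \<le> optimal_value M F W T x A B \<sigma> Q D1 D2"
    unfolding optimal_value_def
  proof (rule INF_greatest)
    fix u assume "u \<in> admissible_controls M F W T x A B \<sigma> Q"
    then obtain X where u: "progressively_measurable F T u" "state_process M F W T x A B \<sigma> u X" "cost_well_defined M T Q u X"
      unfolding admissible_controls_def by blast
    show "ereal (v 0 (return borel x)) \<le> ereal (?J u)"
      using cost_verification(1)[OF u] unfolding J_cost[OF u] v0 D by simp
  qed
  have verification: "u \<in> admissible_controls M F W T x A B \<sigma> Q \<and> ?J u = cost M T Q D1 D2 u X \<and>
      ereal (?J u) = optimal_value M F W T x A B \<sigma> Q D1 D2 \<and>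
      optimal_value M F W T x A B \<sigma> Q D1 D2 = ereal (v 0 (return borel x))"
    if u: "progressively_measurable F T u" "state_process M F W T x A B \<sigma> u X" "cost_well_defined M T Q u X"
      and fb: "feedback_form M T a_star u X" for u X
  proof -
    have "\<forall>t \<mu>. a_star t \<mu> \<in> borel_measurable borel" unfolding a_star by simp
    then have adm: "u \<in> admissible_controls M F W T x A B \<sigma> Q"
      unfolding admissible_controls_def using u fb by blast
    have val: "?J u = v 0 (return borel x)"
      using cost_verification(2)[OF u fb[unfolded a_star]] unfolding J_cost[OF u] v0 D by simp
    have "optimal_value M F W T x A B \<sigma> Q D1 D2 \<le> ereal (?J u)"
      unfolding optimal_value_def by (rule INF_lower[OF adm])
    with lower val have "optimal_value M F W T x A B \<sigma> Q D1 D2 = ereal (v 0 (return borel x))"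
      by (simp add: antisym)
    with adm val J_cost[OF u] show ?thesis by simp
  qed
  show ?thesis
    using master terminal optimality verification by blast
qed

end
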